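(* Let $\mathcal{M}\subset\mathbb{R}^m$ be a compact smooth $d$-dimensional embedded submanifold (without boundary), equipped with the Riemannian metric and volume form $dV$ induced from $\mathbb{R}^m$, and let $x_1,x_2,\dots$ be i.i.d. samples from a smooth, strictly positive density $p$ on $\mathcal{M}$ with respect to $dV$. Let $\mathcal{N}\subset\mathbb{R}^n$ be a smooth $d_{\mathcal{N}}$-dimensional embedded submanifold and $\mathcal{H}:\mathcal{M}\to\mathcal{N}$ a smooth map; set $y_j=\mathcal{H}(x_j)$. Fix $x\in\mathcal{M}$, put $y=\mathcal{H}(x)$, and for $\epsilon>0$ and $N\in\mathbb{N}$ define $$D(x)=\sum_{i=1}^N \exp\!\Big(-\frac{\|x_i-x\|^2}{2\epsilon}\Big),$$ the $m\times N$ matrix $X$ with $j$-th column $X_j = D(x)^{-1/2}\exp\!\big(-\frac{\|x_j-x\|^2}{4\epsilon}\big)(x_j-x)$, and the $n\times N$ matrix $Y$ with $j$-th column $Y_j = D(x)^{-1/2}\exp\!\big(-\frac{\|x_j-x\|^2}{4\epsilon}\big)(y_j-y)$. Then there is a matrix $R_{\mathcal{H}}(x)\in\mathbb{R}^{n\times m}$, independent of $\epsilon$, such that (almost surely) $$\lim_{N\to\infty}\frac{1}{\epsilon}YX^\top = D\hat{\mathcal{H}}(x)+\epsilon R_{\mathcal{H}}(x)+\mathcal{O}(\epsilon^2)\quad\text{as }\epsilon\to0,$$ where $D\hat{\mathcal{H}}(x)=\mathcal{I}_{\mathcal{N}}(\mathcal{H}(x))^\top D\mathcal{H}(x)\,\mathcal{I}(x)\in\mathbb{R}^{n\times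 m}$.
   Context: $\mathcal{I}(x)$ is the $d\times m$ matrix whose rows form an orthonormal basis of the tangent space $T_x\mathcal{M}\subset\mathbb{R}^m$, so $\mathcal{I}(x)\mathcal{I}(x)^\top=I_{d\times d}$ and $\mathcal{I}(x)$ maps $\mathbb{R}^m$ onto $T_x\mathcal{M}$ (in these coordinates), killing vectors orthogonal to $T_x\mathcal{M}$. Similarly $\mathcal{I}_{\mathcal{N}}(z)$ is the $d_{\mathcal{N}}\times n$ matrix whose rows form an orthonormal basis of $T_z\mathcal{N}\subset\mathbb{R}^n$. $D\mathcal{H}(x)$ is the $d_{\mathcal{N}}\times d$ matrix of the differential $T_x\mathcal{M}\to T_{\mathcal{H}(x)}\mathcal{N}$ with respect to these orthonormal bases. Thus $D\hat{\mathcal{H}}(x)$ is the differential of $\mathcal{H}$ viewed as a map $\mathbb{R}^m\to\mathbb{R}^n$ that vanishes on the normal space $T_x\mathcal{M}^\perp$. *)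

theory Defs
  imports "HOL-Analysis.Analysis" "HOL-Probability.Probability"
begin

fun iter_dderiv :: "'a list \<Rightarrow> ('a::real_normed_vector \<Rightarrow> 'b::real_normed_vector) \<Rightarrow> 'a \<Rightarrow> 'b" where
  "iter_dderiv [] f = f"
| "iter_dderiv (v # vs) f = (\<lambda>z. frechet_derivative (iter_dderiv vs f) (at z) v)"

definition C_inf_on :: "'a::euclidean_space set \<Rightarrow> ('a \<Rightarrow> 'b::real_normed_vector) \<Rightarrow> bool" where
  "C_inf_on S f \<longleftrightarrow> open S \<and> (\<forall>vs. \<forall>z\<in>S. iter_dderiv vs f differentiable (at z))"

definition manifold_chart ::
  "'d::finite itself \<Rightarrow> (real^'m) set \<Rightarrow> (real^'m) set \<Rightarrow> (real^'d) set \<Rightarrow> (real^'d \<Rightarrow> real^'m) \<Rightarrow> bool" where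
  "manifold_chart t M U V \<phi> \<longleftrightarrow> open U \<and> open V \<and> C_inf_on V \<phi> \<and>
     (\<exists>\<psi>. homeomorphism V (M \<inter> U) \<phi> \<psi>) \<and> (\<forall>a\<in>V. inj (frechet_derivative \<phi> (at a)))"

definition smooth_embedded_submanifold :: "'d::finite itself \<Rightarrow> (real^'m) set \<Rightarrow> bool" where
  "smooth_embedded_submanifold t M \<longleftrightarrow>
     (\<forall>q\<in>M. \<exists>U V (\<phi>::real^'d \<Rightarrow> real^'m). q \<in> U \<and> manifold_chart t M U V \<phi>)"

definition smooth_map_on :: "(real^'m) set \<Rightarrow> (real^'m \<Rightarrow> 'b::real_normed_vector) \<Rightarrow> bool" where
  "smooth_map_on M f \<longleftrightarrow>
     (\<forall>q\<in>M. \<exists>U G. open U \<and> q \<in> U \<and> C_inf_on U G \<and> (\<forall>z\<in>M \<inter> U. G z = f z))"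

definition riemannian_volume :: "'d::finite itself \<Rightarrow> (real^'m) set \<Rightarrow> (real^'m) measure \<Rightarrow> bool" where
  "riemannian_volume t M \<mu> \<longleftrightarrow> sets \<mu> = sets borel \<and> emeasure \<mu> (UNIV - M) = 0 \<and>
     (\<forall>U V (\<phi>::real^'d \<Rightarrow> real^'m) A. manifold_chart t M U V \<phi> \<and> A \<in> sets lborel \<and> A \<subseteq> V \<longrightarrow>
        emeasure \<mu> (\<phi> ` A) =
          (\<integral>\<^sup>+a\<in>A. ennreal (sqrt (det (transpose (matrix (frechet_derivative \<phi> (at a)))
                                    ** matrix (frechet_derivative \<phi> (at a))))) \<partial>lborel))"

definition tangent_space :: "(real^'m) set \<Rightarrow> real^'m \<Rightarrow> (real^'m) set" where
  "tangent_space M z = {v. \<exists>(\<gamma>::real \<Rightarrow> real^'m) e. e > 0 \<and> (\<forall>t. \<bar>t\<bar> < e \<longrightarrow> \<gamma> t \<in> M) \<and>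
      \<gamma> 0 = z \<and> (\<gamma> has_vector_derivative v) (at 0)}"

definition differential :: "(real^'m) set \<Rightarrow> (real^'m \<Rightarrow> real^'n) \<Rightarrow> real^'m \<Rightarrow> real^'m \<Rightarrow> real^'n" where
  "differential M H z v = (THE w. \<forall>(\<gamma>::real \<Rightarrow> real^'m) e. e > 0 \<and> (\<forall>t. \<bar>t\<bar> < e \<longrightarrow> \<gamma> t \<in> M) \<and>
      \<gamma> 0 = z \<and> (\<gamma> has_vector_derivative v) (at 0) \<longrightarrow> ((H \<circ> \<gamma>) has_vector_derivative w) (at 0))"

definition tangent_basis :: "'d::finite itself \<Rightarrow> (real^'m) set \<Rightarrow> real^'m \<Rightarrow> real^'m^'d" where
  "tangent_basis t M z = (SOME B. (\<forall>i j. B $ i \<bullet> B $ j = (if i = j then 1 else 0)) \<and>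
      span (range (\<lambda>i. B $ i)) = tangent_space M z)"

definition DH_matrix :: "'d::finite itself \<Rightarrow> 'e::finite itself \<Rightarrow> (real^'m) set \<Rightarrow> (real^'n) set \<Rightarrow>
    (real^'m \<Rightarrow> real^'n) \<Rightarrow> real^'m \<Rightarrow> real^'d^'e" where
  "DH_matrix t s M N H z = (\<chi> a b. tangent_basis s N (H z) $ a \<bullet> differential M H z (tangent_basis t M z $ b))"

definition DH_hat :: "'d::finite itself \<Rightarrow> 'e::finite itself \<Rightarrow> (real^'m) set \<Rightarrow> (real^'n) set \<Rightarrow>
    (real^'m \<Rightarrow> real^'n) \<Rightarrow> real^'m \<Rightarrow> real^'m^'n" where
  "DH_hat t s M N H z = transpose (tangent_basis s N (H z)) ** DH_matrix t s M N H z ** tangent_basis t M z"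

text \<open>Samples x_1, ..., x_N are xs 0, ..., xs (N-1).\<close>
definition kernel_sum :: "real \<Rightarrow> real^'m \<Rightarrow> (nat \<Rightarrow> real^'m) \<Rightarrow> nat \<Rightarrow> real" where
  "kernel_sum \<epsilon> z xs Nn = (\<Sum>i<Nn. exp (- (norm (xs i - z))\<^sup>2 / (2 * \<epsilon>)))"

definition colX :: "real \<Rightarrow> real^'m \<Rightarrow> (nat \<Rightarrow> real^'m) \<Rightarrow> nat \<Rightarrow> nat \<Rightarrow> real^'m" where
  "colX \<epsilon> z xs Nn j = (1 / sqrt (kernel_sum \<epsilon> z xs Nn) * exp (- (norm (xs j - z))\<^sup>2 / (4 * \<epsilon>))) *\<^sub>R (xs j - z)"

definition colY :: "real \<Rightarrow> real^'m \<Rightarrow> (nat \<Rightarrow> real^'m) \<Rightarrow> (real^'m \<Rightarrow> real^'n) \<Rightarrow> nat \<Rightarrow> nat \<Rightarrow> real^'n" where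
  "colY \<epsilon> z xs H Nn j = (1 / sqrt (kernel_sum \<epsilon> z xs Nn) * exp (- (norm (xs j - z))\<^sup>2 / (4 * \<epsilon>))) *\<^sub>R (H (xs j) - H z)"

definition emp_YXt :: "real \<Rightarrow> real^'m \<Rightarrow> (nat \<Rightarrow> real^'m) \<Rightarrow> (real^'m \<Rightarrow> real^'n) \<Rightarrow> nat \<Rightarrow> real^'m^'n" where
  "emp_YXt \<epsilon> z xs H Nn = (\<chi> a b. \<Sum>j<Nn. colY \<epsilon> z xs H Nn j $ a * colX \<epsilon> z xs Nn j $ b)"

end

theory Submission
  imports Defs
begin

text \<open>
  By the strong law of large numbers, the entry \<open>(i, j)\<close> of the empirical matrix converges almost surely to
  the quotient of \<open>E[k (H(X) - H(x))\<^sub>i (X - x)\<^sub>j]\<close> and \<open>\<epsilon> E[k]\<close>, where \<open>X\<close> has law \<open>p dV\<close> and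
  \<open>k = exp (- |X - x|\<^sup>2 / (2 \<epsilon>))\<close>. In a chart \<open>\<phi>\<close> with \<open>\<phi>(a) = x\<close>, the substitution \<open>a + s u\<close> with
  \<open>s = sqrt \<epsilon>\<close> turns both expectations into Gaussian integrals with weight \<open>exp (- |A u|\<^sup>2 / 2)\<close>,
  \<open>A = D\<phi>(a)\<close>, of functions that have a Taylor expansion in \<open>s\<close>. The coefficient of \<open>s ^ k\<close> has the
  parity of \<open>k\<close> in \<open>u\<close>, so odd powers of \<open>s\<close> integrate to zero and the expansion is one in \<open>\<epsilon>\<close>.
  The leading coefficient is the second moment \<open>E[(DH A u)\<^sub>i (A u)\<^sub>j]\<close>, which integration by parts identifies with
  \<open>DH\<close> composed with the orthogonal projection onto the tangent space \<open>range A\<close>.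
\<close>

section \<open>Strong law for bounded samples\<close>

text \<open>Three features shape the proof. In the chart the exponent is
  \<open>- q (s u) / (2 s^2)\<close> with limit \<open>- |A u|^2 / 2\<close>. Its deviation from the
  limit is of order \<open>s\<close> but grows with \<open>u\<close>, so replacing the exponential
  by a Taylor polynomial is safe only because \<open>|\<phi> (a + h) - x|^2 \<ge> c |h|^2\<close>
  near \<open>a\<close> keeps a Gaussian majorant. An error of order \<open>\<epsilon>^2\<close>
  means order four in \<open>s\<close>; products that start with \<open>s^2\<close> are therefore
  expanded to order six, since dividing by \<open>s^2\<close> costs two orders. Finally, one chart
  is enough: points of \<open>M\<close> away from \<open>x\<close> contribute less than any power of
  \<open>s\<close>, and the leading terms of both expectations carry the same factor
  (\<open>p\<close> at \<open>x\<close>, volume density, Gaussian mass), which cancels in the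
  quotient. The data \<open>p\<close> and \<open>H\<close> are controlled on \<open>M\<close> only,
  where the samples lie almost surely; off \<open>M\<close> they are replaced by zero to obtain
  Borel functions. The limit in \<open>N\<close> is deterministic for each \<epsilon>, so the
  exceptional null set may depend on \<epsilon>.\<close>

lemma bounded_iid_strong_law:
  fixes X :: "nat \<Rightarrow> 'w \<Rightarrow> real"
  assumes "prob_space P"
    and indep: "prob_space.indep_vars P (\<lambda>_. borel) X UNIV"
    and distr: "\<And>i. distr P borel (X i) = \<nu>"
    and bounded: "AE t in \<nu>. \<bar>t\<bar> \<le> B"
  shows "AE \<omega> in P. (\<lambda>n. (\<Sum>i<n. X i \<omega>) / real n) \<longlonglongrightarrow> (\<integral>t. t \<partial>\<nu>)"
proof -
  interpret prob_space P by fact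
  have X[measurable]: "random_variable borel (X i)" for i
    using indep unfolding indep_vars_def by blast
  \<comment> \<open>With \<open>B = 0\<close> the Hoeffding exponent would divide by zero and give
    \<open>r = 1\<close>; the added 1 keeps \<open>r < 1\<close>.\<close>
  define B' where "B' = \<bar>B\<bar> + 1"
  have bd: "AE \<omega> in P. X i \<omega> \<in> {- B'..B'}" for i
  proof -
    have "AE \<omega> in P. \<bar>X i \<omega>\<bar> \<le> B"
      using bounded unfolding distr[of i, symmetric] by (subst (asm) AE_distr_iff) auto
    then show ?thesis by eventually_elim (auto simp: B'_def)
  qed
  have mean: "(\<integral>t. t \<partial>\<nu>) = expectation (X 0)"
    unfolding distr[of 0, symmetric] by (subst integral_distr) auto
  define m where "m = expectation (X 0)"
  \<comment> \<open>Boundedness admits Hoeffding's inequality, whose deviation probabilities decay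
    geometrically in \<open>n\<close>; they are summable, so Borel-Cantelli applies.\<close>
  have dev: "AE \<omega> in P. eventually (\<lambda>n. \<bar>(\<Sum>i<n. X i \<omega>) / real n - m\<bar> < e) sequentially"
    if "e > 0" for e
  proof -
    define A where "A n = {\<omega>\<in>space P. \<bar>(\<Sum>i<n. X i \<omega>) / real n - m\<bar> \<ge> e}" for n
    define r where "r = exp (- (2 * e\<^sup>2 / (B' - (- B'))\<^sup>2))"
    have r: "0 < r" "r < 1" using \<open>e > 0\<close> by (auto simp: r_def B'_def)
    have "prob (A n) \<le> 2 * r ^ n" if "n > 0" for n
    proof -
      interpret Hoeffding_ineq_iid P "{..<n}" X "X 0" "- B'" B' m
      proof unfold_locales
        show "indep_vars (\<lambda>_. borel) X {..<n}"
          using indep by (rule indep_vars_subset) auto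
        show "distr P borel (X i) = distr P borel (X 0)" for i
          by (simp add: distr)
      qed (use bd in \<open>auto simp: m_def\<close>)
      have "prob (A n) \<le> 2 * exp (- 2 * real n * e\<^sup>2 / (B' - (- B'))\<^sup>2)"
        using Hoeffding_ineq_abs_ge'[of e] that \<open>e > 0\<close>
        by (simp add: A_def B'_def lessThan_empty_iff)
      also have "exp (- 2 * real n * e\<^sup>2 / (B' - (- B'))\<^sup>2) = r ^ n"
        unfolding r_def exp_of_nat_mult[symmetric] by (simp add: field_simps)
      finally show ?thesis .
    qed
    then have bound: "norm (prob (A n)) \<le> 2 * r ^ n" if "n \<ge> 1" for n
      using that by simp
    have "summable (\<lambda>n. 2 * r ^ n)"
      using r by (intro summable_mult summable_geometric) simp
    from summable_comparison_test'[OF this bound] have "summable (\<lambda>n. prob (A n))" .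
    then have "AE \<omega> in P. eventually (\<lambda>n. \<omega> \<in> space P - A n) sequentially"
      by (intro borel_cantelli_AE1) (simp_all add: A_def emeasure_eq_measure)
    then show ?thesis
      by eventually_elim (auto simp: A_def not_le elim!: eventually_mono)
  qed
  \<comment> \<open>Countably many tolerances suffice for convergence, so their exceptional null
    sets can be united.\<close>
  have "AE \<omega> in P. \<forall>k. eventually (\<lambda>n. \<bar>(\<Sum>i<n. X i \<omega>) / real n - m\<bar> < 1 / Suc k) sequentially"
    unfolding AE_all_countable by (intro allI dev) auto
  then show ?thesis
  proof eventually_elim
    case (elim \<omega>)
    show ?case
      unfolding mean m_def[symmetric] tendsto_iff dist_real_def
    proof (intro allI impI)
      fix e :: real assume "e > 0"
      then obtain k where "1 / Suc k < e" using nat_approx_posE by blast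
      with elim[rule_format, of k] show "eventually (\<lambda>n. \<bar>(\<Sum>i<n. X i \<omega>) / real n - m\<bar> < e) sequentially"
        by (auto elim!: eventually_mono)
    qed
  qed
qed

section \<open>Expansions in the scale parameter\<close>

text \<open>For fixed \<open>s\<close> the variable \<open>u\<close> runs over a ball of radius
  \<open>\<rho> / s\<close>, which exhausts the space as \<open>s\<close> tends to 0. The
  restriction \<open>s \<le> 1\<close> makes all powers of \<open>s\<close> bounded.\<close>

definition scaled_ball :: "real \<Rightarrow> (real \<times> 'a::real_normed_vector) set" where
  "scaled_ball \<rho> = {(s, u). 0 < s \<and> s \<le> 1 \<and> norm (s *\<^sub>R u) < \<rho>}"

text \<open>The constants do not depend on \<open>s\<close>, and growth of this kind is absorbed by
  any Gaussian weight.\<close>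

definition poly_bdd :: "(real \<times> 'a::real_normed_vector) set \<Rightarrow> (real \<Rightarrow> 'a \<Rightarrow> real) \<Rightarrow> bool" where
  "poly_bdd D r \<longleftrightarrow> (\<exists>C M. \<forall>s u. (s, u) \<in> D \<longrightarrow> \<bar>r s u\<bar> \<le> C * (1 + norm u) ^ M)"

section \<open>Algebra of polynomially bounded functions\<close>

lemma poly_bddI:
  assumes "\<And>s u. (s, u) \<in> D \<Longrightarrow> \<bar>r s u\<bar> \<le> C * (1 + norm u) ^ M"
  shows "poly_bdd D r"
  using assms unfolding poly_bdd_def by blast

lemma poly_bddE:
  assumes "poly_bdd D r"
  obtains C M where "C \<ge> 0" "\<And>s u. (s, u) \<in> D \<Longrightarrow> \<bar>r s u\<bar> \<le> C * (1 + norm u) ^ M"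
proof -
  from assms obtain C M where *: "\<And>s u. (s, u) \<in> D \<Longrightarrow> \<bar>r s u\<bar> \<le> C * (1 + norm u) ^ M"
    unfolding poly_bdd_def by blast
  have "\<bar>r s u\<bar> \<le> \<bar>C\<bar> * (1 + norm u) ^ M" if "(s, u) \<in> D" for s u
    using *[OF that] by (rule order_trans) (intro mult_right_mono, auto)
  then show ?thesis by (intro that[of "\<bar>C\<bar>"]) auto
qed

lemma poly_bdd_mono: "poly_bdd D r \<Longrightarrow> D' \<subseteq> D \<Longrightarrow> poly_bdd D' r"
  unfolding poly_bdd_def by blast

lemma poly_bdd_le:
  assumes "poly_bdd D r'" "\<And>s u. (s, u) \<in> D \<Longrightarrow> \<bar>r s u\<bar> \<le> \<bar>r' s u\<bar>"
  shows "poly_bdd D r"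
  using assms unfolding poly_bdd_def by (meson order_trans)

lemma poly_bdd_const: "poly_bdd D (\<lambda>_ _. a)"
  by (rule poly_bddI[of _ _ "\<bar>a\<bar>" 0]) auto

lemma poly_bdd_norm: "poly_bdd D (\<lambda>_ u. norm u)"
  by (rule poly_bddI[of _ _ 1 1]) auto

lemma poly_bdd_add:
  assumes "poly_bdd D r" "poly_bdd D r'"
  shows "poly_bdd D (\<lambda>s u. r s u + r' s u)"
proof -
  obtain C M where 1: "C \<ge> 0" "\<And>s u. (s, u) \<in> D \<Longrightarrow> \<bar>r s u\<bar> \<le> C * (1 + norm u) ^ M"
    by (rule poly_bddE[OF assms(1)]) blast
  obtain C' M' where 2: "C' \<ge> 0" "\<And>s u. (s, u) \<in> D \<Longrightarrow> \<bar>r' s u\<bar> \<le> C' * (1 + norm u) ^ M'"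
    by (rule poly_bddE[OF assms(2)]) blast
  have "\<bar>r s u + r' s u\<bar> \<le> (C + C') * (1 + norm u) ^ (M + M')" if "(s, u) \<in> D" for s u
  proof -
    have "(1 + norm u) ^ M \<le> (1 + norm u) ^ (M + M')" "(1 + norm u) ^ M' \<le> (1 + norm u) ^ (M + M')"
      by (auto intro!: power_increasing)
    then have "C * (1 + norm u) ^ M + C' * (1 + norm u) ^ M' \<le> (C + C') * (1 + norm u) ^ (M + M')"
      unfolding distrib_right using 1(1) 2(1) by (intro add_mono mult_left_mono)
    with 1(2)[OF that] 2(2)[OF that] show ?thesis by linarith
  qed
  then show ?thesis by (rule poly_bddI)
qed

lemma poly_bdd_mult:
  assumes "poly_bdd D r" "poly_bdd D r'"
  shows "poly_bdd D (\<lambda>s u. r s u * r' s u)"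
proof -
  obtain C M where 1: "C \<ge> 0" "\<And>s u. (s, u) \<in> D \<Longrightarrow> \<bar>r s u\<bar> \<le> C * (1 + norm u) ^ M"
    by (rule poly_bddE[OF assms(1)]) blast
  obtain C' M' where 2: "C' \<ge> 0" "\<And>s u. (s, u) \<in> D \<Longrightarrow> \<bar>r' s u\<bar> \<le> C' * (1 + norm u) ^ M'"
    by (rule poly_bddE[OF assms(2)]) blast
  have "\<bar>r s u * r' s u\<bar> \<le> (C * C') * (1 + norm u) ^ (M + M')" if "(s, u) \<in> D" for s u
  proof -
    have "\<bar>r s u\<bar> * \<bar>r' s u\<bar> \<le> (C * (1 + norm u) ^ M) * (C' * (1 + norm u) ^ M')"
      using 1 2 that by (intro mult_mono) auto
    then show ?thesis by (simp add: abs_mult power_add algebra_simps)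
  qed
  then show ?thesis by (rule poly_bddI)
qed

lemma poly_bdd_sum:
  "(\<And>i. i \<in> I \<Longrightarrow> poly_bdd D (r i)) \<Longrightarrow> poly_bdd D (\<lambda>s u. \<Sum>i\<in>I. r i s u)"
  by (induction I rule: infinite_finite_induct) (auto intro: poly_bdd_add poly_bdd_const)

lemma poly_bdd_power: "poly_bdd D r \<Longrightarrow> poly_bdd D (\<lambda>s u. r s u ^ k)"
  by (induction k) (auto intro: poly_bdd_mult poly_bdd_const)

lemma poly_bdd_scale: "poly_bdd (scaled_ball \<rho>) (\<lambda>s u. s ^ k)"
  by (rule poly_bddI[of _ _ 1 0]) (auto simp: scaled_ball_def power_le_one)

text \<open>Continuity is there for measurability, growth for integrability against Gaussian
  weights, parity for the cancellation of odd orders. Homogeneity of degree \<open>k\<close> would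
  be lost when an expansion is divided by \<open>s ^ m\<close> in \<open>sexp_shift\<close>; parity
  survives for even \<open>m\<close>.\<close>

definition coef :: "nat \<Rightarrow> ('a::real_normed_vector \<Rightarrow> real) \<Rightarrow> bool" where
  "coef k c \<longleftrightarrow> continuous_on UNIV c \<and> (\<forall>u. c (- u) = (- 1) ^ k * c u) \<and> poly_bdd UNIV (\<lambda>_. c)"

lemma coef_zero: "coef k (\<lambda>_. 0)"
  by (auto simp: coef_def poly_bdd_const)

lemma coef_const: "coef 0 (\<lambda>_. a)"
  by (auto simp: coef_def poly_bdd_const)

lemma coef_add: "coef k c \<Longrightarrow> coef k d \<Longrightarrow> coef k (\<lambda>u. c u + d u)"
  by (auto simp: coef_def algebra_simps intro!: continuous_intros poly_bdd_add)

lemma coef_sum: "(\<And>i. i \<in> I \<Longrightarrow> coef k (c i)) \<Longrightarrow> coef k (\<lambda>u. \<Sum>i\<in>I. c i u)"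
  by (induction I rule: infinite_finite_induct) (auto intro: coef_add coef_zero)

lemma coef_mult: "coef i c \<Longrightarrow> coef j d \<Longrightarrow> coef (i + j) (\<lambda>u. c u * d u)"
  by (auto simp: coef_def power_add intro!: continuous_intros poly_bdd_mult)

lemma coef_linear:
  fixes l :: "'a::euclidean_space \<Rightarrow> real"
  assumes "linear l"
  shows "coef 1 l"
proof -
  have bl: "bounded_linear l" using assms by (simp add: linear_conv_bounded_linear)
  obtain K where K: "\<And>u. norm (l u) \<le> norm u * K" using bounded_linear.bounded[OF bl] by blast
  have "poly_bdd UNIV (\<lambda>_::real. l)"
  proof (rule poly_bddI[of _ _ "\<bar>K\<bar>" 1])
    fix u have "\<bar>l u\<bar> \<le> norm u * K" using K[of u] by simp
    also have "\<dots> \<le> norm u * \<bar>K\<bar>" by (intro mult_left_mono) auto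
    also have "\<dots> \<le> (1 + norm u) * \<bar>K\<bar>" by (intro mult_right_mono) auto
    finally show "\<bar>l u\<bar> \<le> \<bar>K\<bar> * (1 + norm u) ^ 1" by (simp add: mult.commute)
  qed
  then show ?thesis
    using bl assms by (auto simp: coef_def linear_neg intro!: linear_continuous_on)
qed

text \<open>Asymptotics of order \<open>n\<close> in \<open>s\<close>, with a remainder that is uniform in \<open>u\<close> up to polynomial growth as long as
  \<open>s u\<close> stays in a fixed ball. The parity required in \<open>coef\<close> is automatic for functions of \<open>s u\<close> and is preserved by products.\<close>

definition sexp :: "nat \<Rightarrow> (real \<Rightarrow> 'a::real_normed_vector \<Rightarrow> real) \<Rightarrow> (nat \<Rightarrow> 'a \<Rightarrow> real) \<Rightarrow> bool" where
  "sexp n f c \<longleftrightarrow> (\<forall>k. coef k (c k)) \<and>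
     (\<exists>\<rho>>0. \<exists>r. poly_bdd (scaled_ball \<rho>) r \<and>
        (\<forall>s u. (s, u) \<in> scaled_ball \<rho> \<longrightarrow> f s u = (\<Sum>k<n. s ^ k * c k u) + s ^ n * r s u))"

lemma sexpI:
  assumes "\<And>k. coef k (c k)" "\<rho> > 0" "poly_bdd (scaled_ball \<rho>) r"
    "\<And>s u. (s, u) \<in> scaled_ball \<rho> \<Longrightarrow> f s u = (\<Sum>k<n. s ^ k * c k u) + s ^ n * r s u"
  shows "sexp n f c"
  using assms unfolding sexp_def by blast

lemma sexpE:
  assumes "sexp n f c"
  obtains \<rho> r where "\<rho> > 0" "poly_bdd (scaled_ball \<rho>) r"
    "\<And>s u. (s, u) \<in> scaled_ball \<rho> \<Longrightarrow> f s u = (\<Sum>k<n. s ^ k * c k u) + s ^ n * r s u"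
  using assms unfolding sexp_def by blast

lemma sexp_coef: "sexp n f c \<Longrightarrow> coef k (c k)"
  by (simp add: sexp_def)

lemma scaled_ball_mono: "\<rho> \<le> \<rho>' \<Longrightarrow> scaled_ball \<rho> \<subseteq> scaled_ball \<rho>'"
  by (auto simp: scaled_ball_def)

lemma poly_bdd_coef: "coef k c \<Longrightarrow> poly_bdd D (\<lambda>_. c)"
  unfolding coef_def using poly_bdd_mono by blast

text \<open>The error is absorbed by the remainder, so a function inherits the coefficients of any
  approximation of order \<open>s ^ n\<close>, typically those of a Taylor polynomial into which an
  expansion has been inserted.\<close>

lemma sexp_perturb:
  assumes f: "sexp n f c" and "\<rho> > 0" "poly_bdd (scaled_ball \<rho>) r"
    and close: "\<And>s u. (s, u) \<in> scaled_ball \<rho> \<Longrightarrow> \<bar>g s u - f s u\<bar> \<le> s ^ n * r s u"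
  shows "sexp n g c"
proof -
  obtain \<rho>' r' where f': "\<rho>' > 0" "poly_bdd (scaled_ball \<rho>') r'"
    "\<And>s u. (s, u) \<in> scaled_ball \<rho>' \<Longrightarrow> f s u = (\<Sum>k<n. s ^ k * c k u) + s ^ n * r' s u"
    using sexpE[OF f] by blast
  define D where "D = (scaled_ball (min \<rho> \<rho>') :: (real \<times> 'a) set)"
  have D: "D \<subseteq> scaled_ball \<rho>" "D \<subseteq> scaled_ball \<rho>'"
    unfolding D_def by (auto intro!: scaled_ball_mono)
  have "poly_bdd D (\<lambda>s u. r' s u + (g s u - f s u) / s ^ n)"
  proof (intro poly_bdd_add)
    show "poly_bdd D r'" using f'(2) D(2) by (rule poly_bdd_mono)
    show "poly_bdd D (\<lambda>s u. (g s u - f s u) / s ^ n)"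
    proof (rule poly_bdd_le)
      show "poly_bdd D r" using assms(3) D(1) by (rule poly_bdd_mono)
      fix s u assume "(s, u) \<in> D"
      then have "\<bar>g s u - f s u\<bar> \<le> s ^ n * r s u" "s > 0"
        using close D(1) by (auto simp: D_def scaled_ball_def)
      then show "\<bar>(g s u - f s u) / s ^ n\<bar> \<le> \<bar>r s u\<bar>"
        by (simp add: field_simps abs_mult) (smt (verit) mult_left_mono zero_less_power)
    qed
  qed
  note pb = this
  show ?thesis
  proof (rule sexpI[OF sexp_coef[OF f] _ pb[unfolded D_def]])
    fix s :: real and u :: 'a assume "(s, u) \<in> scaled_ball (min \<rho> \<rho>')"
    then have su: "(s, u) \<in> scaled_ball \<rho>'" "s \<noteq> 0"
      using D(2) by (auto simp: D_def scaled_ball_def)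
    then have "s ^ n * (r' s u + (g s u - f s u) / s ^ n) = s ^ n * r' s u + (g s u - f s u)"
      by (simp add: distrib_left)
    then show "g s u = (\<Sum>k<n. s ^ k * c k u) + s ^ n * (r' s u + (g s u - f s u) / s ^ n)"
      using f'(3)[OF su(1)] by simp
  qed (use f'(1) \<open>\<rho> > 0\<close> in simp)
qed

lemma sexp_cong:
  assumes "sexp n f c" "\<rho> > 0" "\<And>s u. (s, u) \<in> scaled_ball \<rho> \<Longrightarrow> g s u = f s u"
  shows "sexp n g c"
  using assms by (intro sexp_perturb[OF assms(1,2) poly_bdd_const[of _ 0]]) auto

lemma sexp_const: "n > 0 \<Longrightarrow> sexp n (\<lambda>_ _. a) (\<lambda>k _. if k = 0 then a else 0)"
proof (rule sexpI[where \<rho>=1 and r="\<lambda>_ _. 0"])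
  assume "n > 0"
  then show "a = (\<Sum>k<n. s ^ k * (if k = 0 then a else 0)) + s ^ n * 0" for s :: real
    by (simp add: if_distrib sum.delta' cong: if_cong)
  show "coef k (\<lambda>_. if k = 0 then a else 0)" for k
    by (cases "k = 0") (auto intro: coef_const coef_zero)
qed (auto intro: poly_bdd_const)

lemma sexp_add:
  assumes f: "sexp n f c" and g: "sexp n g d"
  shows "sexp n (\<lambda>s u. f s u + g s u) (\<lambda>k u. c k u + d k u)"
proof -
  obtain \<rho> r where f': "\<rho> > 0" "poly_bdd (scaled_ball \<rho>) r"
    "\<And>s u. (s, u) \<in> scaled_ball \<rho> \<Longrightarrow> f s u = (\<Sum>k<n. s ^ k * c k u) + s ^ n * r s u"
    using sexpE[OF f] by blast
  obtain \<rho>' r' where g': "\<rho>' > 0" "poly_bdd (scaled_ball \<rho>') r'"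
    "\<And>s u. (s, u) \<in> scaled_ball \<rho>' \<Longrightarrow> g s u = (\<Sum>k<n. s ^ k * d k u) + s ^ n * r' s u"
    using sexpE[OF g] by blast
  have D: "scaled_ball (min \<rho> \<rho>') \<subseteq> (scaled_ball \<rho> :: (real \<times> 'a) set)"
    "scaled_ball (min \<rho> \<rho>') \<subseteq> (scaled_ball \<rho>' :: (real \<times> 'a) set)"
    by (auto intro!: scaled_ball_mono)
  show ?thesis
  proof (rule sexpI)
    show "coef k (\<lambda>u. c k u + d k u)" for k using f g by (intro coef_add sexp_coef)
    show "min \<rho> \<rho>' > 0" using f' g' by simp
    show "poly_bdd (scaled_ball (min \<rho> \<rho>')) (\<lambda>s u. r s u + r' s u)"
      using f'(2) g'(2) D by (intro poly_bdd_add) (auto intro: poly_bdd_mono)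
    fix s :: real and u :: 'a assume "(s, u) \<in> scaled_ball (min \<rho> \<rho>')"
    then have su: "(s, u) \<in> scaled_ball \<rho>" "(s, u) \<in> scaled_ball \<rho>'"
      using D by auto
    have "(\<Sum>k<n. s ^ k * (c k u + d k u)) = (\<Sum>k<n. s ^ k * c k u) + (\<Sum>k<n. s ^ k * d k u)"
      by (simp add: distrib_left sum.distrib)
    then show "f s u + g s u = (\<Sum>k<n. s ^ k * (c k u + d k u)) + s ^ n * (r s u + r' s u)"
      unfolding f'(3)[OF su(1)] g'(3)[OF su(2)] by (simp add: distrib_left)
  qed
qed

lemma sexp_mult:
  assumes f: "sexp n f c" and g: "sexp n g d"
  shows "sexp n (\<lambda>s u. f s u * g s u) (\<lambda>k u. \<Sum>i\<le>k. c i u * d (k - i) u)"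
proof -
  obtain \<rho> r where f': "\<rho> > 0" "poly_bdd (scaled_ball \<rho>) r"
    "\<And>s u. (s, u) \<in> scaled_ball \<rho> \<Longrightarrow> f s u = (\<Sum>k<n. s ^ k * c k u) + s ^ n * r s u"
    using sexpE[OF f] by blast
  obtain \<rho>' r' where g': "\<rho>' > 0" "poly_bdd (scaled_ball \<rho>') r'"
    "\<And>s u. (s, u) \<in> scaled_ball \<rho>' \<Longrightarrow> g s u = (\<Sum>k<n. s ^ k * d k u) + s ^ n * r' s u"
    using sexpE[OF g] by blast
  define D where "D = (scaled_ball (min \<rho> \<rho>') :: (real \<times> 'a) set)"
  have D: "D \<subseteq> scaled_ball \<rho>" "D \<subseteq> scaled_ball \<rho>'"
    unfolding D_def by (auto intro!: scaled_ball_mono)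
  \<comment> \<open>The pairs of overshooting total degree: their products carry
    \<open>s ^ (i + j)\<close> with \<open>i + j \<ge> n\<close> and belong to the remainder
    \<open>h\<close>, together with all terms containing \<open>r\<close> or
    \<open>r'\<close>.\<close>
  define T where "T = {(i, j). i < n \<and> j < n \<and> n \<le> i + j}"
  define h where "h s u = (\<Sum>(i, j)\<in>T. s ^ (i + j - n) * (c i u * d j u)) +
    (\<Sum>k<n. s ^ k * c k u) * r' s u + r s u * ((\<Sum>k<n. s ^ k * d k u) + s ^ n * r' s u)" for s u
  have pc: "poly_bdd D (\<lambda>_. c k)" "poly_bdd D (\<lambda>_. d k)" for k
    using f g sexp_coef poly_bdd_coef by blast+
  have pr: "poly_bdd D r" "poly_bdd D r'"
    using f'(2) g'(2) D by (auto intro: poly_bdd_mono)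
  have ps: "poly_bdd D (\<lambda>s u. s ^ k)" for k
    unfolding D_def by (rule poly_bdd_scale)
  show ?thesis
  proof (rule sexpI)
    show "coef k (\<lambda>u. \<Sum>i\<le>k. c i u * d (k - i) u)" for k
    proof (rule coef_sum)
      fix i assume "i \<in> {..k}"
      then show "coef k (\<lambda>u. c i u * d (k - i) u)"
        using coef_mult[OF sexp_coef[OF f, of i] sexp_coef[OF g, of "k - i"]] by simp
    qed
    show "min \<rho> \<rho>' > 0" using f' g' by simp
    show "poly_bdd (scaled_ball (min \<rho> \<rho>')) h"
      unfolding D_def[symmetric] h_def case_prod_beta
      by (intro poly_bdd_add poly_bdd_mult poly_bdd_sum pc pr ps)
    fix s :: real and u :: 'a assume "(s, u) \<in> scaled_ball (min \<rho> \<rho>')"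
    then have su: "(s, u) \<in> scaled_ball \<rho>" "(s, u) \<in> scaled_ball \<rho>'"
      using D unfolding D_def by auto
    let ?p = "\<lambda>i j. (s ^ i * c i u) * (s ^ j * d j u)"
    have split: "{..<n} \<times> {..<n} = {(i, j). i + j < n} \<union> T" "{(i, j). i + j < n} \<inter> T = {}"
      by (auto simp: T_def)
    have "{(i, j). i + j < n} \<subseteq> {..<n} \<times> {..<n}" "T \<subseteq> {..<n} \<times> {..<n}"
      by (auto simp: T_def)
    then have fin: "finite {(i, j). i + j < n}" "finite T"
      by (auto dest: finite_subset)
    have "(\<Sum>k<n. s ^ k * c k u) * (\<Sum>k<n. s ^ k * d k u) = (\<Sum>(i, j)\<in>{..<n} \<times> {..<n}. ?p i j)"
      by (simp add: sum_product sum.cartesian_product)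
    also have "\<dots> = (\<Sum>(i, j)\<in>{(i, j). i + j < n}. ?p i j) + (\<Sum>(i, j)\<in>T. ?p i j)"
      unfolding split(1) using fin split(2) by (rule sum.union_disjoint)
    also have "(\<Sum>(i, j)\<in>{(i, j). i + j < n}. ?p i j) = (\<Sum>k<n. \<Sum>i\<le>k. ?p i (k - i))"
      by (rule sum.triangle_reindex)
    also have "\<dots> = (\<Sum>k<n. s ^ k * (\<Sum>i\<le>k. c i u * d (k - i) u))"
    proof (intro sum.cong refl)
      fix k
      have "?p i (k - i) = s ^ k * (c i u * d (k - i) u)" if "i \<le> k" for i
      proof -
        have "s ^ k = s ^ i * s ^ (k - i)" using that by (simp flip: power_add)
        then show ?thesis by simp
      qed
      then show "(\<Sum>i\<le>k. ?p i (k - i)) = s ^ k * (\<Sum>i\<le>k. c i u * d (k - i) u)"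
        unfolding sum_distrib_left by (intro sum.cong) auto
    qed
    also have "(\<Sum>(i, j)\<in>T. ?p i j) = s ^ n * (\<Sum>(i, j)\<in>T. s ^ (i + j - n) * (c i u * d j u))"
      unfolding sum_distrib_left
    proof (intro sum.cong refl, clarify)
      fix i j assume "(i, j) \<in> T"
      then have "i + j = n + (i + j - n)" by (auto simp: T_def)
      then have p: "s ^ i * s ^ j = s ^ n * s ^ (i + j - n)" by (metis power_add)
      have "?p i j = (s ^ i * s ^ j) * (c i u * d j u)" by (simp only: mult_ac)
      then show "?p i j = s ^ n * (s ^ (i + j - n) * (c i u * d j u))"
        unfolding p by (simp only: mult.assoc)
    qed
    finally have "(\<Sum>k<n. s ^ k * c k u) * (\<Sum>k<n. s ^ k * d k u) =
      (\<Sum>k<n. s ^ k * (\<Sum>i\<le>k. c i u * d (k - i) u)) +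
        s ^ n * (\<Sum>(i, j)\<in>T. s ^ (i + j - n) * (c i u * d j u))" .
    then show "f s u * g s u = (\<Sum>k<n. s ^ k * (\<Sum>i\<le>k. c i u * d (k - i) u)) + s ^ n * h s u"
      unfolding f'(3)[OF su(1)] g'(3)[OF su(2)] h_def by (simp only: distrib_left distrib_right mult_ac add_ac)
  qed
qed

text \<open>Coefficient \<open>m + k\<close> moves to place \<open>k\<close>, and its parity
  condition moves with it because \<open>(- 1) ^ m = 1\<close>.\<close>

lemma sexp_shift:
  assumes f: "sexp (m + n) f c" and zero: "\<And>k u. k < m \<Longrightarrow> c k u = 0" and "even m"
  shows "sexp n (\<lambda>s u. f s u / s ^ m) (\<lambda>k. c (m + k))"
proof -
  obtain \<rho> r where f': "\<rho> > 0" "poly_bdd (scaled_ball \<rho>) r"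
    "\<And>s u. (s, u) \<in> scaled_ball \<rho> \<Longrightarrow> f s u = (\<Sum>k<m+n. s ^ k * c k u) + s ^ (m + n) * r s u"
    using sexpE[OF f] by blast
  show ?thesis
  proof (rule sexpI[OF _ f'(1,2)])
    show "coef k (c (m + k))" for k
      using sexp_coef[OF f, of "m + k"] \<open>even m\<close> by (simp add: coef_def power_add)
    fix s :: real and u :: 'a assume su: "(s, u) \<in> scaled_ball \<rho>"
    have sum: "(\<Sum>k<m+n. s ^ k * c k u) = (\<Sum>k<m. s ^ k * c k u) + (\<Sum>k<n. s ^ (m + k) * c (m + k) u)" for n
      by (induction n) auto
    have "f s u = s ^ m * ((\<Sum>k<n. s ^ k * c (m + k) u) + s ^ n * r s u)"
      unfolding f'(3)[OF su] sum using zero by (simp add: power_add sum_distrib_left algebra_simps)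
    then show "f s u / s ^ m = (\<Sum>k<n. s ^ k * c (m + k) u) + s ^ n * r s u"
      using su by (simp add: scaled_ball_def)
  qed
qed

lemma sexp_trunc:
  assumes f: "sexp (n + m) f c"
  shows "sexp n f c"
proof -
  obtain \<rho> r where f': "\<rho> > 0" "poly_bdd (scaled_ball \<rho>) r"
    "\<And>s u. (s, u) \<in> scaled_ball \<rho> \<Longrightarrow> f s u = (\<Sum>k<n+m. s ^ k * c k u) + s ^ (n + m) * r s u"
    using sexpE[OF f] by blast
  show ?thesis
  proof (rule sexpI[OF sexp_coef[OF f] f'(1)])
    show "poly_bdd (scaled_ball \<rho>) (\<lambda>s u. (\<Sum>k<m. s ^ k * c (n + k) u) + s ^ m * r s u)"
      by (intro poly_bdd_add poly_bdd_sum poly_bdd_mult poly_bdd_scale f'(2)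
          poly_bdd_coef[OF sexp_coef[OF f]])
    have "(\<Sum>k<n+m. s ^ k * c k u) = (\<Sum>k<n. s ^ k * c k u) + s ^ n * (\<Sum>k<m. s ^ k * c (n + k) u)" for s u m
      by (induction m) (auto simp: power_add algebra_simps)
    then show "f s u = (\<Sum>k<n. s ^ k * c k u) + s ^ n * ((\<Sum>k<m. s ^ k * c (n + k) u) + s ^ m * r s u)"
      if "(s, u) \<in> scaled_ball \<rho>" for s u
      using f'(3)[OF that] by (simp add: power_add algebra_simps)
  qed
qed

text \<open>This is how coefficients of expansions that are merely known to exist get identified:
  pointwise in \<open>u\<close>, each one once the lower ones are known to vanish.\<close>

lemma sexp_limit:
  assumes f: "sexp n f c" and zero: "\<And>i. i < k \<Longrightarrow> c i u = 0" and "k < n"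
  shows "((\<lambda>s. f s u / s ^ k) \<longlongrightarrow> c k u) (at_right 0)"
proof -
  obtain m where n: "n = k + Suc m" using \<open>k < n\<close> less_iff_Suc_add by auto
  obtain \<rho> r where f': "\<rho> > 0" "poly_bdd (scaled_ball \<rho>) r"
    "\<And>s u. (s, u) \<in> scaled_ball \<rho> \<Longrightarrow> f s u = (\<Sum>k<n. s ^ k * c k u) + s ^ n * r s u"
    using sexpE[OF f] by blast
  obtain C M where C: "C \<ge> 0" "\<And>s u. (s, u) \<in> scaled_ball \<rho> \<Longrightarrow> \<bar>r s u\<bar> \<le> C * (1 + norm u) ^ M"
    by (rule poly_bddE[OF f'(2)]) blast
  \<comment> \<open>For this fixed \<open>u\<close>, every \<open>s\<close> in \<open>(0, e)\<close>
    puts \<open>(s, u)\<close> into the scaled ball; \<open>1 + norm u\<close> avoids a division by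
    zero at \<open>u = 0\<close>.\<close>
  define e where "e = min 1 (\<rho> / (1 + norm u))"
  have e: "e > 0" unfolding e_def using f'(1) by (auto simp: add_pos_nonneg)
  have ball: "(s, u) \<in> scaled_ball \<rho>" if "0 < s" "s < e" for s
  proof -
    have "s * norm u \<le> s * (1 + norm u)" using that by (intro mult_left_mono) auto
    also have "\<dots> < \<rho>"
    proof -
      have "1 + norm u > 0" by (simp add: add_pos_nonneg)
      then show ?thesis using that(2) by (auto simp: e_def field_simps)
    qed
    finally show ?thesis using that by (auto simp: scaled_ball_def e_def)
  qed
  have "((\<lambda>s. c k u + s * (\<Sum>i<m. s ^ i * c (k + Suc i) u) + s * s ^ m * r s u) \<longlongrightarrow> c k u + 0 * (\<Sum>i<m. 0 ^ i * c (k + Suc i) u) + 0) (at_right 0)"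
  proof (intro tendsto_intros)
    show "((\<lambda>s. s * s ^ m * r s u) \<longlongrightarrow> 0) (at_right 0)"
    proof (rule Lim_null_comparison)
      have "\<bar>s * s ^ m * r s u\<bar> \<le> s * (C * (1 + norm u) ^ M)" if "0 < s" "s < e" for s
      proof -
        have "s * s ^ m \<le> s * 1" using that by (intro mult_left_mono power_le_one) (auto simp: e_def)
        then have "\<bar>s * s ^ m\<bar> * \<bar>r s u\<bar> \<le> s * (C * (1 + norm u) ^ M)"
          using that C(1) C(2)[OF ball[OF that]] by (intro mult_mono) auto
        then show ?thesis by (simp add: abs_mult)
      qed
      then show "eventually (\<lambda>s. norm (s * s ^ m * r s u) \<le> s * (C * (1 + norm u) ^ M)) (at_right 0)"
        using e by (auto simp: eventually_at_right_field)
      show "((\<lambda>s. s * (C * (1 + norm u) ^ M)) \<longlongrightarrow> 0) (at_right 0)"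
        by (rule tendsto_eq_intros | simp)+
    qed
  qed
  then have lim: "((\<lambda>s. c k u + s * (\<Sum>i<m. s ^ i * c (k + Suc i) u) + s * s ^ m * r s u) \<longlongrightarrow> c k u) (at_right 0)"
    by simp
  have "eventually (\<lambda>s. c k u + s * (\<Sum>i<m. s ^ i * c (k + Suc i) u) + s * s ^ m * r s u = f s u / s ^ k) (at_right 0)"
    unfolding eventually_at_right_field
  proof (intro exI[of _ e] conjI allI impI e)
    fix s assume s: "0 < s" "s < e"
    have "(\<Sum>i<n. s ^ i * c i u) = s ^ k * (c k u + s * (\<Sum>i<m. s ^ i * c (k + Suc i) u))"
      unfolding n by (induction m) (auto simp: zero power_add algebra_simps)
    then have "f s u = s ^ k * (c k u + s * (\<Sum>i<m. s ^ i * c (k + Suc i) u) + s * s ^ m * r s u)"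
      using f'(3)[OF ball[OF s]] by (simp add: n power_add algebra_simps)
    then show "c k u + s * (\<Sum>i<m. s ^ i * c (k + Suc i) u) + s * s ^ m * r s u = f s u / s ^ k"
      using s by simp
  qed
  from Lim_transform_eventually[OF lim this] show ?thesis .
qed

text \<open>Coefficients are forgotten on purpose: closure under algebra then becomes a matter of
  introduction rules, and only leading coefficients have to be recovered from limits.\<close>

definition sexpandable :: "nat \<Rightarrow> (real \<Rightarrow> 'a::real_normed_vector \<Rightarrow> real) \<Rightarrow> bool" where
  "sexpandable n f \<longleftrightarrow> (\<exists>c. sexp n f c)"

lemma sexpandable_const: "n > 0 \<Longrightarrow> sexpandable n (\<lambda>_ _. a)"
  using sexp_const unfolding sexpandable_def by blast

lemma sexpandable_add: "sexpandable n f \<Longrightarrow> sexpandable n g \<Longrightarrow> sexpandable n (\<lambda>s u. f s u + g s u)"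
  using sexp_add unfolding sexpandable_def by blast

lemma sexpandable_mult: "sexpandable n f \<Longrightarrow> sexpandable n g \<Longrightarrow> sexpandable n (\<lambda>s u. f s u * g s u)"
  using sexp_mult unfolding sexpandable_def by blast

lemma sexpandable_sum:
  "n > 0 \<Longrightarrow> (\<And>i. i \<in> I \<Longrightarrow> sexpandable n (f i)) \<Longrightarrow> sexpandable n (\<lambda>s u. \<Sum>i\<in>I. f i s u)"
  by (induction I rule: infinite_finite_induct) (auto intro: sexpandable_add sexpandable_const)

lemma sexpandable_prod:
  "n > 0 \<Longrightarrow> (\<And>i. i \<in> I \<Longrightarrow> sexpandable n (f i)) \<Longrightarrow> sexpandable n (\<lambda>s u. \<Prod>i\<in>I. f i s u)"
  by (induction I rule: infinite_finite_induct) (auto intro: sexpandable_mult sexpandable_const)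

lemma sexpandable_prod_list:
  "n > 0 \<Longrightarrow> (\<And>i. i \<in> set xs \<Longrightarrow> sexpandable n (f i)) \<Longrightarrow> sexpandable n (\<lambda>s u. \<Prod>i\<leftarrow>xs. f i s u)"
  by (induction xs) (auto intro: sexpandable_mult sexpandable_const)

lemma sexpandable_power: "n > 0 \<Longrightarrow> sexpandable n f \<Longrightarrow> sexpandable n (\<lambda>s u. f s u ^ k)"
  by (induction k) (auto intro: sexpandable_mult sexpandable_const)

lemma sexpandable_perturb:
  assumes "sexpandable n f" "\<rho> > 0" "poly_bdd (scaled_ball \<rho>) r"
    "\<And>s u. (s, u) \<in> scaled_ball \<rho> \<Longrightarrow> \<bar>g s u - f s u\<bar> \<le> s ^ n * r s u"
  shows "sexpandable n g"
  using assms sexp_perturb unfolding sexpandable_def by blast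

lemma sexpandable_minus: "n > 0 \<Longrightarrow> sexpandable n f \<Longrightarrow> sexpandable n g \<Longrightarrow> sexpandable n (\<lambda>s u. f s u - g s u)"
  using sexpandable_add[OF _ sexpandable_mult[OF sexpandable_const[of n "-1"]], of f g] by simp

section \<open>Taylor expansion of smooth maps\<close>

lemma C_inf_on_differentiable: "C_inf_on S f \<Longrightarrow> z \<in> S \<Longrightarrow> f differentiable at z"
  unfolding C_inf_on_def by (metis iter_dderiv.simps(1))

lemma C_inf_on_has_derivative:
  "C_inf_on S f \<Longrightarrow> z \<in> S \<Longrightarrow>
    (iter_dderiv vs f has_derivative (\<lambda>v. iter_dderiv (v # vs) f z)) (at z)"
  by (simp add: C_inf_on_def frechet_derivative_works[symmetric] eta_contract_eq)

lemma C_inf_on_continuous_on: "C_inf_on S f \<Longrightarrow> continuous_on S (iter_dderiv vs f)"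
  by (auto simp: C_inf_on_def intro!: differentiable_imp_continuous_on differentiable_on_subset
      differentiable_at_imp_differentiable_on)

lemma iter_dderiv_append: "iter_dderiv (vs @ us) f = iter_dderiv vs (iter_dderiv us f)"
  by (induction vs) auto

lemma C_inf_on_iter_dderiv: "C_inf_on S f \<Longrightarrow> C_inf_on S (iter_dderiv us f)"
  by (simp add: C_inf_on_def iter_dderiv_append[symmetric])

abbreviation basis_lists :: "nat \<Rightarrow> 'a::euclidean_space list set" where
  "basis_lists k \<equiv> {bs. set bs \<subseteq> Basis \<and> length bs = k}"

text \<open>A derivative is linear in its direction, so \<open>h\<close> can be expanded in the
  basis one slot at a time. Only finitely many lists of basis vectors remain, which is what makes
  Taylor remainders uniform in the direction of \<open>h\<close>.\<close>

lemma iter_dderiv_replicate: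
  fixes f :: "'a::euclidean_space \<Rightarrow> 'b::real_normed_vector"
  assumes f: "C_inf_on S f" and "z \<in> S"
  shows "iter_dderiv (replicate k h) f z = (\<Sum>bs\<in>basis_lists k. (\<Prod>b\<leftarrow>bs. h \<bullet> b) *\<^sub>R iter_dderiv bs f z)"
  using \<open>z \<in> S\<close>
proof (induction k arbitrary: z)
  case 0
  have "basis_lists 0 = {[] :: 'a list}" by auto
  then show ?case by simp
next
  case (Suc k)
  let ?g = "\<lambda>z. \<Sum>bs\<in>basis_lists k. (\<Prod>b\<leftarrow>bs. h \<bullet> b) *\<^sub>R iter_dderiv bs f z"
  let ?D = "\<lambda>v. \<Sum>bs\<in>basis_lists k. (\<Prod>b\<leftarrow>bs. h \<bullet> b) *\<^sub>R iter_dderiv (v # bs) f z"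
  \<comment> \<open>The induction hypothesis holds at all points of the open set \<open>S\<close>,
    so the two functions agree near \<open>z\<close> and have the same derivative there.\<close>
  have "(?g has_derivative ?D) (at z)"
    using Suc.prems f by (intro has_derivative_sum has_derivative_scaleR_right C_inf_on_has_derivative)
  moreover have "open S" using f by (simp add: C_inf_on_def)
  ultimately have "(iter_dderiv (replicate k h) f has_derivative ?D) (at z)"
    using Suc.prems by (rule has_derivative_transform_within_open) (simp add: Suc.IH)
  from fun_cong[OF frechet_derivative_at[OF this], of h]
  have "iter_dderiv (replicate (Suc k) h) f z = ?D h" by simp
  also have "\<dots> = (\<Sum>bs\<in>basis_lists k. \<Sum>b\<in>Basis. ((\<Prod>b\<leftarrow>bs. h \<bullet> b) * (h \<bullet> b)) *\<^sub>R iter_dderiv (b # bs) f z)"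
  proof (intro sum.cong refl)
    fix bs :: "'a list"
    have "linear (\<lambda>v. iter_dderiv (v # bs) f z)"
      using C_inf_on_has_derivative[OF f Suc.prems] by (rule has_derivative_linear)
    then have "iter_dderiv ((\<Sum>b\<in>Basis. (h \<bullet> b) *\<^sub>R b) # bs) f z = (\<Sum>b\<in>Basis. (h \<bullet> b) *\<^sub>R iter_dderiv (b # bs) f z)"
      by (simp only: linear_sum[where f="\<lambda>v. iter_dderiv (v # bs) f z"]
          linear_scale[where f="\<lambda>v. iter_dderiv (v # bs) f z"])
    then show "(\<Prod>b\<leftarrow>bs. h \<bullet> b) *\<^sub>R iter_dderiv (h # bs) f z =
      (\<Sum>b\<in>Basis. ((\<Prod>b\<leftarrow>bs. h \<bullet> b) * (h \<bullet> b)) *\<^sub>R iter_dderiv (b # bs) f z)"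
      unfolding euclidean_representation by (simp only: scaleR_sum_right scaleR_scaleR)
  qed
  also have "\<dots> = (\<Sum>(bs, b)\<in>basis_lists k \<times> Basis. ((\<Prod>b\<leftarrow>b # bs. h \<bullet> b)) *\<^sub>R iter_dderiv (b # bs) f z)"
    unfolding sum.cartesian_product by (intro sum.cong refl) (auto simp: mult.commute)
  also have "\<dots> = (\<Sum>bs\<in>basis_lists (Suc k). (\<Prod>b\<leftarrow>bs. h \<bullet> b) *\<^sub>R iter_dderiv bs f z)"
    unfolding lists_length_Suc_eq
    by (subst sum.reindex) (auto simp: inj_on_def case_prod_beta simp del: iter_dderiv.simps intro!: sum.cong)
  finally show ?case .
qed

lemma abs_prod_list_inner_le:
  fixes h :: "'a::euclidean_space"
  shows "set bs \<subseteq> Basis \<Longrightarrow> \<bar>\<Prod>b\<leftarrow>bs. h \<bullet> b\<bar> \<le> norm h ^ length bs"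
  by (induction bs) (auto simp: abs_mult intro!: mult_mono Basis_le_norm)

text \<open>Maclaurin's formula is applied on \<open>[0, 1]\<close> to the restriction of a
  component of \<open>f\<close> to the segment from \<open>a\<close> to \<open>a + h\<close>. The
  \<open>n\<close>-th derivatives along basis lists are bounded on a compact ball, hence
  \<open>C\<close> does not depend on \<open>h\<close>.\<close>

lemma C_inf_on_Taylor:
  fixes f :: "'a::euclidean_space \<Rightarrow> 'b::euclidean_space"
  assumes f: "C_inf_on S f" and "a \<in> S"
  obtains \<rho> C where "\<rho> > 0" "C \<ge> 0"
    "\<And>h. norm h < \<rho> \<Longrightarrow> \<bar>f (a + h) \<bullet> i - (\<Sum>k<n. \<Sum>bs\<in>basis_lists k.
        (\<Prod>b\<leftarrow>bs. h \<bullet> b) * (iter_dderiv bs f a \<bullet> i / fact k))\<bar> \<le> C * norm h ^ n"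
proof -
  have "open S" using f by (simp add: C_inf_on_def)
  then obtain \<rho> where \<rho>: "\<rho> > 0" "cball a \<rho> \<subseteq> S"
    using \<open>a \<in> S\<close> open_contains_cball by blast
  have "\<exists>K. \<forall>z\<in>cball a \<rho>. \<bar>iter_dderiv bs f z \<bullet> i\<bar> \<le> K" for bs
  proof -
    have "continuous_on (cball a \<rho>) (\<lambda>z. iter_dderiv bs f z \<bullet> i)"
      using C_inf_on_continuous_on[OF f] \<rho>(2) by (intro continuous_intros) (rule continuous_on_subset)
    then have "bounded ((\<lambda>z. iter_dderiv bs f z \<bullet> i) ` cball a \<rho>)"
      by (intro compact_imp_bounded compact_continuous_image compact_cball)
    then show ?thesis unfolding bounded_iff by auto
  qed
  then obtain K where K: "\<And>bs z. z \<in> cball a \<rho> \<Longrightarrow> \<bar>iter_dderiv bs f z \<bullet> i\<bar> \<le> K bs"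
    by metis
  define C where "C = (\<Sum>bs\<in>(basis_lists n :: 'a list set). \<bar>K bs\<bar> / fact n)"
  show ?thesis
  proof (rule that[OF \<rho>(1), of C])
    show "C \<ge> 0" unfolding C_def by (intro sum_nonneg) auto
    fix h :: 'a assume h: "norm h < \<rho>"
    have inS: "a + t *\<^sub>R h \<in> cball a \<rho>" if "0 \<le> t" "t \<le> 1" for t
    proof -
      have "\<bar>t\<bar> * norm h \<le> 1 * norm h" using that by (intro mult_right_mono) auto
      then show ?thesis using h by (simp add: dist_norm)
    qed
    define diff where "diff k t = iter_dderiv (replicate k h) f (a + t *\<^sub>R h) \<bullet> i" for k t
    have D: "\<forall>m t. m < n \<and> 0 \<le> t \<and> t \<le> 1 \<longrightarrow> DERIV (diff m) t :> diff (Suc m) t"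
    proof (intro allI impI, elim conjE)
      fix m and t :: real assume t: "0 \<le> t" "t \<le> 1"
      have lin: "linear (\<lambda>v. iter_dderiv (v # replicate m h) f (a + t *\<^sub>R h))"
        using C_inf_on_has_derivative[OF f] inS[OF t] \<rho>(2) by (blast intro: has_derivative_linear)
      have "(iter_dderiv (replicate m h) f has_derivative (\<lambda>v. iter_dderiv (v # replicate m h) f (a + t *\<^sub>R h)))
          (at (a + t *\<^sub>R h))"
        using C_inf_on_has_derivative[OF f] inS[OF t] \<rho>(2) by blast
      moreover have "((\<lambda>t. a + t *\<^sub>R h) has_derivative (\<lambda>e. e *\<^sub>R h)) (at t)"
        by (auto intro!: derivative_eq_intros)
      ultimately have "((\<lambda>t. iter_dderiv (replicate m h) f (a + t *\<^sub>R h)) has_derivative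
          (\<lambda>e. iter_dderiv ((e *\<^sub>R h) # replicate m h) f (a + t *\<^sub>R h))) (at t)"
        by (rule has_derivative_compose[rotated])
      then have "(diff m has_derivative
          (\<lambda>e. iter_dderiv ((e *\<^sub>R h) # replicate m h) f (a + t *\<^sub>R h) \<bullet> i)) (at t)"
        unfolding diff_def by (rule has_derivative_inner_left)
      then show "DERIV (diff m) t :> diff (Suc m) t"
        unfolding has_field_derivative_def
        by (rule has_derivative_eq_rhs)
          (simp add: linear_scale[OF lin] diff_def fun_eq_iff mult.commute del: iter_dderiv.simps)
    qed
    obtain t where t: "0 < t" "t \<le> 1"
      "diff 0 1 = (\<Sum>m<n. diff m 0 / fact m * 1 ^ m) + diff n t / fact n * 1 ^ n"
      using Maclaurin2[of 1 diff "diff 0" n] D by auto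
    have rep: "diff k t = (\<Sum>bs\<in>basis_lists k. (\<Prod>b\<leftarrow>bs. h \<bullet> b) * (iter_dderiv bs f (a + t *\<^sub>R h) \<bullet> i))"
      if "0 \<le> t" "t \<le> 1" for k t
      using iter_dderiv_replicate[OF f, of "a + t *\<^sub>R h" k h] inS[OF that] \<rho>(2)
      by (auto simp: diff_def inner_sum_left)
    have "f (a + h) \<bullet> i - (\<Sum>k<n. \<Sum>bs\<in>basis_lists k. (\<Prod>b\<leftarrow>bs. h \<bullet> b) * (iter_dderiv bs f a \<bullet> i / fact k))
        = diff n t / fact n"
      using t(3) rep[of 0] by (simp add: diff_def sum_divide_distrib)
    also have "\<bar>\<dots>\<bar> \<le> (\<Sum>bs\<in>(basis_lists n :: 'a list set). norm h ^ n * (\<bar>K bs\<bar> / fact n))"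
      unfolding rep[OF less_imp_le[OF t(1)] t(2)] sum_divide_distrib
    proof (rule sum_abs[THEN order_trans], intro sum_mono)
      fix bs assume bs: "bs \<in> (basis_lists n :: 'a list set)"
      have "\<bar>iter_dderiv bs f (a + t *\<^sub>R h) \<bullet> i\<bar> \<le> \<bar>K bs\<bar>"
        using K[OF inS[OF less_imp_le[OF t(1)] t(2)], of bs] by linarith
      then have "\<bar>\<Prod>b\<leftarrow>bs. h \<bullet> b\<bar> * (\<bar>iter_dderiv bs f (a + t *\<^sub>R h) \<bullet> i\<bar> / fact n) \<le> norm h ^ n * (\<bar>K bs\<bar> / fact n)"
        using abs_prod_list_inner_le[of bs h] bs by (intro mult_mono divide_right_mono) auto
      then show "\<bar>(\<Prod>b\<leftarrow>bs. h \<bullet> b) * (iter_dderiv bs f (a + t *\<^sub>R h) \<bullet> i) / fact n\<bar> \<le> norm h ^ n * (\<bar>K bs\<bar> / fact n)"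
        by (simp add: abs_mult)
    qed
    also have "\<dots> = C * norm h ^ n" by (simp add: C_def sum_distrib_left mult.commute)
    finally show "\<bar>f (a + h) \<bullet> i - (\<Sum>k<n. \<Sum>bs\<in>basis_lists k.
        (\<Prod>b\<leftarrow>bs. h \<bullet> b) * (iter_dderiv bs f a \<bullet> i / fact k))\<bar> \<le> C * norm h ^ n" .
  qed
qed

lemma coef_prod_list:
  fixes bs :: "'a::euclidean_space list"
  shows "coef (length bs) (\<lambda>u. \<Prod>b\<leftarrow>bs. u \<bullet> b)"
proof (induction bs)
  case (Cons b bs)
  have "coef 1 (\<lambda>u. u \<bullet> b)"
    by (intro coef_linear) (auto intro!: linearI simp: inner_add_left)
  from coef_mult[OF this Cons] show ?case by simp
qed (simp add: coef_const)

text \<open>The Taylor part of degree \<open>k\<close> is homogeneous: at \<open>s u\<close> it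
  releases exactly \<open>s ^ k\<close>, and as a product of \<open>k\<close> linear forms it has
  the parity of \<open>k\<close>.\<close>

lemma sexpandable_C_inf_on:
  fixes f :: "'a::euclidean_space \<Rightarrow> 'b::euclidean_space"
  assumes f: "C_inf_on S f" and "a \<in> S"
  shows "sexpandable n (\<lambda>s u. f (a + s *\<^sub>R u) \<bullet> i)"
proof -
  obtain \<rho> C where \<rho>: "\<rho> > 0" "C \<ge> 0"
    "\<And>h. norm h < \<rho> \<Longrightarrow> \<bar>f (a + h) \<bullet> i - (\<Sum>k<n. \<Sum>bs\<in>basis_lists k.
        (\<Prod>b\<leftarrow>bs. h \<bullet> b) * (iter_dderiv bs f a \<bullet> i / fact k))\<bar> \<le> C * norm h ^ n"
    using C_inf_on_Taylor[OF assms] by blast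
  define c where "c k u = (\<Sum>bs\<in>basis_lists k. (\<Prod>b\<leftarrow>bs. u \<bullet> b) * (iter_dderiv bs f a \<bullet> i / fact k))" for k u
  have coef: "coef k (c k)" for k
    unfolding c_def
  proof (rule coef_sum)
    fix bs :: "'a list" assume "bs \<in> basis_lists k"
    then show "coef k (\<lambda>u. (\<Prod>b\<leftarrow>bs. u \<bullet> b) * (iter_dderiv bs f a \<bullet> i / fact k))"
      using coef_mult[OF coef_prod_list[of bs] coef_const] by (simp del: times_divide_eq_right)
  qed
  have hom: "c k (s *\<^sub>R u) = s ^ k * c k u" for k s u
  proof -
    have "(\<Prod>b\<leftarrow>bs. s *\<^sub>R u \<bullet> b) = s ^ length bs * (\<Prod>b\<leftarrow>bs. u \<bullet> b)" for bs :: "'a list"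
      by (induction bs) (auto simp: algebra_simps)
    then show ?thesis
      unfolding c_def sum_distrib_left by (intro sum.cong) (auto simp del: inner_scaleR_left)
  qed
  have "sexp n (\<lambda>s u. \<Sum>k<n. s ^ k * c k u) c"
    by (rule sexpI[OF coef, of 1 "\<lambda>_ _. 0"]) (auto intro: poly_bdd_const)
  then have "sexp n (\<lambda>s u. f (a + s *\<^sub>R u) \<bullet> i) c"
  proof (rule sexp_perturb[OF _ \<rho>(1)])
    show "poly_bdd (scaled_ball \<rho>) (\<lambda>_ u. C * norm (u :: 'a) ^ n)"
      by (intro poly_bdd_mult poly_bdd_const poly_bdd_power poly_bdd_norm)
    fix s :: real and u :: 'a assume "(s, u) \<in> scaled_ball \<rho>"
    then show "\<bar>f (a + s *\<^sub>R u) \<bullet> i - (\<Sum>k<n. s ^ k * c k u)\<bar> \<le> s ^ n * (C * norm u ^ n)"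
      using \<rho>(3)[of "s *\<^sub>R u"] unfolding c_def[symmetric] hom
      by (auto simp: scaled_ball_def power_mult_distrib algebra_simps)
  qed
  then show ?thesis unfolding sexpandable_def by blast
qed

text \<open>Replaces a higher-order chain rule. The Taylor polynomial of \<open>G\<close> is a
  polynomial in the components of \<open>w\<close> and thus expandable by algebra, while the
  Lipschitz bound turns its remainder into \<open>s ^ n\<close> times a power of
  \<open>norm u\<close>.\<close>

lemma sexpandable_compose:
  fixes G :: "'b::euclidean_space \<Rightarrow> 'c::euclidean_space" and w :: "real \<Rightarrow> 'a::real_normed_vector \<Rightarrow> 'b"
  assumes G: "C_inf_on W G" "x \<in> W" and "n > 0"
    and w: "\<And>i. i \<in> Basis \<Longrightarrow> sexpandable n (\<lambda>s u. w s u \<bullet> i)"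
    and "\<rho> > 0" and lip: "\<And>s u. (s, u) \<in> scaled_ball \<rho> \<Longrightarrow> norm (w s u) \<le> L * norm (s *\<^sub>R u)"
  shows "sexpandable n (\<lambda>s u. G (x + w s u) \<bullet> j)"
proof -
  obtain \<rho>' C where \<rho>': "\<rho>' > 0" "C \<ge> 0"
    "\<And>h. norm h < \<rho>' \<Longrightarrow> \<bar>G (x + h) \<bullet> j - (\<Sum>k<n. \<Sum>bs\<in>basis_lists k.
        (\<Prod>b\<leftarrow>bs. h \<bullet> b) * (iter_dderiv bs G x \<bullet> j / fact k))\<bar> \<le> C * norm h ^ n"
    using C_inf_on_Taylor[OF G] by blast
  \<comment> \<open>A strictly positive Lipschitz constant, as the new radius divides by it.\<close>
  define L' where "L' = \<bar>L\<bar> + 1"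
  have lip': "norm (w s u) \<le> L' * norm (s *\<^sub>R u)" if "(s, u) \<in> scaled_ball \<rho>" for s u
    using lip[OF that] by (rule order_trans) (auto simp: L'_def intro!: mult_right_mono)
  have "L' > 0" by (simp add: L'_def)
  have P: "sexpandable n (\<lambda>s u. \<Sum>k<n. \<Sum>bs\<in>basis_lists k.
        (\<Prod>b\<leftarrow>bs. w s u \<bullet> b) * (iter_dderiv bs G x \<bullet> j / fact k))"
    using \<open>n > 0\<close> w
    by (intro sexpandable_sum sexpandable_mult sexpandable_prod_list sexpandable_const) auto
  show ?thesis
  proof (rule sexpandable_perturb[OF P])
    show "min \<rho> (\<rho>' / L') > 0" using \<open>\<rho> > 0\<close> \<rho>' \<open>L' > 0\<close> by simp
    show "poly_bdd (scaled_ball (min \<rho> (\<rho>' / L'))) (\<lambda>_ u. C * L' ^ n * norm (u :: 'a) ^ n)"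
      by (intro poly_bdd_mult poly_bdd_const poly_bdd_power poly_bdd_norm)
    fix s :: real and u :: 'a assume su: "(s, u) \<in> scaled_ball (min \<rho> (\<rho>' / L'))"
    have *: "norm (w s u) \<le> L' * norm (s *\<^sub>R u)"
      using su by (intro lip') (auto simp: scaled_ball_def)
    also have "\<dots> < \<rho>'" using su \<open>L' > 0\<close> by (simp add: scaled_ball_def field_simps del: norm_scaleR)
    finally have "norm (w s u) < \<rho>'" .
    note \<rho>'(3)[OF this]
    also have "C * norm (w s u) ^ n \<le> C * (L' * norm (s *\<^sub>R u)) ^ n"
      using * \<rho>'(2) by (intro mult_left_mono power_mono) auto
    also have "\<dots> = s ^ n * (C * L' ^ n * norm u ^ n)"
      using su by (simp add: scaled_ball_def power_mult_distrib)
    finally show "\<bar>G (x + w s u) \<bullet> j - (\<Sum>k<n. \<Sum>bs\<in>basis_lists k.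
        (\<Prod>b\<leftarrow>bs. w s u \<bullet> b) * (iter_dderiv bs G x \<bullet> j / fact k))\<bar> \<le> s ^ n * (C * L' ^ n * norm u ^ n)" .
  qed
qed

text \<open>Multiply by the conjugate \<open>sqrt (1 + v) + T\<close>, where \<open>T\<close> is the
  cubic Taylor polynomial. The product \<open>1 + v - T^2\<close> is a polynomial divisible by
  \<open>v ^ 4\<close>, and the conjugate is at least \<open>1 / 2\<close> since \<open>T\<close>
  is.\<close>

lemma sqrt_Taylor4:
  fixes v :: real
  assumes "\<bar>v\<bar> \<le> 1 / 2"
  shows "\<bar>sqrt (1 + v) - (1 + v / 2 - v\<^sup>2 / 8 + v ^ 3 / 16)\<bar> \<le> v ^ 4"
proof -
  define T where "T = 1 + v / 2 - v\<^sup>2 / 8 + v ^ 3 / 16"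
  have v: "v\<^sup>2 \<le> 1 / 4" "\<bar>v ^ 3\<bar> \<le> 1 / 8"
    using power_mono[OF assms, of 2] power_mono[OF assms, of 3] by (auto simp: power_divide power_abs)
  have T: "T \<ge> 1 / 2" unfolding T_def using v assms by (auto simp: abs_le_iff)
  have "(sqrt (1 + v) - T) * (sqrt (1 + v) + T) = (sqrt (1 + v))\<^sup>2 - T\<^sup>2"
    by (simp add: algebra_simps power2_eq_square)
  also have "\<dots> = v ^ 4 * (- (5 / 64) + v / 64 - v\<^sup>2 / 256)"
    using assms by (simp add: T_def abs_le_iff power2_eq_square power3_eq_cube power4_eq_xxxx field_simps)
  finally have "\<bar>(sqrt (1 + v) - T) * (sqrt (1 + v) + T)\<bar> = \<bar>v ^ 4 * (- (5 / 64) + v / 64 - v\<^sup>2 / 256)\<bar>"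
    by (rule arg_cong)
  moreover have "\<bar>v ^ 4\<bar> = v ^ 4" by simp
  ultimately have eq: "\<bar>sqrt (1 + v) - T\<bar> * \<bar>sqrt (1 + v) + T\<bar> = v ^ 4 * \<bar>- (5 / 64) + v / 64 - v\<^sup>2 / 256\<bar>"
    by (simp only: abs_mult)
  have "\<bar>- (5 / 64) + v / 64 - v\<^sup>2 / 256\<bar> \<le> 1 / 2"
    using v assms zero_le_power2[of v] unfolding abs_le_iff by linarith
  then have "v ^ 4 * \<bar>- (5 / 64) + v / 64 - v\<^sup>2 / 256\<bar> \<le> v ^ 4 * (1 / 2)"
    by (intro mult_left_mono) auto
  moreover have "1 / 2 \<le> \<bar>sqrt (1 + v) + T\<bar>"
  proof -
    have "0 \<le> sqrt (1 + v)" using assms by (simp add: abs_le_iff)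
    with T show ?thesis by linarith
  qed
  then have "\<bar>sqrt (1 + v) - T\<bar> * (1 / 2) \<le> \<bar>sqrt (1 + v) - T\<bar> * \<bar>sqrt (1 + v) + T\<bar>"
    by (intro mult_left_mono) auto
  ultimately have "\<bar>sqrt (1 + v) - T\<bar> * (1 / 2) \<le> v ^ 4 * (1 / 2)"
    unfolding eq by (rule order_trans[rotated])
  then show ?thesis by (simp add: T_def)
qed

text \<open>This is what makes outer Taylor expansions work: the fourth power of such an
  \<open>f\<close> is \<open>s ^ 4\<close> times a function of polynomial growth.\<close>

lemma sexp_vanishing_bound:
  assumes f: "sexp n f c" and "n > 0" and zero: "\<And>u. c 0 u = 0"
  obtains \<rho> r where "\<rho> > 0" "poly_bdd (scaled_ball \<rho>) r"
    "\<And>s u. (s, u) \<in> scaled_ball \<rho> \<Longrightarrow> f s u = s * r s u"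
proof -
  from f \<open>n > 0\<close> have "sexp 1 f c" using sexp_trunc[of 1 "n - 1" f c] by simp
  from sexpE[OF this] zero show ?thesis using that by auto
qed

text \<open>Since the limit \<open>A\<close> is the same for all \<open>u\<close>, the expansion of
  \<open>f / A - 1\<close> has no constant term, and \<open>near\<close> keeps this quantity in the
  range of \<open>sqrt_Taylor4\<close>; the error is then of order \<open>s ^ 4\<close>.\<close>

lemma sexpandable_sqrt:
  fixes f :: "real \<Rightarrow> 'a::real_normed_vector \<Rightarrow> real"
  assumes f: "sexpandable 4 f" and "A > 0"
    and lim: "\<And>u. ((\<lambda>s. f s u) \<longlongrightarrow> A) (at_right 0)"
    and "\<rho> > 0" and near: "\<And>s u. (s, u) \<in> scaled_ball \<rho> \<Longrightarrow> \<bar>f s u - A\<bar> \<le> A / 2"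
  shows "sexpandable 4 (\<lambda>s u. sqrt (f s u))"
proof -
  define v where "v s u = f s u * (1 / A) - 1" for s u
  have "sexpandable 4 v"
    unfolding v_def using f by (intro sexpandable_minus sexpandable_mult sexpandable_const) auto
  then obtain c where c: "sexp 4 v c" unfolding sexpandable_def by blast
  have "c 0 u = 0" for u
  proof -
    have "((\<lambda>s. v s u) \<longlongrightarrow> A * (1 / A) - 1) (at_right 0)"
      unfolding v_def by (intro tendsto_intros lim)
    moreover have "((\<lambda>s. v s u) \<longlongrightarrow> c 0 u) (at_right 0)"
      using sexp_limit[OF c, of 0 u] by simp
    ultimately show ?thesis using \<open>A > 0\<close> tendsto_unique[OF trivial_limit_at_right_real] by fastforce
  qed
  from sexp_vanishing_bound[OF c _ this] obtain \<rho>' r where r: "\<rho>' > 0" "poly_bdd (scaled_ball \<rho>') r"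
    "\<And>s u. (s, u) \<in> scaled_ball \<rho>' \<Longrightarrow> v s u = s * r s u"
    by auto
  have T: "sexpandable 4 (\<lambda>s u. 1 + (1 / 2) * v s u - (1 / 8) * v s u ^ 2 + (1 / 16) * v s u ^ 3)"
    using \<open>sexpandable 4 v\<close>
    by (intro sexpandable_add sexpandable_minus sexpandable_mult sexpandable_power sexpandable_const) auto
  have "sexpandable 4 (\<lambda>s u. sqrt (1 + v s u))"
  proof (rule sexpandable_perturb[OF T])
    show "min \<rho> \<rho>' > 0" using r \<open>\<rho> > 0\<close> by simp
    have "poly_bdd (scaled_ball (min \<rho> \<rho>')) r"
      by (rule poly_bdd_mono[OF r(2)]) (simp add: scaled_ball_mono)
    then show "poly_bdd (scaled_ball (min \<rho> \<rho>')) (\<lambda>s u. r s u ^ 4)" by (rule poly_bdd_power)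
    fix s :: real and u :: 'a assume "(s, u) \<in> scaled_ball (min \<rho> \<rho>')"
    then have su: "(s, u) \<in> scaled_ball \<rho>" "(s, u) \<in> scaled_ball \<rho>'" by (auto simp: scaled_ball_def)
    have "v s u = (f s u - A) / A" using \<open>A > 0\<close> by (simp add: v_def field_simps)
    then have "\<bar>v s u\<bar> = \<bar>f s u - A\<bar> / A" using \<open>A > 0\<close> by (simp add: abs_divide)
    also have "\<dots> \<le> (A / 2) / A" using near[OF su(1)] \<open>A > 0\<close> by (intro divide_right_mono) auto
    finally have "\<bar>v s u\<bar> \<le> 1 / 2" using \<open>A > 0\<close> by simp
    from sqrt_Taylor4[OF this]
    show "\<bar>sqrt (1 + v s u) - (1 + (1 / 2) * v s u - (1 / 8) * v s u ^ 2 + (1 / 16) * v s u ^ 3)\<bar> \<le> s ^ 4 * r s u ^ 4"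
      by (simp add: r(3)[OF su(2)] power_mult_distrib)
  qed
  then have "sexpandable 4 (\<lambda>s u. sqrt A * sqrt (1 + v s u))"
    by (intro sexpandable_mult sexpandable_const) auto
  moreover have "sqrt A * sqrt (1 + v s u) = sqrt (f s u)" for s u
    using \<open>A > 0\<close> by (simp add: v_def real_sqrt_mult[symmetric])
  ultimately show ?thesis by simp
qed

section \<open>Laplace asymptotics\<close>

lemma lborel_integral_affine:
  fixes f :: "'a::euclidean_space \<Rightarrow> real"
  assumes [measurable]: "f \<in> borel_measurable borel" and "c \<noteq> 0"
  shows "(\<integral>x. f x \<partial>lborel) = \<bar>c\<bar> ^ DIM('a) * (\<integral>x. f (t + c *\<^sub>R x) \<partial>lborel)"
proof -
  have "(\<integral>x. f x \<partial>lborel) =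
      (\<integral>x. f x \<partial>density (distr lborel borel (\<lambda>x. t + c *\<^sub>R x)) (\<lambda>_. ennreal (\<bar>c\<bar> ^ DIM('a))))"
    using lborel_affine[OF \<open>c \<noteq> 0\<close>, of t] by (simp add: ennreal_power)
  also have "\<dots> = (\<integral>x. \<bar>c\<bar> ^ DIM('a) * f x \<partial>distr lborel borel (\<lambda>x. t + c *\<^sub>R x))"
    by (subst integral_density) auto
  also have "\<dots> = (\<integral>x. \<bar>c\<bar> ^ DIM('a) * f (t + c *\<^sub>R x) \<partial>lborel)"
    by (subst integral_distr) auto
  finally show ?thesis by simp
qed

text \<open>The affine substitution with factor \<open>-1\<close> shows that the integral equals its
  own negative.\<close>

lemma integral_odd_eq_0:
  fixes f :: "'a::euclidean_space \<Rightarrow> real"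
  assumes "f \<in> borel_measurable borel" and odd: "\<And>u. f (- u) = - f u"
  shows "(\<integral>u. f u \<partial>lborel) = 0"
  using lborel_integral_affine[OF assms(1), of "-1" 0] by (simp add: odd)

section \<open>Integrability against Gaussian weights\<close>

lemma integrable_gaussian:
  assumes "c > 0"
  shows "integrable lborel (\<lambda>u::'a::euclidean_space. exp (- c * (norm u)\<^sup>2))"
proof (rule integrableI_nonneg)
  have one: "(\<integral>\<^sup>+x. ennreal (exp (- c * (x::real)\<^sup>2)) \<partial>lborel) < \<infinity>"
  proof -
    \<comment> \<open>Chosen so that the exponent of the normal density is
      \<open>- c * x^2\<close>.\<close>
    define \<sigma> where "\<sigma> = sqrt (1 / (2 * c))"
    have \<sigma>: "\<sigma> > 0" "\<sigma>\<^sup>2 = 1 / (2 * c)" using \<open>c > 0\<close> by (auto simp: \<sigma>_def)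
    have "integrable lborel (\<lambda>x. sqrt (2 * pi * \<sigma>\<^sup>2) * normal_density 0 \<sigma> x)"
      using \<sigma>(1) by (intro integrable_mult_right integrable_normal_density)
    moreover have "sqrt (2 * pi * \<sigma>\<^sup>2) * normal_density 0 \<sigma> x = exp (- c * x\<^sup>2)" for x
      unfolding normal_density_def \<sigma>(2) using \<open>c > 0\<close> by (simp add: field_simps)
    ultimately have "integrable lborel (\<lambda>x::real. exp (- c * x\<^sup>2))" by simp
    then show ?thesis by (simp add: integrable_iff_bounded)
  qed
  have "exp (- c * (norm u)\<^sup>2) = (\<Prod>b\<in>Basis. exp (- c * (u \<bullet> b)\<^sup>2))" for u :: 'a
  proof -
    have "(norm u)\<^sup>2 = (\<Sum>b\<in>Basis. (u \<bullet> b)\<^sup>2)"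
      unfolding power2_norm_eq_inner by (subst euclidean_inner) (simp add: power2_eq_square)
    then show ?thesis by (simp add: sum_distrib_left exp_sum)
  qed
  then have "(\<integral>\<^sup>+u. ennreal (exp (- c * (norm (u::'a))\<^sup>2)) \<partial>lborel) =
      (\<integral>\<^sup>+u. (\<Prod>b\<in>Basis. ennreal (exp (- c * ((u::'a) \<bullet> b)\<^sup>2))) \<partial>lborel)"
    by (simp add: prod_ennreal)
  also have "\<dots> = (\<Prod>b\<in>(Basis :: 'a set). (\<integral>\<^sup>+x. ennreal (exp (- c * (x::real)\<^sup>2)) \<partial>lborel))"
    by (rule nn_integral_lborel_prod) auto
  also have "\<dots> < \<infinity>" using one by (simp add: power_less_top_ennreal)
  finally show "(\<integral>\<^sup>+u. ennreal (exp (- c * (norm (u::'a))\<^sup>2)) \<partial>lborel) < \<infinity>" .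
qed auto

lemma integrable_gaussian_bound:
  fixes f :: "'a::euclidean_space \<Rightarrow> real"
  assumes "c > 0" and [measurable]: "f \<in> borel_measurable borel"
    and bound: "\<And>u. \<bar>f u\<bar> \<le> C * exp (k * norm u - c * (norm u)\<^sup>2)"
  shows "integrable lborel f"
proof (rule Bochner_Integration.integrable_bound)
  show "integrable lborel (\<lambda>u::'a. \<bar>C\<bar> * exp (k\<^sup>2 / (2 * c)) * exp (- (c / 2) * (norm u)\<^sup>2))"
    using \<open>c > 0\<close> by (intro integrable_mult_right integrable_gaussian) auto
  show "AE u in lborel. norm (f u) \<le> norm (\<bar>C\<bar> * exp (k\<^sup>2 / (2 * c)) * exp (- (c / 2) * (norm u)\<^sup>2))"
  proof (rule AE_I2)
    fix u :: 'a
    \<comment> \<open>Completing the square: half of the quadratic decay pays for the linear growth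
      \<open>k * norm u\<close>.\<close>
    have "0 \<le> (c * norm u - k)\<^sup>2 / (2 * c)" using \<open>c > 0\<close> by simp
    also have "\<dots> = k\<^sup>2 / (2 * c) - (c / 2) * (norm u)\<^sup>2 - (k * norm u - c * (norm u)\<^sup>2)"
      using \<open>c > 0\<close> by (simp add: power2_eq_square field_simps)
    finally have "exp (k * norm u - c * (norm u)\<^sup>2) \<le> exp (k\<^sup>2 / (2 * c)) * exp (- (c / 2) * (norm u)\<^sup>2)"
      unfolding exp_add[symmetric] by simp
    then have "\<bar>C\<bar> * exp (k * norm u - c * (norm u)\<^sup>2) \<le> \<bar>C\<bar> * (exp (k\<^sup>2 / (2 * c)) * exp (- (c / 2) * (norm u)\<^sup>2))"
      by (intro mult_left_mono) auto
    moreover have "C * exp (k * norm u - c * (norm u)\<^sup>2) \<le> \<bar>C\<bar> * exp (k * norm u - c * (norm u)\<^sup>2)"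
      by (intro mult_right_mono) auto
    ultimately have "\<bar>f u\<bar> \<le> \<bar>C\<bar> * (exp (k\<^sup>2 / (2 * c)) * exp (- (c / 2) * (norm u)\<^sup>2))"
      using bound[of u] by linarith
    then show "norm (f u) \<le> norm (\<bar>C\<bar> * exp (k\<^sup>2 / (2 * c)) * exp (- (c / 2) * (norm u)\<^sup>2))"
      by (simp add: abs_mult mult.assoc)
  qed
qed simp

lemma integrable_poly_gaussian:
  fixes f :: "'a::euclidean_space \<Rightarrow> real"
  assumes "c > 0" and "f \<in> borel_measurable borel"
    and bound: "\<And>u. \<bar>f u\<bar> \<le> C * (1 + norm u) ^ M * exp (- c * (norm u)\<^sup>2)"
  shows "integrable lborel f"
proof (rule integrable_gaussian_bound[OF assms(1,2)])
  fix u :: 'a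
  have "(1 + norm u) ^ M \<le> exp (norm u) ^ M"
    using exp_ge_add_one_self[of "norm u"] by (intro power_mono) auto
  also have "\<dots> = exp (M * norm u)" by (simp add: exp_of_nat_mult)
  finally have "\<bar>C\<bar> * ((1 + norm u) ^ M * exp (- c * (norm u)\<^sup>2)) \<le> \<bar>C\<bar> * (exp (M * norm u) * exp (- c * (norm u)\<^sup>2))"
    by (intro mult_left_mono mult_right_mono) auto
  moreover have "C * ((1 + norm u) ^ M * exp (- c * (norm u)\<^sup>2)) \<le> \<bar>C\<bar> * ((1 + norm u) ^ M * exp (- c * (norm u)\<^sup>2))"
    by (intro mult_right_mono) auto
  ultimately show "\<bar>f u\<bar> \<le> \<bar>C\<bar> * exp (M * norm u - c * (norm u)\<^sup>2)"
    using bound[of u] by (simp add: exp_diff exp_minus field_simps)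
qed

lemma poly_bdd_abs: "poly_bdd D r \<Longrightarrow> poly_bdd D (\<lambda>s u. \<bar>r s u\<bar>)"
  by (simp add: poly_bdd_def)

lemma poly_bdd_Un:
  assumes "poly_bdd D r" "poly_bdd D' r"
  shows "poly_bdd (D \<union> D') r"
proof -
  obtain C M where 1: "C \<ge> 0" "\<And>s u. (s, u) \<in> D \<Longrightarrow> \<bar>r s u\<bar> \<le> C * (1 + norm u) ^ M"
    by (rule poly_bddE[OF assms(1)]) blast
  obtain C' M' where 2: "C' \<ge> 0" "\<And>s u. (s, u) \<in> D' \<Longrightarrow> \<bar>r s u\<bar> \<le> C' * (1 + norm u) ^ M'"
    by (rule poly_bddE[OF assms(2)]) blast
  have "poly_bdd UNIV (\<lambda>_ u::'a. C * (1 + norm u) ^ M + C' * (1 + norm u) ^ M')"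
    by (intro poly_bdd_add poly_bdd_mult poly_bdd_const poly_bdd_power poly_bdd_norm)
  then show ?thesis
  proof (rule poly_bdd_le[OF poly_bdd_mono], goal_cases)
    case (2 s u)
    have nn: "C * (1 + norm u) ^ M \<ge> 0" "C' * (1 + norm u) ^ M' \<ge> 0"
      using 1(1) \<open>C' \<ge> 0\<close> by auto
    from 2 show ?case
    proof
      assume "(s, u) \<in> D" from 1(2)[OF this] nn show ?thesis by linarith
    next
      assume "(s, u) \<in> D'" from \<open>(s, u) \<in> D' \<Longrightarrow> \<bar>r s u\<bar> \<le> C' * (1 + norm u) ^ M'\<close>[OF this] nn
      show ?thesis by linarith
    qed
  qed simp
qed

text \<open>The factor \<open>max 1 (exp y)\<close>, rather than \<open>exp \<bar>y\<bar>\<close>, keeps the remainder integrable: multiplied by the Gaussian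
  weight it is bounded either by that weight or by the original exponential.\<close>

lemma abs_exp_diff_Taylor_le:
  fixes y :: real
  shows "\<bar>exp y - (1 + y + y\<^sup>2 / 2 + y ^ 3 / 6)\<bar> \<le> y ^ 4 * max 1 (exp y)"
proof -
  obtain t where t: "(0 \<le> t \<and> t \<le> y) \<or> (y \<le> t \<and> t \<le> 0)"
    "exp y = (\<Sum>m<4. y ^ m / fact m) + exp t / fact 4 * y ^ 4"
  proof (cases "y = 0")
    case True then show ?thesis using that[of 0] by (simp add: eval_nat_numeral)
  next
    case False
    show ?thesis
    proof (cases "y > 0")
      case True
      then obtain t where "0 < t" "t \<le> y" "exp y = (\<Sum>m<4. exp 0 / fact m * y ^ m) + exp t / fact 4 * y ^ 4"
        using Maclaurin2[of y "\<lambda>_. exp" exp 4] by auto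
      then show ?thesis using that[of t] by simp
    next
      case False
      with \<open>y \<noteq> 0\<close> have "y < 0" by simp
      then obtain t where "y < t" "t < 0" "exp y = (\<Sum>m<4. exp 0 / fact m * y ^ m) + exp t / fact 4 * y ^ 4"
        using Maclaurin_minus[of y 4 "\<lambda>_. exp" exp] by auto
      then show ?thesis using that[of t] by simp
    qed
  qed
  have "(\<Sum>m<4. y ^ m / fact m) = 1 + y + y\<^sup>2 / 2 + y ^ 3 / 6"
    by (simp add: eval_nat_numeral)
  with t(2) have "\<bar>exp y - (1 + y + y\<^sup>2 / 2 + y ^ 3 / 6)\<bar> = y ^ 4 * (exp t / 24)"
    by (simp add: abs_mult fact_numeral)
  also have "exp t / 24 \<le> max 1 (exp y)"
  proof -
    have "exp t \<le> max 1 (exp y)" using t(1) by (auto simp: le_max_iff_disj)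
    then show ?thesis using exp_gt_zero[of t] by linarith
  qed
  finally show ?thesis by (simp add: mult_left_mono)
qed

lemma sexp_poly_bdd:
  assumes f: "sexp n f c"
  obtains \<rho> where "\<rho> > 0" "poly_bdd (scaled_ball \<rho>) f"
proof -
  obtain \<rho> r where r: "\<rho> > 0" "poly_bdd (scaled_ball \<rho>) r"
    "\<And>s u. (s, u) \<in> scaled_ball \<rho> \<Longrightarrow> f s u = (\<Sum>k<n. s ^ k * c k u) + s ^ n * r s u"
    using sexpE[OF f] by blast
  have "poly_bdd (scaled_ball \<rho>) (\<lambda>s u. (\<Sum>k<n. s ^ k * c k u) + s ^ n * r s u)"
    by (intro poly_bdd_add poly_bdd_mult poly_bdd_sum poly_bdd_scale r(2) poly_bdd_coef[OF sexp_coef[OF f]])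
  then have "poly_bdd (scaled_ball \<rho>) f"
    by (rule poly_bdd_le) (simp add: r(3))
  with r(1) show ?thesis by (rule that)
qed

lemma sexp_coef_0:
  assumes "coef 0 c" "n > 0"
  shows "sexp n (\<lambda>_. c) (\<lambda>k u. if k = 0 then c u else 0)"
proof (rule sexpI[where \<rho>=1 and r="\<lambda>_ _. 0"])
  show "c u = (\<Sum>k<n. s ^ k * (if k = 0 then c u else 0)) + s ^ n * 0" for s :: real and u
    using \<open>n > 0\<close> by (simp add: if_distrib sum.delta' cong: if_cong)
  show "coef k (\<lambda>u. if k = 0 then c u else 0)" for k
    using \<open>coef 0 c\<close> by (cases "k = 0") (auto intro: coef_zero)
qed (auto intro: poly_bdd_const)

lemma sexp_coef_eqI:
  assumes "sexp n f c" "k < n" "\<And>i. i < k \<Longrightarrow> c i u = 0"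
    and "((\<lambda>s. f s u / s ^ k) \<longlongrightarrow> l) (at_right 0)"
  shows "c k u = l"
  using sexp_limit[OF assms(1,3,2)] assms(4) by (rule tendsto_unique[OF trivial_limit_at_right_real])

lemma tendsto_line_at_right: "((\<lambda>s. a + s *\<^sub>R u) \<longlongrightarrow> a) (at_right 0)" for a u :: "'a::real_normed_vector"
proof -
  have "((\<lambda>s. a + s *\<^sub>R u) \<longlongrightarrow> a + 0 *\<^sub>R u) (at_right 0)" by (intro tendsto_intros)
  then show ?thesis by simp
qed

lemma eventually_norm_scaleR_less:
  fixes u :: "'a::real_normed_vector"
  assumes "\<rho> > 0"
  shows "\<forall>\<^sub>F s in at_right 0. norm (s *\<^sub>R u) < \<rho>"
  using tendsto_norm_zero[OF tendsto_line_at_right[of 0 u, simplified]] assms by (rule order_tendstoD(2))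

text \<open>After \<open>h = s u\<close> the integrand \<open>F s\<close> lives on a ball of radius
  \<open>\<rho>1 / s\<close>, whereas its expansion \<open>S s\<close> is integrated over the whole
  space. One bound on \<open>F - S\<close>, namely \<open>s ^ 4\<close> times polynomial times
  Gaussian, covers the ball and its complement alike. Integrating \<open>S\<close> term by term
  leaves orders 0 and 2 only.\<close>

theorem Laplace_expansion:
  fixes q g :: "'a::euclidean_space \<Rightarrow> real"
  assumes [measurable]: "q \<in> borel_measurable borel" "g \<in> borel_measurable borel"
    and "c > 0" "\<rho> > 0" and q_ge: "\<And>h. norm h < \<rho> \<Longrightarrow> c * (norm h)\<^sup>2 \<le> q h"
    and q: "sexp 4 (\<lambda>s u. q (s *\<^sub>R u) / s\<^sup>2) Q"
    and g: "sexp 4 (\<lambda>s u. g (s *\<^sub>R u) / s ^ m) P"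
  shows "\<exists>\<rho>1 B K. 0 < \<rho>1 \<and> \<rho>1 \<le> \<rho> \<and>
    (\<forall>s. 0 < s \<and> s \<le> 1 \<longrightarrow>
      \<bar>(\<integral>h. indicator (ball 0 \<rho>1) h * exp (- q h / (2 * s\<^sup>2)) * g h \<partial>lborel) / s ^ (DIM('a) + m)
        - (\<integral>u. exp (- Q 0 u / 2) * P 0 u \<partial>lborel) - s\<^sup>2 * B\<bar> \<le> K * s ^ 4)"
proof -
  have cont: "continuous_on UNIV (Q k)" "continuous_on UNIV (P k)" for k
    using sexp_coef[OF q] sexp_coef[OF g] by (auto simp: coef_def)
  \<comment> \<open>The quadratic lower bound on \<open>q\<close> passes to the limit and gives the
    limiting weight Gaussian decay.\<close>
  have Q0_ge: "c * (norm u)\<^sup>2 \<le> Q 0 u" for u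
  proof (rule tendsto_lowerbound)
    show "((\<lambda>s. q (s *\<^sub>R u) / s\<^sup>2) \<longlongrightarrow> Q 0 u) (at_right 0)"
      using sexp_limit[OF q, of 0 u] by simp
    have "\<forall>\<^sub>F s in at_right 0. norm (s *\<^sub>R u) < \<rho>"
      using \<open>\<rho> > 0\<close> by (rule eventually_norm_scaleR_less)
    then show "\<forall>\<^sub>F s in at_right 0. c * (norm u)\<^sup>2 \<le> q (s *\<^sub>R u) / s\<^sup>2"
      using eventually_at_right_less[of "0::real"]
    proof eventually_elim
      case (elim s)
      have "c * (norm (s *\<^sub>R u))\<^sup>2 \<le> q (s *\<^sub>R u)" using q_ge elim by blast
      then show ?case using elim by (simp add: power_mult_distrib field_simps)
    qed
  qed simp

  \<comment> \<open>The deviation of the exponent from its limit: the kernel equals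
    \<open>exp (- Q 0 u / 2) * exp (y s u)\<close>. It has no term of order 0 in
    \<open>s\<close>.\<close>
  define y where "y s u = (- (1 / 2)) * (q (s *\<^sub>R u) / s\<^sup>2) + (1 / 2) * Q 0 u" for s u
  have "sexpandable 4 (\<lambda>_. Q 0)"
    using sexp_coef_0[OF sexp_coef[OF q, of 0], of 4] unfolding sexpandable_def by auto
  then have "\<exists>yc. sexp 4 y yc"
    unfolding y_def sexpandable_def[symmetric]
    by (intro sexpandable_add sexpandable_mult sexpandable_const)
      (use q in \<open>auto simp: sexpandable_def\<close>)
  then obtain yc where yc: "sexp 4 y yc" by blast
  have y_lim: "((\<lambda>s. y s u) \<longlongrightarrow> 0) (at_right 0)" for u
  proof -
    have "((\<lambda>s. y s u) \<longlongrightarrow> - (1 / 2) * Q 0 u + (1 / 2) * Q 0 u) (at_right 0)"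
      unfolding y_def using sexp_limit[OF q, of 0 u] by (intro tendsto_intros) auto
    then show ?thesis by simp
  qed
  have "yc 0 u = 0" for u
    by (rule sexp_coef_eqI[OF yc]) (use y_lim[of u] in simp_all)
  from sexp_vanishing_bound[OF yc _ this] obtain \<rho>y ry where ry: "\<rho>y > 0" "poly_bdd (scaled_ball \<rho>y) ry"
    "\<And>s u. (s, u) \<in> scaled_ball \<rho>y \<Longrightarrow> y s u = s * ry s u" by auto

  \<comment> \<open>The cubic Taylor polynomial of \<open>exp\<close> at \<open>y\<close>; as
    \<open>y\<close> is of order \<open>s\<close>, what it omits is of order
    \<open>s ^ 4\<close>.\<close>
  define E where "E s u = 1 + y s u + (1 / 2) * y s u ^ 2 + (1 / 6) * y s u ^ 3" for s u
  have "sexpandable 4 E"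
    unfolding E_def using yc
    by (intro sexpandable_add sexpandable_mult sexpandable_power sexpandable_const) (auto simp: sexpandable_def)
  then obtain ec where ec: "sexp 4 E ec" unfolding sexpandable_def by blast
  have "ec 0 u = 1" for u
  proof (rule sexp_coef_eqI[OF ec])
    have "((\<lambda>s. E s u) \<longlongrightarrow> 1 + 0 + (1 / 2) * 0 ^ 2 + (1 / 6) * 0 ^ 3) (at_right 0)"
      unfolding E_def by (intro tendsto_intros y_lim)
    then show "((\<lambda>s. E s u / s ^ 0) \<longlongrightarrow> 1) (at_right 0)" by simp
  qed auto

  define G where "G s u = g (s *\<^sub>R u) / s ^ m" for s u
  define Z where "Z k u = (\<Sum>i\<le>k. ec i u * P (k - i) u)" for k u
  have Z: "sexp 4 (\<lambda>s u. E s u * G s u) Z"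
    unfolding Z_def G_def by (rule sexp_mult[OF ec g])
  have Z0: "Z 0 u = P 0 u" for u
    by (simp add: Z_def \<open>ec 0 u = 1\<close>)
  obtain \<rho>z rz where rz: "\<rho>z > 0" "poly_bdd (scaled_ball \<rho>z) rz"
    "\<And>s u. (s, u) \<in> scaled_ball \<rho>z \<Longrightarrow> E s u * G s u = (\<Sum>k<4. s ^ k * Z k u) + s ^ 4 * rz s u"
    using sexpE[OF Z] by blast
  obtain \<rho>g where \<rho>g: "\<rho>g > 0" "poly_bdd (scaled_ball \<rho>g) G"
    using sexp_poly_bdd[OF g] unfolding G_def by blast

  define \<rho>1 where "\<rho>1 = min (min \<rho> \<rho>g) (min \<rho>y \<rho>z)"
  have \<rho>1: "0 < \<rho>1" "\<rho>1 \<le> \<rho>" using \<open>\<rho> > 0\<close> ry(1) rz(1) \<rho>g(1) by (auto simp: \<rho>1_def)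
  define D where "D = (scaled_ball \<rho>1 :: (real \<times> 'a) set)"
  have D: "D \<subseteq> scaled_ball \<rho>g" "D \<subseteq> scaled_ball \<rho>y" "D \<subseteq> scaled_ball \<rho>z" "D \<subseteq> scaled_ball \<rho>"
    unfolding D_def by (auto intro!: scaled_ball_mono simp: \<rho>1_def)
  define D' where "D' = {(s, u :: 'a). 0 < s \<and> s \<le> 1 \<and> \<rho>1 \<le> norm (s *\<^sub>R u)}"

  define F where "F s u = indicator (ball 0 \<rho>1) (s *\<^sub>R u) * exp (- q (s *\<^sub>R u) / (2 * s\<^sup>2)) * G s u" for s u
  define S where "S s u = (\<Sum>k<4. s ^ k * (exp (- Q 0 u / 2) * Z k u))" for s u
  \<comment> \<open>The rate is \<open>c / 2\<close> because the kernel carries half of the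
    quadratic form.\<close>
  define gauss where "gauss u = exp (- (c / 2) * (norm u)\<^sup>2)" for u :: 'a
  \<comment> \<open>Dividing by the desired bound reduces the estimate of \<open>F - S\<close> to
    polynomial boundedness, shown separately on \<open>D\<close> and on its complement
    \<open>D'\<close> within \<open>0 < s \<le> 1\<close>.\<close>
  define R where "R s u = (F s u - S s u) / (s ^ 4 * gauss u)" for s u
  have expQ: "exp (- Q 0 u / 2) \<le> gauss u" for u
    using Q0_ge[of u] by (simp add: gauss_def)
  have "poly_bdd D R"
  proof (rule poly_bdd_le)
    show "poly_bdd D (\<lambda>s u. ry s u ^ 4 * \<bar>G s u\<bar> + \<bar>rz s u\<bar>)"
      using ry(2) rz(2) \<rho>g(2) D
      by (intro poly_bdd_add poly_bdd_mult poly_bdd_power)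
        (auto intro: poly_bdd_le[OF poly_bdd_mono])
    fix s and u :: 'a assume su: "(s, u) \<in> D"
    then have s: "0 < s" "s \<le> 1" "norm (s *\<^sub>R u) < \<rho>1" by (auto simp: D_def scaled_ball_def)
    then have "norm (s *\<^sub>R u) < \<rho>" using \<rho>1 by simp
    from q_ge[OF this] have "c * (norm u)\<^sup>2 \<le> q (s *\<^sub>R u) / s\<^sup>2"
      using s by (simp add: power_mult_distrib field_simps)
    \<comment> \<open>The left side is the original kernel, which \<open>q_ge\<close> bounds by
      \<open>gauss\<close>. Together with \<open>expQ\<close> this covers both alternatives of the
      factor \<open>max 1 (exp y)\<close> in the Taylor remainder.\<close>
    then have e1: "exp (- Q 0 u / 2) * exp (y s u) \<le> gauss u"
      unfolding exp_add[symmetric] y_def gauss_def by (simp add: field_simps)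
    have "F s u = exp (- Q 0 u / 2) * exp (y s u) * G s u"
      unfolding F_def exp_add[symmetric] y_def using s by (simp add: field_simps)
    moreover have "S s u = exp (- Q 0 u / 2) * (\<Sum>k<4. s ^ k * Z k u)"
      by (simp add: S_def sum_distrib_left mult_ac)
    then have "S s u = exp (- Q 0 u / 2) * (E s u * G s u - s ^ 4 * rz s u)"
      using rz(3)[of s u] su D(3) by auto
    ultimately have "F s u - S s u = exp (- Q 0 u / 2) * (exp (y s u) - E s u) * G s u + exp (- Q 0 u / 2) * s ^ 4 * rz s u"
      by (simp add: algebra_simps)
    also have "\<bar>\<dots>\<bar> \<le> exp (- Q 0 u / 2) * \<bar>exp (y s u) - E s u\<bar> * \<bar>G s u\<bar> + exp (- Q 0 u / 2) * s ^ 4 * \<bar>rz s u\<bar>"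
      using s(1) by (intro order_trans[OF abs_triangle_ineq]) (auto simp: abs_mult)
    also have "\<dots> \<le> gauss u * (s ^ 4 * ry s u ^ 4) * \<bar>G s u\<bar> + gauss u * s ^ 4 * \<bar>rz s u\<bar>"
    proof (intro add_mono mult_right_mono)
      have "exp (- Q 0 u / 2) * \<bar>exp (y s u) - E s u\<bar> \<le> exp (- Q 0 u / 2) * (y s u ^ 4 * max 1 (exp (y s u)))"
        using abs_exp_diff_Taylor_le[of "y s u"] by (intro mult_left_mono) (auto simp: E_def)
      also have "\<dots> = y s u ^ 4 * (exp (- Q 0 u / 2) * max 1 (exp (y s u)))" by simp
      also have "\<dots> \<le> y s u ^ 4 * gauss u"
        using e1 expQ[of u] by (intro mult_left_mono) (auto simp: max_def)
      also have "\<dots> = gauss u * (s ^ 4 * ry s u ^ 4)"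
        using ry(3) su D(2) by (auto simp: power_mult_distrib)
      finally show "exp (- Q 0 u / 2) * \<bar>exp (y s u) - E s u\<bar> \<le> gauss u * (s ^ 4 * ry s u ^ 4)" .
    qed (use expQ[of u] s in auto)
    finally have "\<bar>F s u - S s u\<bar> \<le> (s ^ 4 * gauss u) * (ry s u ^ 4 * \<bar>G s u\<bar> + \<bar>rz s u\<bar>)"
      by (simp add: algebra_simps)
    then show "\<bar>R s u\<bar> \<le> \<bar>ry s u ^ 4 * \<bar>G s u\<bar> + \<bar>rz s u\<bar>\<bar>"
      using s(1) by (simp add: R_def abs_mult gauss_def field_simps)
  qed
  moreover have "poly_bdd D' R"
  proof (rule poly_bdd_le)
    show "poly_bdd D' (\<lambda>s u. (1 / \<rho>1) ^ 4 * norm u ^ 4 * (\<Sum>k<4. \<bar>Z k u\<bar>))"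
      by (intro poly_bdd_mult poly_bdd_power poly_bdd_const poly_bdd_norm poly_bdd_sum
          poly_bdd_abs poly_bdd_coef[OF sexp_coef[OF Z]])
    fix s and u :: 'a assume "(s, u) \<in> D'"
    then have s: "0 < s" "s \<le> 1" "\<rho>1 \<le> s * norm u" by (auto simp: D'_def)
    have F0: "F s u = 0" using s by (simp add: F_def)
    \<comment> \<open>Beyond the cutoff \<open>norm u\<close> is at least
      \<open>\<rho>1 / s\<close>, so four powers of it supply the factor \<open>s ^ 4\<close> that
      the tail of \<open>S\<close> lacks.\<close>
    have one: "1 \<le> s ^ 4 * ((1 / \<rho>1) ^ 4 * norm u ^ 4)"
      using s(3) \<rho>1(1) one_le_power[of "s * norm u / \<rho>1" 4]
      by (simp add: power_mult_distrib power_divide)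
    have "\<bar>S s u\<bar> \<le> (\<Sum>k<4. gauss u * \<bar>Z k u\<bar>)"
      unfolding S_def
    proof (rule sum_abs[THEN order_trans], intro sum_mono)
      fix k
      have "\<bar>s ^ k\<bar> * (exp (- Q 0 u / 2) * \<bar>Z k u\<bar>) \<le> 1 * (gauss u * \<bar>Z k u\<bar>)"
        using s expQ[of u] by (intro mult_mono) (auto simp: power_le_one gauss_def)
      then show "\<bar>s ^ k * (exp (- Q 0 u / 2) * Z k u)\<bar> \<le> gauss u * \<bar>Z k u\<bar>"
        by (simp add: abs_mult)
    qed
    also have "\<dots> = 1 * (gauss u * (\<Sum>k<4. \<bar>Z k u\<bar>))" by (simp add: sum_distrib_left)
    also have "\<dots> \<le> (s ^ 4 * ((1 / \<rho>1) ^ 4 * norm u ^ 4)) * (gauss u * (\<Sum>k<4. \<bar>Z k u\<bar>))"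
      using one by (intro mult_right_mono mult_nonneg_nonneg sum_nonneg) (auto simp: gauss_def)
    finally have "\<bar>F s u - S s u\<bar> \<le> (s ^ 4 * gauss u) * ((1 / \<rho>1) ^ 4 * norm u ^ 4 * (\<Sum>k<4. \<bar>Z k u\<bar>))"
      by (simp add: F0 algebra_simps)
    then have "\<bar>R s u\<bar> \<le> (1 / \<rho>1) ^ 4 * norm u ^ 4 * (\<Sum>k<4. \<bar>Z k u\<bar>)"
      unfolding R_def abs_divide using s(1) by (subst pos_divide_le_eq) (auto simp: gauss_def abs_mult mult_ac)
    then show "\<bar>R s u\<bar> \<le> \<bar>(1 / \<rho>1) ^ 4 * norm u ^ 4 * (\<Sum>k<4. \<bar>Z k u\<bar>)\<bar>" by linarith
  qed
  ultimately obtain C M where CM: "C \<ge> 0" "\<And>s u. (s, u) \<in> D \<union> D' \<Longrightarrow> \<bar>R s u\<bar> \<le> C * (1 + norm u) ^ M"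
    by (rule poly_bddE[OF poly_bdd_Un]) blast
  have FS: "\<bar>F s u - S s u\<bar> \<le> s ^ 4 * (C * (1 + norm u) ^ M * gauss u)" if "0 < s" "s \<le> 1" for s u
  proof -
    have "(s, u) \<in> D \<union> D'" using that by (auto simp: D_def D'_def scaled_ball_def)
    from CM(2)[OF this] that show ?thesis
      unfolding R_def abs_divide by (subst (asm) pos_divide_le_eq) (auto simp: gauss_def abs_mult mult_ac)
  qed

  have [measurable]: "Z k \<in> borel_measurable borel" "Q k \<in> borel_measurable borel" "P k \<in> borel_measurable borel" for k
    using sexp_coef[OF Z] cont by (auto simp: coef_def intro: borel_measurable_continuous_onI)
  have [measurable]: "gauss \<in> borel_measurable borel" unfolding gauss_def by measurable
  have int_dom: "integrable lborel (\<lambda>u::'a. C * (1 + norm u) ^ M * gauss u)"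
    using \<open>c > 0\<close> CM(1) by (intro integrable_poly_gaussian[of "c / 2" _ C M]) (auto simp: gauss_def)
  have int_Z: "integrable lborel (\<lambda>u. exp (- Q 0 u / 2) * Z k u)" for k
  proof -
    have "poly_bdd UNIV (\<lambda>_. Z k)" using sexp_coef[OF Z, of k] by (simp add: coef_def)
    then obtain Ck Mk where Ck: "Ck \<ge> 0" "\<And>u. \<bar>Z k u\<bar> \<le> Ck * (1 + norm u) ^ Mk"
      by (rule poly_bddE) blast
    have "\<bar>exp (- Q 0 u / 2) * Z k u\<bar> \<le> Ck * (1 + norm u) ^ Mk * exp (- (c / 2) * (norm u)\<^sup>2)" for u
      using mult_mono[OF Ck(2)[of u] expQ[of u]] Ck(1) by (simp add: gauss_def abs_mult mult_ac)
    then show ?thesis using \<open>c > 0\<close> by (intro integrable_poly_gaussian[of "c / 2" _ Ck Mk]) auto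
  qed
  define J where "J k = (\<integral>u. exp (- Q 0 u / 2) * Z k u \<partial>lborel)" for k
  \<comment> \<open>The limiting weight is even because \<open>Q 0\<close> is, and
    \<open>Z k\<close> has the parity of \<open>k\<close>.\<close>
  have J_odd: "J k = 0" if "odd k" for k
    unfolding J_def
  proof (rule integral_odd_eq_0)
    show "exp (- Q 0 (- u) / 2) * Z k (- u) = - (exp (- Q 0 u / 2) * Z k u)" for u
      using sexp_coef[OF Z, of k] sexp_coef[OF q, of 0] that by (simp add: coef_def)
  qed auto
  have int_S: "integrable lborel (S s)" for s
    unfolding S_def using int_Z by (intro Bochner_Integration.integrable_sum integrable_mult_right)
  have "(\<integral>u. S s u \<partial>lborel) = (\<Sum>k<4. s ^ k * J k)" for s
    unfolding S_def J_def using int_Z by (subst Bochner_Integration.integral_sum) auto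
  also have "(\<Sum>k<4. s ^ k * J k) = J 0 + s\<^sup>2 * J 2" for s
  proof -
    have "J 1 = 0" "J 3 = 0" by (simp_all add: J_odd)
    then show ?thesis by (simp add: eval_nat_numeral)
  qed
  finally have S_int: "(\<integral>u. S s u \<partial>lborel) = J 0 + s\<^sup>2 * J 2" for s .
  define K where "K = (\<integral>u. C * (1 + norm u) ^ M * gauss u \<partial>lborel)"
  show ?thesis
  proof (intro exI conjI allI impI)
    show "0 < \<rho>1" "\<rho>1 \<le> \<rho>" by fact+
    fix s :: real assume s: "0 < s \<and> s \<le> 1"
    have sc[measurable]: "(\<lambda>u::'a. s *\<^sub>R u) \<in> borel_measurable borel" by measurable
    have [measurable]: "(\<lambda>u::'a. indicator (ball 0 \<rho>1) (s *\<^sub>R u) :: real) \<in> borel_measurable borel"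
      by (rule measurable_compose[OF sc borel_measurable_indicator]) auto
    have [measurable]: "(indicator (ball 0 \<rho>1) :: 'a \<Rightarrow> real) \<in> borel_measurable borel"
      by (rule borel_measurable_indicator) auto
    have [measurable]: "F s \<in> borel_measurable borel"
      unfolding F_def G_def by measurable
    have [measurable]: "S s \<in> borel_measurable borel"
      unfolding S_def by measurable
    have int_FS: "integrable lborel (\<lambda>u. F s u - S s u)"
      by (rule Bochner_Integration.integrable_bound[OF integrable_mult_right[OF int_dom, of "s ^ 4"]])
        (use FS s CM(1) in \<open>auto simp: gauss_def intro: order_trans\<close>)
    then have "integrable lborel (\<lambda>u. (F s u - S s u) + S s u)"
      using int_S by (rule Bochner_Integration.integrable_add)
    then have int_F: "integrable lborel (F s)" by simp
    have "(\<integral>h. indicator (ball 0 \<rho>1) h * exp (- q h / (2 * s\<^sup>2)) * g h \<partial>lborel) =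
        s ^ DIM('a) * (\<integral>u. indicator (ball 0 \<rho>1) (s *\<^sub>R u) * exp (- q (s *\<^sub>R u) / (2 * s\<^sup>2)) * g (s *\<^sub>R u) \<partial>lborel)"
      using s by (subst lborel_integral_affine[where c=s and t=0]) auto
    also have "(\<integral>u. indicator (ball 0 \<rho>1) (s *\<^sub>R u) * exp (- q (s *\<^sub>R u) / (2 * s\<^sup>2)) * g (s *\<^sub>R u) \<partial>lborel)
        = (\<integral>u. s ^ m * F s u \<partial>lborel)"
      using s by (intro Bochner_Integration.integral_cong) (auto simp: F_def G_def)
    finally have "(\<integral>h. indicator (ball 0 \<rho>1) h * exp (- q h / (2 * s\<^sup>2)) * g h \<partial>lborel) / s ^ (DIM('a) + m) = (\<integral>u. F s u \<partial>lborel)"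
      using s by (simp add: power_add)
    moreover have "(\<integral>u. F s u \<partial>lborel) - (J 0 + s\<^sup>2 * J 2) = (\<integral>u. F s u - S s u \<partial>lborel)"
      unfolding S_int[symmetric] using int_F int_S by simp
    moreover have "\<bar>\<integral>u. F s u - S s u \<partial>lborel\<bar> \<le> (\<integral>u. s ^ 4 * (C * (1 + norm u) ^ M * gauss u) \<partial>lborel)"
      using FS s int_FS int_dom
      by (intro order_trans[OF integral_abs_bound] integral_mono) auto
    moreover have "J 0 = (\<integral>u. exp (- Q 0 u / 2) * P 0 u \<partial>lborel)"
      by (simp add: J_def Z0)
    ultimately show "\<bar>(\<integral>h. indicator (ball 0 \<rho>1) h * exp (- q h / (2 * s\<^sup>2)) * g h \<partial>lborel) / s ^ (DIM('a) + m)
        - (\<integral>u. exp (- Q 0 u / 2) * P 0 u \<partial>lborel) - s\<^sup>2 * J 2\<bar> \<le> K * s ^ 4"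
      by (simp add: K_def mult.commute)
  qed
qed

text \<open>Supplies the majorant for the difference quotients in
  \<open>gaussian_integration_by_parts\<close>.\<close>

lemma abs_exp_minus_one_le: "\<bar>exp x - 1\<bar> \<le> \<bar>x\<bar> * exp \<bar>x\<bar>" for x :: real
proof -
  obtain t where t: "\<bar>t\<bar> \<le> \<bar>x\<bar>" "exp x = 1 + exp t * x"
    using Maclaurin_exp_le[of x 1] by auto
  then have "exp t \<le> exp \<bar>x\<bar>" by simp
  then have "\<bar>x\<bar> * exp t \<le> \<bar>x\<bar> * exp \<bar>x\<bar>" by (intro mult_left_mono) auto
  with t(2) show ?thesis by (simp add: abs_mult mult.commute)
qed

section \<open>Gaussian second moments for an injective linear map\<close>

lemma gaussian_weight_bound:
  fixes A :: "'a::euclidean_space \<Rightarrow> 'b::euclidean_space"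
  assumes "linear A" "inj A"
  obtains c where "c > 0" "\<And>u. exp (- (norm (A u))\<^sup>2 / 2) \<le> exp (- c * (norm u)\<^sup>2)"
proof -
  obtain B where B: "B > 0" "\<And>u. B * norm u \<le> norm (A u)"
    using linear_inj_bounded_below_pos[OF assms] by blast
  show ?thesis
  proof (rule that)
    show "B\<^sup>2 / 2 > 0" using B(1) by simp
    fix u
    have "(B * norm u)\<^sup>2 \<le> (norm (A u))\<^sup>2" using B by (intro power_mono) auto
    then show "exp (- (norm (A u))\<^sup>2 / 2) \<le> exp (- (B\<^sup>2 / 2) * (norm u)\<^sup>2)"
      by (simp add: power_mult_distrib)
  qed
qed

lemma borel_measurable_linear:
  fixes A :: "'a::euclidean_space \<Rightarrow> 'b::euclidean_space"
  assumes "linear A"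
  shows "A \<in> borel_measurable borel"
  using assms by (auto intro!: borel_measurable_continuous_onI linear_continuous_on simp: linear_conv_bounded_linear)

lemma integrable_gaussian_weight:
  fixes A :: "'a::euclidean_space \<Rightarrow> 'b::euclidean_space"
  assumes A: "linear A" "inj A"
  shows "integrable lborel (\<lambda>u. exp (- (norm (A u))\<^sup>2 / 2))"
proof -
  have [measurable]: "A \<in> borel_measurable borel" using A(1) by (rule borel_measurable_linear)
  obtain c where c: "c > 0" "\<And>u. exp (- (norm (A u))\<^sup>2 / 2) \<le> exp (- c * (norm u)\<^sup>2)"
    by (rule gaussian_weight_bound[OF A]) blast
  show ?thesis
    using c by (intro integrable_gaussian_bound[of c _ 1 0]) auto
qed

lemma integrable_gaussian_moment2:
  fixes A :: "'a::euclidean_space \<Rightarrow> 'b::euclidean_space" and l l' :: "'a \<Rightarrow> real"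
  assumes A: "linear A" "inj A" and l: "linear l" "linear l'"
  shows "integrable lborel (\<lambda>u. exp (- (norm (A u))\<^sup>2 / 2) * (l u * l' u))"
proof -
  have [measurable]: "A \<in> borel_measurable borel" "l \<in> borel_measurable borel" "l' \<in> borel_measurable borel"
    using A(1) l by (auto intro: borel_measurable_linear)
  obtain c where c: "c > 0" "\<And>u. exp (- (norm (A u))\<^sup>2 / 2) \<le> exp (- c * (norm u)\<^sup>2)"
    by (rule gaussian_weight_bound[OF A]) blast
  have "poly_bdd UNIV (\<lambda>_ u. l u * l' u)"
    using coef_mult[OF coef_linear[OF l(1)] coef_linear[OF l(2)]] by (simp add: coef_def)
  then obtain C M where CM: "C \<ge> 0" "\<And>u. \<bar>l u * l' u\<bar> \<le> C * (1 + norm u) ^ M"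
    by (rule poly_bddE) blast
  show ?thesis
  proof (rule integrable_poly_gaussian[OF c(1)])
    fix u
    have "exp (- (norm (A u))\<^sup>2 / 2) * \<bar>l u * l' u\<bar> \<le> exp (- c * (norm u)\<^sup>2) * (C * (1 + norm u) ^ M)"
      using c(2) CM by (intro mult_mono) auto
    then show "\<bar>exp (- (norm (A u))\<^sup>2 / 2) * (l u * l' u)\<bar> \<le> C * (1 + norm u) ^ M * exp (- c * (norm u)\<^sup>2)"
      by (simp add: abs_mult mult_ac)
  qed measurable
qed

text \<open>Stein's identity, derived from translation invariance. Tilting the weight by
  \<open>exp (t * z u)\<close> amounts to a shift by \<open>t w\<close>, so \<open>I t\<close> has a
  closed form; the identity compares the two ways of computing the derivative of \<open>I\<close> at
  0, with dominated convergence along a sequence on the integral side.\<close>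

lemma gaussian_integration_by_parts:
  fixes A :: "'a::euclidean_space \<Rightarrow> 'b::euclidean_space" and l :: "'a \<Rightarrow> real"
  assumes A: "linear A" "inj A" and l: "linear l"
  shows "(\<integral>u. exp (- (norm (A u))\<^sup>2 / 2) * (l u * (A u \<bullet> A w)) \<partial>lborel) =
      l w * (\<integral>u. exp (- (norm (A u))\<^sup>2 / 2) \<partial>lborel)"
proof -
  define E where "E u = exp (- (norm (A u))\<^sup>2 / 2)" for u
  define z where "z u = A u \<bullet> A w" for u
  have [measurable]: "A \<in> borel_measurable borel" "l \<in> borel_measurable borel"
    using A(1) l by (auto intro: borel_measurable_linear)
  have [measurable]: "E \<in> borel_measurable borel" "z \<in> borel_measurable borel"
    unfolding E_def z_def by measurable
  obtain c where "c > 0" and E_le: "\<And>u. E u \<le> exp (- c * (norm u)\<^sup>2)"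
    unfolding E_def by (rule gaussian_weight_bound[OF A]) blast
  obtain Kl where Kl: "\<And>u. \<bar>l u\<bar> \<le> Kl * norm u"
    using linear_bounded[OF l] by auto
  obtain KA where KA: "\<And>u. norm (A u) \<le> KA * norm u"
    using linear_bounded[OF A(1)] by auto
  define Kz where "Kz = \<bar>KA\<bar> * norm (A w)"
  have Kz: "\<bar>z u\<bar> \<le> Kz * norm u" for u
  proof -
    have "\<bar>z u\<bar> \<le> norm (A u) * norm (A w)" unfolding z_def by (rule Cauchy_Schwarz_ineq2)
    also have "norm (A u) \<le> \<bar>KA\<bar> * norm u" using KA[of u] by (rule order_trans) (intro mult_right_mono, auto)
    finally show ?thesis by (simp add: Kz_def mult_ac mult_right_mono)
  qed
  have "Kz \<ge> 0" by (simp add: Kz_def)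
  have l_exp: "\<bar>l u\<bar> \<le> \<bar>Kl\<bar> * exp (norm u)" for u
  proof -
    have "\<bar>l u\<bar> \<le> \<bar>Kl\<bar> * norm u" using Kl[of u] by (rule order_trans) (intro mult_right_mono, auto)
    also have "\<dots> \<le> \<bar>Kl\<bar> * exp (norm u)" using exp_ge_add_one_self[of "norm u"] by (intro mult_left_mono) linarith+
    finally show ?thesis .
  qed
  \<comment> \<open>The exponent \<open>2 * Kz\<close> leaves room for two factors
    \<open>exp \<bar>z u\<bar>\<close>: one bounds the exponential, the other the factor
    \<open>\<bar>z u\<bar>\<close> that comes from a difference quotient.\<close>
  have dom: "integrable lborel f"
    if [measurable]: "f \<in> borel_measurable borel" and f: "\<And>u. \<bar>f u\<bar> \<le> \<bar>l u\<bar> * exp (2 * Kz * norm u) * E u" for f :: "'a \<Rightarrow> real"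
  proof (rule integrable_gaussian_bound[OF \<open>c > 0\<close> that(1)])
    fix u
    have "\<bar>l u\<bar> * exp (2 * Kz * norm u) * E u \<le> \<bar>Kl\<bar> * exp (norm u) * exp (2 * Kz * norm u) * exp (- c * (norm u)\<^sup>2)"
      using l_exp[of u] E_le[of u] by (intro mult_mono) (auto simp: E_def)
    also have "\<dots> = \<bar>Kl\<bar> * exp ((1 + 2 * Kz) * norm u - c * (norm u)\<^sup>2)"
      by (simp add: exp_add[symmetric] algebra_simps)
    finally show "\<bar>f u\<bar> \<le> \<bar>Kl\<bar> * exp ((1 + 2 * Kz) * norm u - c * (norm u)\<^sup>2)"
      using f[of u] by linarith
  qed
  have int_E: "integrable lborel E"
    unfolding E_def by (rule integrable_gaussian_weight[OF A])
  have int_lE: "integrable lborel (\<lambda>u. l u * E u)"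
  proof (rule dom)
    fix u
    have "\<bar>l u\<bar> * 1 * E u \<le> \<bar>l u\<bar> * exp (2 * Kz * norm u) * E u"
      using \<open>Kz \<ge> 0\<close> by (intro mult_right_mono mult_left_mono) (auto simp: E_def)
    then show "\<bar>l u * E u\<bar> \<le> \<bar>l u\<bar> * exp (2 * Kz * norm u) * E u" by (simp add: abs_mult E_def)
  qed simp
  have lE: "(\<integral>u. l u * E u \<partial>lborel) = 0"
    by (rule integral_odd_eq_0) (auto simp: E_def linear_neg[OF A(1)] linear_neg[OF l])
  define I where "I t = (\<integral>u. l u * (exp (t * z u) * E u) \<partial>lborel)" for t
  have I: "I t = exp (t\<^sup>2 * (norm (A w))\<^sup>2 / 2) * (t * l w * (\<integral>u. E u \<partial>lborel))" for t
  proof -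
    \<comment> \<open>Completing the square: the shift cancels the mixed term \<open>t * z u\<close>
      and leaves a constant factor.\<close>
    have E_shift: "exp (t * z (t *\<^sub>R w + u)) * E (t *\<^sub>R w + u) = exp (t\<^sup>2 * (norm (A w))\<^sup>2 / 2) * E u" for u
      unfolding E_def z_def exp_add[symmetric] linear_add[OF A(1)] linear_scale[OF A(1)] power2_norm_eq_inner
      by (simp add: inner_add_left inner_add_right inner_commute power2_eq_square field_simps)
    have "I t = (\<integral>u. l (t *\<^sub>R w + u) * (exp (t * z (t *\<^sub>R w + u)) * E (t *\<^sub>R w + u)) \<partial>lborel)"
      unfolding I_def by (subst lborel_integral_affine[where c=1 and t="t *\<^sub>R w"]) auto
    also have "\<dots> = (\<integral>u. exp (t\<^sup>2 * (norm (A w))\<^sup>2 / 2) * (t * l w * E u + l u * E u) \<partial>lborel)"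
      unfolding E_shift linear_add[OF l] linear_scale[OF l]
      by (intro Bochner_Integration.integral_cong) (auto simp: algebra_simps)
    also have "\<dots> = exp (t\<^sup>2 * (norm (A w))\<^sup>2 / 2) * (t * l w * (\<integral>u. E u \<partial>lborel) + (\<integral>u. l u * E u \<partial>lborel))"
      using int_E int_lE by simp
    finally show ?thesis by (simp add: lE)
  qed
  have int_lzE: "integrable lborel (\<lambda>u. l u * (exp (t * z u) * E u))" if "\<bar>t\<bar> \<le> 1" for t
  proof (rule dom)
    fix u
    have "t * z u \<le> \<bar>t * z u\<bar>" by simp
    also have "\<dots> \<le> 1 * \<bar>z u\<bar>" unfolding abs_mult using that by (intro mult_right_mono) auto
    also have "\<dots> \<le> 2 * Kz * norm u" using Kz[of u] \<open>Kz \<ge> 0\<close> by (simp add: mult_nonneg_nonneg) 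
    finally have "exp (t * z u) \<le> exp (2 * Kz * norm u)" by simp
    then have "\<bar>l u\<bar> * exp (t * z u) * E u \<le> \<bar>l u\<bar> * exp (2 * Kz * norm u) * E u"
      by (intro mult_right_mono mult_left_mono) (auto simp: E_def)
    then show "\<bar>l u * (exp (t * z u) * E u)\<bar> \<le> \<bar>l u\<bar> * exp (2 * Kz * norm u) * E u"
      by (simp add: abs_mult E_def mult.assoc)
  qed simp
  define t where "t n = 1 / real (Suc n)" for n
  have t: "0 < t n" "t n \<le> 1" for n by (auto simp: t_def)
  have t_lim: "t \<longlonglongrightarrow> 0" unfolding t_def using LIMSEQ_inverse_real_of_nat by (simp add: inverse_eq_divide)
  \<comment> \<open>The difference quotient at 0 of the integrand of \<open>I\<close>; by
    \<open>lE\<close> the value of \<open>I\<close> at 0 vanishes.\<close>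
  define f where "f n u = l u * ((exp (t n * z u) - 1) / t n) * E u" for n u
  have f_int: "(\<integral>u. f n u \<partial>lborel) = I (t n) / t n" for n
  proof -
    have "(\<integral>u. f n u \<partial>lborel) = (\<integral>u. (l u * (exp (t n * z u) * E u) - l u * E u) / t n \<partial>lborel)"
      by (intro Bochner_Integration.integral_cong) (auto simp: f_def algebra_simps diff_divide_distrib)
    also have "\<dots> = (I (t n) - 0) / t n"
      using int_lzE[of "t n"] t[of n] int_lE lE by (simp add: I_def)
    finally show ?thesis by simp
  qed
  have "(\<lambda>n. \<integral>u. f n u \<partial>lborel) \<longlonglongrightarrow> (\<integral>u. l u * z u * E u \<partial>lborel)"
  proof (rule integral_dominated_convergence[where w="\<lambda>u. \<bar>l u\<bar> * exp (2 * Kz * norm u) * E u"])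
    show "integrable lborel (\<lambda>u. \<bar>l u\<bar> * exp (2 * Kz * norm u) * E u)"
      by (rule dom) (auto simp: E_def abs_mult)
    show "AE u in lborel. (\<lambda>n. f n u) \<longlonglongrightarrow> l u * z u * E u"
    proof (rule AE_I2)
      fix u
      have "((\<lambda>t. exp (t * z u)) has_real_derivative z u) (at 0)"
        by (auto intro!: derivative_eq_intros)
      then have "((\<lambda>t. (exp (t * z u) - 1) / t) \<longlongrightarrow> z u) (at 0)"
        by (simp add: has_field_derivative_iff)
      then have "(\<lambda>n. (exp (t n * z u) - 1) / t n) \<longlonglongrightarrow> z u"
        by (rule filterlim_compose) (use t_lim t in \<open>auto simp: filterlim_at intro!: always_eventually less_imp_neq[symmetric]\<close>)
      then show "(\<lambda>n. f n u) \<longlonglongrightarrow> l u * z u * E u"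
        unfolding f_def by (intro tendsto_intros)
    qed
    show "AE u in lborel. norm (f n u) \<le> \<bar>l u\<bar> * exp (2 * Kz * norm u) * E u" for n
    proof (rule AE_I2)
      fix u
      have "\<bar>exp (t n * z u) - 1\<bar> \<le> \<bar>t n * z u\<bar> * exp \<bar>t n * z u\<bar>" by (rule abs_exp_minus_one_le)
      also have "\<dots> \<le> (t n * \<bar>z u\<bar>) * exp \<bar>z u\<bar>"
      proof (intro mult_mono)
        show "exp \<bar>t n * z u\<bar> \<le> exp \<bar>z u\<bar>" using t[of n] by (simp add: abs_mult mult_left_le_one_le)
      qed (use t[of n] in \<open>auto simp: abs_mult\<close>)
      finally have "\<bar>(exp (t n * z u) - 1) / t n\<bar> \<le> \<bar>z u\<bar> * exp \<bar>z u\<bar>"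
        using t[of n] by (simp add: abs_divide divide_le_eq mult_ac)
      also have "\<dots> \<le> exp \<bar>z u\<bar> * exp \<bar>z u\<bar>"
        using exp_ge_add_one_self[of "\<bar>z u\<bar>"] by (intro mult_right_mono) linarith+
      also have "\<dots> = exp (2 * \<bar>z u\<bar>)" by (simp add: exp_add[symmetric])
      also have "\<dots> \<le> exp (2 * Kz * norm u)" using Kz[of u] by simp
      finally have "\<bar>l u\<bar> * \<bar>(exp (t n * z u) - 1) / t n\<bar> * E u \<le> \<bar>l u\<bar> * exp (2 * Kz * norm u) * E u"
        by (intro mult_right_mono mult_left_mono) (auto simp: E_def)
      then show "norm (f n u) \<le> \<bar>l u\<bar> * exp (2 * Kz * norm u) * E u" by (simp add: f_def abs_mult E_def)
    qed
  qed (auto simp: f_def)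
  moreover have "(\<lambda>n. \<integral>u. f n u \<partial>lborel) \<longlonglongrightarrow> exp (0\<^sup>2 * (norm (A w))\<^sup>2 / 2) * (l w * (\<integral>u. E u \<partial>lborel))"
  proof -
    have "(\<integral>u. f n u \<partial>lborel) = exp ((t n)\<^sup>2 * (norm (A w))\<^sup>2 / 2) * (l w * (\<integral>u. E u \<partial>lborel))" for n
      unfolding f_int I using t[of n] by simp
    moreover have "(\<lambda>n. exp ((t n)\<^sup>2 * (norm (A w))\<^sup>2 / 2) * (l w * (\<integral>u. E u \<partial>lborel))) \<longlonglongrightarrow>
        exp (0\<^sup>2 * (norm (A w))\<^sup>2 / 2) * (l w * (\<integral>u. E u \<partial>lborel))"
      by (intro tendsto_intros t_lim) auto
    ultimately show ?thesis by simp
  qed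
  ultimately have "(\<integral>u. l u * z u * E u \<partial>lborel) = l w * (\<integral>u. E u \<partial>lborel)"
    using LIMSEQ_unique by fastforce
  then show ?thesis unfolding E_def z_def by (simp add: mult_ac)
qed

section \<open>Tangent spaces and differentials\<close>

lemma manifold_chartD:
  assumes "manifold_chart t M U V \<phi>"
  shows "open U" "open V" "C_inf_on V \<phi>" "\<And>a. a \<in> V \<Longrightarrow> \<phi> a \<in> M \<inter> U"
    "\<And>a. a \<in> V \<Longrightarrow> inj (frechet_derivative \<phi> (at a))"
  using assms by (auto simp: manifold_chart_def homeomorphism_def)

lemma manifold_chart_has_derivative:
  assumes "manifold_chart t M U V \<phi>" "a \<in> V"
  shows "(\<phi> has_derivative frechet_derivative \<phi> (at a)) (at a)"
    "linear (frechet_derivative \<phi> (at a))"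
  using C_inf_on_differentiable[OF manifold_chartD(3)[OF assms(1)] assms(2)]
  by (auto simp: frechet_derivative_works[symmetric] linear_frechet_derivative)

lemma has_vector_derivative_compose:
  assumes "(\<gamma> has_vector_derivative v) (at 0)" "(G has_derivative L) (at (\<gamma> 0))"
  shows "((G \<circ> \<gamma>) has_vector_derivative L v) (at 0)"
proof -
  have "((\<lambda>t. G (\<gamma> t)) has_derivative (\<lambda>t. L (t *\<^sub>R v))) (at 0)"
    using has_derivative_compose[OF assms(1)[unfolded has_vector_derivative_def] assms(2)] .
  moreover have "L (t *\<^sub>R v) = t *\<^sub>R L v" for t
    using has_derivative_linear[OF assms(2)] by (rule linear_scale)
  ultimately show ?thesis by (simp add: has_vector_derivative_def comp_def)
qed

text \<open>The hard inclusion is that velocities lie in \<open>range A\<close>. The inverse chart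
  \<open>\<psi>\<close> is only known to be continuous, so a curve in \<open>M\<close> cannot be
  differentiated in coordinates. Instead the component \<open>z\<close> of the velocity orthogonal
  to \<open>range A\<close> is shown to vanish: along the curve it sees only the first-order
  remainder of \<open>\<phi>\<close>, which is \<open>o(t)\<close> by injectivity of
  \<open>A\<close>.\<close>

lemma tangent_space_chart:
  fixes \<phi> :: "real^'d::finite \<Rightarrow> real^'m"
  assumes chart: "manifold_chart TYPE('d) M U V \<phi>" and a: "a \<in> V"
  shows "tangent_space M (\<phi> a) = range (frechet_derivative \<phi> (at a))"
proof
  note chartD = manifold_chartD[OF chart]
  define A where "A = frechet_derivative \<phi> (at a)"
  have D: "(\<phi> has_derivative A) (at a)" and lin: "linear A"
    using manifold_chart_has_derivative[OF chart a] by (auto simp: A_def)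
  have inj: "inj A" using chartD(5)[OF a] by (simp add: A_def)
  show "range A \<subseteq> tangent_space M (\<phi> a)"
  proof
    fix v assume "v \<in> range A"
    then obtain w where v: "v = A w" by blast
    define \<gamma> where "\<gamma> = (\<lambda>t::real. \<phi> (a + t *\<^sub>R w))"
    have "((\<lambda>t::real. a + t *\<^sub>R w) has_vector_derivative w) (at 0)"
      by (auto intro!: derivative_eq_intros)
    from has_vector_derivative_compose[OF this, of \<phi> A] D
    have deriv: "(\<gamma> has_vector_derivative v) (at 0)" by (simp add: \<gamma>_def comp_def v)
    have "((\<lambda>t::real. a + t *\<^sub>R w) \<longlongrightarrow> a + 0 *\<^sub>R w) (at 0)" by (intro tendsto_intros)
    then have "\<forall>\<^sub>F t in at 0. a + t *\<^sub>R w \<in> V"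
      using chartD(2) a by (intro topological_tendstoD) auto
    then obtain e where e: "e > 0" "\<And>t. t \<noteq> 0 \<Longrightarrow> dist t 0 < e \<Longrightarrow> a + t *\<^sub>R w \<in> V"
      unfolding eventually_at by auto
    have "\<gamma> t \<in> M" if "\<bar>t\<bar> < e" for t
      using e(2)[of t] that a chartD(4) by (cases "t = 0") (auto simp: \<gamma>_def)
    with deriv \<open>e > 0\<close> show "v \<in> tangent_space M (\<phi> a)"
      unfolding tangent_space_def by (auto intro!: exI[of _ \<gamma>] exI[of _ e] simp: \<gamma>_def)
  qed
  show "tangent_space M (\<phi> a) \<subseteq> range A"
  proof
    fix v assume "v \<in> tangent_space M (\<phi> a)"
    then obtain \<gamma> e where \<gamma>: "e > 0" "\<And>t. \<bar>t\<bar> < e \<Longrightarrow> \<gamma> t \<in> M" "\<gamma> 0 = \<phi> a"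
      "(\<gamma> has_vector_derivative v) (at 0)"
      unfolding tangent_space_def by blast
    obtain \<psi> where \<psi>: "homeomorphism V (M \<inter> U) \<phi> \<psi>" using chart by (auto simp: manifold_chart_def)
    have "isCont \<gamma> 0" using \<gamma>(4) by (rule has_vector_derivative_continuous)
    then have \<gamma>_lim: "(\<gamma> \<longlongrightarrow> \<phi> a) (at 0)" by (simp add: isCont_def \<gamma>(3))
    then have "\<forall>\<^sub>F t in at 0. \<gamma> t \<in> U"
      using chartD(1,4) a by (intro topological_tendstoD) auto
    moreover have "\<forall>\<^sub>F t in at (0::real). \<bar>t\<bar> < e"
      using \<gamma>(1) by (auto simp: eventually_at dist_real_def)
    ultimately have ev: "\<forall>\<^sub>F t in at 0. \<gamma> t \<in> M \<inter> U"
      by eventually_elim (auto intro: \<gamma>(2))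
    define \<alpha> where "\<alpha> = (\<lambda>t. \<psi> (\<gamma> t))"
    have \<phi>\<alpha>: "\<forall>\<^sub>F t in at 0. \<phi> (\<alpha> t) = \<gamma> t"
      using ev by eventually_elim (use \<psi> in \<open>auto simp: \<alpha>_def homeomorphism_def\<close>)
    have \<alpha>_lim: "(\<alpha> \<longlongrightarrow> a) (at 0)"
    proof -
      have "continuous_on (M \<inter> U) \<psi>" using \<psi> by (simp add: homeomorphism_def)
      then have "((\<lambda>t. \<psi> (\<gamma> t)) \<longlongrightarrow> \<psi> (\<phi> a)) (at 0)"
        using \<gamma>_lim chartD(4)[OF a] ev by (rule continuous_on_tendsto_compose)
      then show ?thesis using \<psi> a by (simp add: \<alpha>_def homeomorphism_def)
    qed
    obtain B where B: "B > 0" "\<And>u. B * norm u \<le> norm (A u)"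
      using linear_inj_bounded_below_pos[OF lin inj] by blast
    define r where "r b = \<phi> b - \<phi> a - A (b - a)" for b
    have r_small: "\<exists>d>0. \<forall>b. norm (b - a) < d \<longrightarrow> norm (r b) \<le> \<eta> * norm (b - a)" if "\<eta> > 0" for \<eta>
      using D that unfolding has_derivative_at_alt r_def by blast
    have \<gamma>_bound: "\<forall>\<^sub>F t in at 0. norm (\<gamma> t - \<phi> a) \<le> (norm v + 1) * \<bar>t\<bar>"
    proof -
      have "\<exists>d>0. \<forall>t. norm (t - 0) < d \<longrightarrow> norm (\<gamma> t - \<gamma> 0 - (t - 0) *\<^sub>R v) \<le> 1 * norm (t - 0)"
        using \<gamma>(4) unfolding has_vector_derivative_def has_derivative_at_alt by (meson zero_less_one)
      then obtain d where d: "d > 0" "\<And>t. \<bar>t\<bar> < d \<Longrightarrow> norm (\<gamma> t - \<phi> a - t *\<^sub>R v) \<le> \<bar>t\<bar>"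
        by (auto simp: \<gamma>(3))
      have "norm (\<gamma> t - \<phi> a) \<le> (norm v + 1) * \<bar>t\<bar>" if "\<bar>t\<bar> < d" for t
        using norm_triangle_sub[of "\<gamma> t - \<phi> a" "t *\<^sub>R v"] d(2)[OF that] by (simp add: algebra_simps)
      then show ?thesis using d(1) by (auto simp: eventually_at dist_real_def)
    qed
    \<comment> \<open>Shows that the coordinates \<open>\<alpha> t\<close> move at most linearly in
      \<open>t\<close>: the lower bound for \<open>A\<close> controls
      \<open>norm (\<alpha> t - a)\<close> by the displacement of the curve plus a remainder, which
      is absorbed into half of the left side.\<close>
    have small: "\<forall>\<^sub>F t in at 0. norm (r (\<alpha> t)) \<le> \<eta> * \<bar>t\<bar>" if "\<eta> > 0" for \<eta>
    proof -
      \<comment> \<open>The first entry of the minimum permits the absorption with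
        \<open>B / 2\<close>; the second turns the resulting linear bound on
        \<open>norm (\<alpha> t - a)\<close> into \<open>\<eta> * \<bar>t\<bar>\<close>.\<close>
      define \<eta>' where "\<eta>' = min (B / 2) (\<eta> * (B / 2) / (norm v + 1))"
      have nv: "norm v + 1 > 0" by (simp add: add_nonneg_pos)
      then have "\<eta>' > 0" using \<open>\<eta> > 0\<close> B(1) by (simp add: \<eta>'_def)
      then obtain d where d: "d > 0" "\<And>b. norm (b - a) < d \<Longrightarrow> norm (r b) \<le> \<eta>' * norm (b - a)"
        using r_small by blast
      have "\<forall>\<^sub>F t in at 0. dist (\<alpha> t) a < d" using \<alpha>_lim d(1) by (rule tendstoD)
      then show ?thesis using \<gamma>_bound \<phi>\<alpha>
      proof eventually_elim
        case (elim t)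
        let ?x = "norm (\<alpha> t - a)"
        have r: "norm (r (\<alpha> t)) \<le> \<eta>' * ?x" using elim(1) by (intro d(2)) (simp add: dist_norm)
        have "B * ?x \<le> norm (A (\<alpha> t - a))" by (rule B(2))
        also have "A (\<alpha> t - a) = (\<gamma> t - \<phi> a) - r (\<alpha> t)" using elim(3) by (simp add: r_def)
        also have "norm \<dots> \<le> norm (\<gamma> t - \<phi> a) + norm (r (\<alpha> t))" by (rule norm_triangle_ineq4)
        also have "\<dots> \<le> (norm v + 1) * \<bar>t\<bar> + (B / 2) * ?x"
        proof -
          have "\<eta>' * ?x \<le> (B / 2) * ?x" unfolding \<eta>'_def by (intro mult_right_mono min.cobounded1) auto
          with r elim(2) show ?thesis by linarith
        qed
        finally have "(B / 2) * ?x \<le> (norm v + 1) * \<bar>t\<bar>" by simp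
        then have x: "?x \<le> (norm v + 1) * \<bar>t\<bar> / (B / 2)" using B(1) by (simp add: field_simps)
        have "\<eta>' * ?x \<le> (\<eta> * (B / 2) / (norm v + 1)) * ((norm v + 1) * \<bar>t\<bar> / (B / 2))"
          unfolding \<eta>'_def using x nv \<open>\<eta> > 0\<close> B(1) by (intro mult_mono min.cobounded2) auto
        also have "\<dots> = \<eta> * \<bar>t\<bar>" using nv B(1) by (simp add: divide_simps)
        finally show ?case using r by linarith
      qed
    qed
    have sub: "subspace (range A)" using lin by (rule linear_subspace_image) (rule subspace_UNIV)
    obtain y z where yz: "y \<in> span (range A)" "\<And>w. w \<in> span (range A) \<Longrightarrow> orthogonal z w" "v = y + z"
      using orthogonal_subspace_decomp_exists[of "range A" v] by blast
    have orth: "z \<bullet> A w = 0" for w using yz(2)[of "A w"] by (simp add: span_base orthogonal_def)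
    have zy: "z \<bullet> y = 0" using yz(1,2) by (simp add: orthogonal_def)
    have "((\<lambda>t. z \<bullet> \<gamma> t) has_vector_derivative z \<bullet> v) (at 0)"
      using \<gamma>(4) by (rule bounded_linear.has_vector_derivative[OF bounded_linear_inner_right])
    then have "((\<lambda>t. (z \<bullet> \<gamma> t - z \<bullet> \<phi> a) / t) \<longlongrightarrow> z \<bullet> v) (at 0)"
      by (simp add: has_real_derivative_iff_has_vector_derivative[symmetric] has_field_derivative_iff \<gamma>(3))
    moreover have "((\<lambda>t. (z \<bullet> \<gamma> t - z \<bullet> \<phi> a) / t) \<longlongrightarrow> 0) (at 0)"
    proof (rule tendstoI)
      fix \<eta> :: real assume "\<eta> > 0"
      define \<eta>' where "\<eta>' = \<eta> / (norm z + 1)"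
      have nz: "norm z + 1 > 0" by (simp add: add_nonneg_pos)
      have "\<eta>' > 0" using \<open>\<eta> > 0\<close> nz by (simp add: \<eta>'_def)
      have "\<forall>\<^sub>F t in at (0::real). t \<noteq> 0" by (auto simp: eventually_at_filter)
      then show "\<forall>\<^sub>F t in at 0. dist ((z \<bullet> \<gamma> t - z \<bullet> \<phi> a) / t) 0 < \<eta>"
        using small[OF \<open>\<eta>' > 0\<close>] \<phi>\<alpha>
      proof eventually_elim
        case (elim t)
        have "z \<bullet> \<gamma> t - z \<bullet> \<phi> a = z \<bullet> r (\<alpha> t)"
          using elim(3) by (simp add: r_def inner_diff_right orth)
        also have "\<bar>\<dots>\<bar> \<le> norm z * norm (r (\<alpha> t))" by (rule Cauchy_Schwarz_ineq2)
        also have "\<dots> \<le> norm z * (\<eta>' * \<bar>t\<bar>)" using elim(2) by (intro mult_left_mono) auto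
        also have "\<dots> < (norm z + 1) * (\<eta>' * \<bar>t\<bar>)" using elim(1) \<open>\<eta>' > 0\<close> by (intro mult_strict_right_mono) auto
        also have "\<dots> = \<eta> * \<bar>t\<bar>" using nz by (simp add: \<eta>'_def)
        finally show ?case using elim(1) by (simp add: dist_real_def abs_divide divide_less_eq)
      qed
    qed
    ultimately have "z \<bullet> v = 0" by (rule tendsto_unique[OF trivial_limit_at])
    then have "z = 0" by (simp add: yz(3) inner_add_right zy)
    with yz sub show "v \<in> range A" by (simp add: span_eq_iff[THEN iffD2])
  qed
qed

text \<open>The choice in \<open>tangent_basis\<close> has a witness: a chart exhibits the tangent
  space as an injective linear image of the parameter space, so an orthonormal basis of it has
  \<open>CARD('d)\<close> elements and can be indexed by \<open>'d\<close>.\<close>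

lemma tangent_basis_orthonormal:
  fixes M :: "(real^'m) set"
  assumes M: "smooth_embedded_submanifold TYPE('d::finite) M" and z: "z \<in> M"
  defines "B \<equiv> tangent_basis TYPE('d) M z"
  shows "B $ i \<bullet> B $ j = (if i = j then 1 else 0)"
    and "span (range (\<lambda>i. B $ i)) = tangent_space M z"
proof -
  obtain U V and \<phi> :: "real^'d \<Rightarrow> real^'m" where "z \<in> U" and chart: "manifold_chart TYPE('d) M U V \<phi>"
    using M z unfolding smooth_embedded_submanifold_def by blast
  then obtain a where a: "a \<in> V" "\<phi> a = z"
    using z unfolding manifold_chart_def homeomorphism_def by blast
  let ?A = "frechet_derivative \<phi> (at a)"
  have T: "tangent_space M z = range ?A" using tangent_space_chart[OF chart a(1)] a(2) by simp
  have lin: "linear ?A" and inj: "inj ?A"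
    using manifold_chart_has_derivative(2)[OF chart a(1)] manifold_chartD(5)[OF chart a(1)] by auto
  have sub: "subspace (range ?A)" using lin by (rule linear_subspace_image) (rule subspace_UNIV)
  have "dim (range ?A) = CARD('d)" using dim_image_eq[OF lin, of UNIV] inj by simp
  then obtain S where S: "S \<subseteq> range ?A" "pairwise orthogonal S" "\<And>x. x \<in> S \<Longrightarrow> norm x = 1"
    "independent S" "card S = CARD('d)" "span S = range ?A"
    using orthonormal_basis_subspace[OF sub] by metis
  have "finite S" using S(4) by (rule independent_imp_finite)
  then obtain f where f: "bij_betw f (UNIV :: 'd set) S"
    using finite_same_card_bij[of "UNIV :: 'd set" S] S(5) by auto
  have "\<exists>B :: real^'m^'d. (\<forall>i j. B $ i \<bullet> B $ j = (if i = j then 1 else 0)) \<and>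
      span (range (\<lambda>i. B $ i)) = tangent_space M z"
  proof (intro exI[of _ "\<chi> i. f i"] conjI allI)
    show "span (range (\<lambda>i. (\<chi> i. f i) $ i)) = tangent_space M z"
      using f S(6) T by (simp add: bij_betw_def)
    fix i j
    have fS: "f i \<in> S" "f j \<in> S" using f by (auto simp: bij_betw_def)
    show "(\<chi> i. f i) $ i \<bullet> (\<chi> i. f i) $ j = (if i = j then 1 else 0)"
    proof (cases "i = j")
      case True then show ?thesis using S(3)[OF fS(1)] by (simp add: dot_square_norm)
    next
      case False
      then have "f i \<noteq> f j" using f by (auto simp: bij_betw_def inj_def)
      then show ?thesis using S(2) fS False by (auto simp: pairwise_def orthogonal_def)
    qed
  qed
  from someI_ex[OF this] show "B $ i \<bullet> B $ j = (if i = j then 1 else 0)"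
    "span (range (\<lambda>i. B $ i)) = tangent_space M z"
    unfolding B_def tangent_basis_def by blast+
qed

lemma orthonormal_span_expansion:
  fixes B :: "real^'m^'d::finite"
  assumes B: "\<And>i j. B $ i \<bullet> B $ j = (if i = j then 1 else 0)"
    and v: "v \<in> span (range (\<lambda>i. B $ i))"
  shows "(\<Sum>i\<in>UNIV. (v \<bullet> B $ i) *\<^sub>R B $ i) = v"
  using v
proof (induction rule: span_induct_alt)
  case (step c x y)
  then obtain j where j: "x = B $ j" by blast
  have "(\<Sum>i\<in>UNIV. (x \<bullet> B $ i) *\<^sub>R B $ i) = (\<Sum>i\<in>UNIV. if i = j then B $ i else 0)"
    by (intro sum.cong refl) (simp add: j B)
  also have "\<dots> = x" by (simp add: j)
  finally have x: "(\<Sum>i\<in>UNIV. (x \<bullet> B $ i) *\<^sub>R B $ i) = x" .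
  have "(\<Sum>i\<in>UNIV. ((c *\<^sub>R x + y) \<bullet> B $ i) *\<^sub>R B $ i)
      = c *\<^sub>R (\<Sum>i\<in>UNIV. (x \<bullet> B $ i) *\<^sub>R B $ i) + (\<Sum>i\<in>UNIV. (y \<bullet> B $ i) *\<^sub>R B $ i)"
    by (simp add: inner_add_left scaleR_add_left sum.distrib scaleR_sum_right)
  then show ?case using x step by simp
qed simp

section \<open>Differentials of maps on a submanifold through local extensions\<close>

lemma curve_compose_has_derivative:
  assumes G: "(G has_derivative L) (at z)" "open W" "z \<in> W" "\<And>y. y \<in> M \<inter> W \<Longrightarrow> G y = H y"
    and \<gamma>: "e > 0" "\<And>t. \<bar>t\<bar> < e \<Longrightarrow> \<gamma> t \<in> M" "\<gamma> 0 = z" "(\<gamma> has_vector_derivative v) (at 0)"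
  shows "((H \<circ> \<gamma>) has_vector_derivative L v) (at 0)"
proof -
  have "(\<gamma> \<longlongrightarrow> z) (at 0)"
    using has_vector_derivative_continuous[OF \<gamma>(4)] \<gamma>(3) by (simp add: isCont_def)
  then have "\<forall>\<^sub>F t in at 0. \<gamma> t \<in> W" using G(2,3) by (rule topological_tendstoD)
  moreover have "\<forall>\<^sub>F t in at (0::real). \<bar>t\<bar> < e"
    using \<gamma>(1) by (auto simp: eventually_at dist_real_def)
  ultimately have ev: "\<forall>\<^sub>F t in at 0. (G \<circ> \<gamma>) t = (H \<circ> \<gamma>) t"
    by eventually_elim (auto simp: \<gamma>(2) G(4))
  have "((G \<circ> \<gamma>) has_vector_derivative L v) (at 0)"
    using has_vector_derivative_compose[OF \<gamma>(4)] G(1) \<gamma>(3) by simp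
  moreover have "(G \<circ> \<gamma>) 0 = (H \<circ> \<gamma>) 0" using \<gamma>(2)[of 0] \<gamma>(1,3) G(3,4) by simp
  ultimately show ?thesis
    using ev unfolding has_vector_derivative_def by (auto intro: has_derivative_transform_eventually)
qed

text \<open>For the definite description, existence comes from the local extension \<open>G\<close>;
  uniqueness needs at least one curve with velocity \<open>v\<close>, which is what tangency of
  \<open>v\<close> provides.\<close>

lemma differential_eq:
  assumes G: "(G has_derivative L) (at z)" "open W" "z \<in> W" "\<And>y. y \<in> M \<inter> W \<Longrightarrow> G y = H y"
    and v: "v \<in> tangent_space M z"
  shows "differential M H z v = L v"
  unfolding differential_def
proof (rule the_equality)
  show "\<forall>\<gamma> e. 0 < e \<and> (\<forall>t. \<bar>t\<bar> < e \<longrightarrow> \<gamma> t \<in> M) \<and> \<gamma> 0 = z \<and> (\<gamma> has_vector_derivative v) (at 0) \<longrightarrow>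
      ((H \<circ> \<gamma>) has_vector_derivative L v) (at 0)"
    using curve_compose_has_derivative[OF G] by blast
  fix w assume w: "\<forall>\<gamma> e. 0 < e \<and> (\<forall>t. \<bar>t\<bar> < e \<longrightarrow> \<gamma> t \<in> M) \<and> \<gamma> 0 = z \<and> (\<gamma> has_vector_derivative v) (at 0) \<longrightarrow>
      ((H \<circ> \<gamma>) has_vector_derivative w) (at 0)"
  obtain \<gamma> e where \<gamma>: "e > 0" "\<And>t. \<bar>t\<bar> < e \<Longrightarrow> \<gamma> t \<in> M" "\<gamma> 0 = z" "(\<gamma> has_vector_derivative v) (at 0)"
    using v unfolding tangent_space_def by blast
  have "((H \<circ> \<gamma>) has_vector_derivative w) (at 0)" using w \<gamma> by blast
  moreover have "((H \<circ> \<gamma>) has_vector_derivative L v) (at 0)" by (rule curve_compose_has_derivative[OF G \<gamma>])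
  ultimately show "w = L v" by (rule vector_derivative_unique_at)
qed

lemma derivative_in_tangent_space:
  assumes G: "(G has_derivative L) (at z)" "open W" "z \<in> W" "\<And>y. y \<in> M \<inter> W \<Longrightarrow> G y = H y"
    and "H ` M \<subseteq> N" and v: "v \<in> tangent_space M z"
  shows "L v \<in> tangent_space N (H z)"
proof -
  obtain \<gamma> e where \<gamma>: "e > 0" "\<And>t. \<bar>t\<bar> < e \<Longrightarrow> \<gamma> t \<in> M" "\<gamma> 0 = z" "(\<gamma> has_vector_derivative v) (at 0)"
    using v unfolding tangent_space_def by blast
  have "((H \<circ> \<gamma>) has_vector_derivative L v) (at 0)" by (rule curve_compose_has_derivative[OF G \<gamma>])
  with \<gamma> \<open>H ` M \<subseteq> N\<close> show ?thesis
    unfolding tangent_space_def by (auto intro!: exI[of _ "H \<circ> \<gamma>"] exI[of _ e])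
qed

text \<open>The basis of the target drops out: expanding in it reproduces \<open>L (B $ c)\<close>,
  since derivatives of \<open>H\<close> in tangent directions are tangent to \<open>N\<close>. What
  remains is \<open>L\<close> composed with the orthogonal projection onto the tangent space of
  \<open>M\<close>.\<close>

lemma DH_hat_eq:
  fixes M :: "(real^'m) set" and N :: "(real^'n) set"
  assumes M: "smooth_embedded_submanifold TYPE('d::finite) M" and N: "smooth_embedded_submanifold TYPE('e::finite) N"
    and G: "(G has_derivative L) (at z)" "open W" "z \<in> W" "\<And>y. y \<in> M \<inter> W \<Longrightarrow> G y = H y"
    and HN: "H ` M \<subseteq> N" and z: "z \<in> M"
  defines "B \<equiv> tangent_basis TYPE('d) M z"
  shows "DH_hat TYPE('d) TYPE('e) M N H z $ i $ j = (\<Sum>c\<in>UNIV. L (B $ c) $ i * B $ c $ j)"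
proof -
  let ?C = "tangent_basis TYPE('e) N (H z)"
  note B = tangent_basis_orthonormal[OF M z, folded B_def]
  have Hz: "H z \<in> N" using HN z by auto
  have Bc: "B $ c \<in> tangent_space M z" for c
    unfolding B(2)[symmetric] by (rule span_base) simp
  have L: "L (B $ c) = (\<Sum>k\<in>UNIV. (L (B $ c) \<bullet> ?C $ k) *\<^sub>R ?C $ k)" for c
    using orthonormal_span_expansion[OF tangent_basis_orthonormal(1)[OF N Hz], of "L (B $ c)"]
      derivative_in_tangent_space[OF G HN Bc[of c]] tangent_basis_orthonormal(2)[OF N Hz] by simp
  have diff: "differential M H z (B $ c) = L (B $ c)" for c
    by (rule differential_eq[OF G Bc])
  have "DH_hat TYPE('d) TYPE('e) M N H z $ i $ j =
      (\<Sum>c\<in>UNIV. (\<Sum>k\<in>UNIV. ?C $ k $ i * (?C $ k \<bullet> differential M H z (B $ c))) * B $ c $ j)"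
    by (simp add: DH_hat_def DH_matrix_def matrix_matrix_mult_def transpose_def B_def)
  also have "\<dots> = (\<Sum>c\<in>UNIV. (\<Sum>k\<in>UNIV. (L (B $ c) \<bullet> ?C $ k) *\<^sub>R ?C $ k) $ i * B $ c $ j)"
    by (simp add: diff inner_commute mult.commute)
  finally show ?thesis unfolding L[symmetric] .
qed

section \<open>Localization in a chart\<close>

text \<open>The square of the Jacobian factor in \<open>riemannian_volume\<close>.\<close>

definition gram_det :: "(real^'d::finite \<Rightarrow> real^'m) \<Rightarrow> real^'d \<Rightarrow> real" where
  "gram_det \<phi> a = det (transpose (matrix (frechet_derivative \<phi> (at a))) ** matrix (frechet_derivative \<phi> (at a)))"

text \<open>The segment from the identity to \<open>transpose A ** A\<close> consists of positive
  definite, hence invertible, matrices. The determinant is continuous along it and starts at 1, so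
  it cannot end at or below 0.\<close>

lemma det_gram_pos:
  fixes A :: "real^'d::finite^'m"
  assumes "inj ((*v) A)"
  shows "det (transpose A ** A) > 0"
proof (rule ccontr)
  define G where "G t = (1 - t) *\<^sub>R mat 1 + t *\<^sub>R (transpose A ** A)" for t :: real
  have nz: "det (G t) \<noteq> 0" if "0 \<le> t" "t \<le> 1" for t
  proof -
    have "v = 0" if "G t *v v = 0" for v
    proof (rule ccontr)
      assume "v \<noteq> 0"
      have "G t *v v = (1 - t) *\<^sub>R v + t *\<^sub>R (transpose A *v (A *v v))"
        unfolding G_def by (simp add: matrix_vector_mult_add_rdistrib scaleR_matrix_vector_assoc[symmetric] matrix_vector_mul_assoc)
      then have "0 = v \<bullet> ((1 - t) *\<^sub>R v + t *\<^sub>R (transpose A *v (A *v v)))" using that by simp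
      also have "\<dots> = (1 - t) * (norm v)\<^sup>2 + t * (norm (A *v v))\<^sup>2"
        by (simp add: inner_add_right dot_lmul_matrix[symmetric] vector_transpose_matrix power2_norm_eq_inner)
          (metis dot_lmul_matrix inner_commute)
      finally have eq: "(1 - t) * (norm v)\<^sup>2 + t * (norm (A *v v))\<^sup>2 = 0" by simp
      have "A *v v \<noteq> 0" using assms \<open>v \<noteq> 0\<close> by (metis injD matrix_vector_mult_0_right)
      then have pos: "(norm v)\<^sup>2 > 0" "(norm (A *v v))\<^sup>2 > 0" using \<open>v \<noteq> 0\<close> by simp_all
      show False
      proof (cases "t = 0")
        case True with eq pos show False by simp
      next
        case False
        with \<open>0 \<le> t\<close> pos have "t * (norm (A *v v))\<^sup>2 > 0" by simp
        moreover have "(1 - t) * (norm v)\<^sup>2 \<ge> 0" using \<open>t \<le> 1\<close> by simp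
        ultimately show False using eq by linarith
      qed
    qed
    then have "invertible (G t)"
      by (simp add: invertible_left_inverse matrix_left_invertible_ker)
    then show ?thesis by (simp add: invertible_det_nz)
  qed
  assume "\<not> det (transpose A ** A) > 0"
  then have "det (G 1) \<le> 0" by (simp add: G_def)
  moreover have "det (G 0) = 1" by (simp add: G_def)
  moreover have "continuous_on {0..1} (\<lambda>t. det (G t))"
    unfolding det_def G_def by (auto intro!: continuous_intros)
  ultimately obtain t where "0 \<le> t" "t \<le> 1" "det (G t) = 0"
    using IVT2'[of "\<lambda>t. det (G t)" 1 0 0] by auto
  with nz show False by blast
qed

lemma gram_det_pos:
  assumes "manifold_chart TYPE('d::finite) M U V \<phi>" "a \<in> V"
  shows "gram_det \<phi> a > 0"
  unfolding gram_det_def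
proof (rule det_gram_pos)
  have "(*v) (matrix (frechet_derivative \<phi> (at a))) = frechet_derivative \<phi> (at a)"
    using manifold_chart_has_derivative(2)[OF assms] by (rule matrix_vector_mul)
  with manifold_chartD(5)[OF assms] show "inj ((*v) (matrix (frechet_derivative \<phi> (at a))))" by simp
qed

text \<open>The Leibniz formula as a polynomial in first partial derivatives of the chart, a form to
  which the closure rules for continuity and for \<open>sexpandable\<close> apply.\<close>

lemma gram_det_expand:
  "gram_det \<phi> a = (\<Sum>p\<in>{p. p permutes UNIV}. of_int (sign p) * (\<Prod>i\<in>UNIV. \<Sum>k\<in>UNIV.
      (iter_dderiv [axis i 1] \<phi> a \<bullet> axis k 1) * (iter_dderiv [axis (p i) 1] \<phi> a \<bullet> axis k 1)))"
  by (simp add: gram_det_def det_def matrix_matrix_mult_def transpose_def matrix_def inner_axis)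

lemma continuous_on_gram_det:
  assumes "manifold_chart TYPE('d::finite) M U V \<phi>"
  shows "continuous_on V (gram_det \<phi>)"
  unfolding gram_det_expand[abs_def]
  by (intro continuous_intros C_inf_on_continuous_on manifold_chartD(3)[OF assms])

lemma gram_det_sexpandable:
  assumes chart: "manifold_chart TYPE('d::finite) M U V \<phi>" and a: "a \<in> V"
  shows "sexpandable 4 (\<lambda>s u. sqrt (gram_det \<phi> (a + s *\<^sub>R u)))"
proof -
  have "isCont (gram_det \<phi>) a"
    using continuous_on_gram_det[OF chart] manifold_chartD(2)[OF chart] a by (simp add: continuous_on_eq_continuous_at)
  have pos: "gram_det \<phi> a > 0" by (rule gram_det_pos[OF chart a])
  then obtain \<rho> where \<rho>: "\<rho> > 0" "\<And>b. dist b a < \<rho> \<Longrightarrow> dist (gram_det \<phi> b) (gram_det \<phi> a) < gram_det \<phi> a / 2"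
    using \<open>isCont (gram_det \<phi>) a\<close> unfolding continuous_at_eps_delta by (metis half_gt_zero)
  show ?thesis
  proof (rule sexpandable_sqrt[OF _ pos _ \<rho>(1)])
    show "sexpandable 4 (\<lambda>s u. gram_det \<phi> (a + s *\<^sub>R u))"
      unfolding gram_det_expand
      by (intro sexpandable_sum sexpandable_mult sexpandable_prod sexpandable_const
          sexpandable_C_inf_on[OF C_inf_on_iter_dderiv[OF manifold_chartD(3)[OF chart]] a]) auto
    show "((\<lambda>s. gram_det \<phi> (a + s *\<^sub>R u)) \<longlongrightarrow> gram_det \<phi> a) (at_right 0)" for u
      using \<open>isCont (gram_det \<phi>) a\<close> tendsto_line_at_right by (rule isCont_tendsto_compose)
    fix s :: real and u :: "real^'d" assume "(s, u) \<in> scaled_ball \<rho>"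
    then show "\<bar>gram_det \<phi> (a + s *\<^sub>R u) - gram_det \<phi> a\<bar> \<le> gram_det \<phi> a / 2"
      using \<rho>(2)[of "a + s *\<^sub>R u"] by (auto simp: scaled_ball_def dist_norm)
  qed
qed

text \<open>Near \<open>a\<close> the remainder of \<open>\<phi>\<close> is at most half of the
  lower bound for the injective derivative. The lower estimate yields the quadratic bound on the
  exponent, the upper one feeds \<open>sexpandable_compose\<close>.\<close>

lemma chart_two_sided_Lipschitz:
  fixes \<phi> :: "real^'d::finite \<Rightarrow> real^'m"
  assumes chart: "manifold_chart TYPE('d) M U V \<phi>" and a: "a \<in> V"
  obtains \<rho> B L where "\<rho> > 0" "B > 0" "\<And>h. norm h < \<rho> \<Longrightarrow> a + h \<in> V"
    "\<And>h. norm h < \<rho> \<Longrightarrow> B * norm h \<le> norm (\<phi> (a + h) - \<phi> a)"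
    "\<And>h. norm h < \<rho> \<Longrightarrow> norm (\<phi> (a + h) - \<phi> a) \<le> L * norm h"
proof -
  define A where "A = frechet_derivative \<phi> (at a)"
  have D: "(\<phi> has_derivative A) (at a)" and lin: "linear A" and inj: "inj A"
    using manifold_chart_has_derivative[OF chart a] manifold_chartD(5)[OF chart a] by (auto simp: A_def)
  obtain B where B: "B > 0" "\<And>u. B * norm u \<le> norm (A u)"
    using linear_inj_bounded_below_pos[OF lin inj] by blast
  obtain K where K: "\<And>u. norm (A u) \<le> K * norm u" using linear_bounded[OF lin] by blast
  obtain d where d: "d > 0" "\<And>b. norm (b - a) < d \<Longrightarrow> norm (\<phi> b - \<phi> a - A (b - a)) \<le> (B / 2) * norm (b - a)"
    using D B(1) unfolding has_derivative_at_alt by (meson half_gt_zero)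
  obtain e where e: "e > 0" "ball a e \<subseteq> V"
    using manifold_chartD(2)[OF chart] a open_contains_ball by blast
  show ?thesis
  proof (rule that[of "min d e" "B / 2" "K + B / 2"])
    fix h :: "real^'d" assume h: "norm h < min d e"
    have r: "norm (\<phi> (a + h) - \<phi> a - A h) \<le> (B / 2) * norm h" using d(2)[of "a + h"] h by simp
    show "a + h \<in> V" using h e(2) by (auto simp: dist_norm)
    show "B / 2 * norm h \<le> norm (\<phi> (a + h) - \<phi> a)"
      using norm_triangle_sub[of "A h" "\<phi> (a + h) - \<phi> a"] r B(2)[of h]
      by (simp add: norm_minus_commute)
    show "norm (\<phi> (a + h) - \<phi> a) \<le> (K + B / 2) * norm h"
      using norm_triangle_sub[of "\<phi> (a + h) - \<phi> a" "A h"] r K[of h] by (simp add: distrib_right)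
  qed (use d e B in auto)
qed

lemma smooth_map_sexpandable:
  fixes \<phi> :: "real^'d::finite \<Rightarrow> real^'m" and f :: "real^'m \<Rightarrow> 'b::euclidean_space"
  assumes chart: "manifold_chart TYPE('d) M U V \<phi>" and a: "a \<in> V"
    and f: "smooth_map_on M f" and "n > 0"
  shows "sexpandable n (\<lambda>s u. f (\<phi> (a + s *\<^sub>R u)) \<bullet> j)"
proof -
  have "\<phi> a \<in> M" using manifold_chartD(4)[OF chart a] by simp
  then obtain W G where G: "open W" "\<phi> a \<in> W" "C_inf_on W G" "\<And>z. z \<in> M \<inter> W \<Longrightarrow> G z = f z"
    using f[unfolded smooth_map_on_def, rule_format, of "\<phi> a"] by auto
  obtain \<rho> B L where \<rho>: "\<rho> > 0" "B > 0" "\<And>h. norm h < \<rho> \<Longrightarrow> a + h \<in> V"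
    "\<And>h. norm h < \<rho> \<Longrightarrow> B * norm h \<le> norm (\<phi> (a + h) - \<phi> a)"
    "\<And>h. norm h < \<rho> \<Longrightarrow> norm (\<phi> (a + h) - \<phi> a) \<le> L * norm h"
    using chart_two_sided_Lipschitz[OF chart a] by blast
  define w where "w s u = \<phi> (a + s *\<^sub>R u) - \<phi> a" for s u
  have "sexpandable n (\<lambda>s u. G (\<phi> a + w s u) \<bullet> j)"
  proof (rule sexpandable_compose[OF G(3,2) \<open>n > 0\<close> _ \<rho>(1)])
    show "sexpandable n (\<lambda>s u. w s u \<bullet> i)" for i
      unfolding w_def inner_diff_left
      by (intro sexpandable_minus sexpandable_const sexpandable_C_inf_on[OF manifold_chartD(3)[OF chart] a] \<open>n > 0\<close>)
    show "norm (w s u) \<le> L * norm (s *\<^sub>R u)" if "(s, u) \<in> scaled_ball \<rho>" for s u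
      unfolding w_def using that by (intro \<rho>(5)) (auto simp: scaled_ball_def)
  qed
  then obtain c where c: "sexp n (\<lambda>s u. G (\<phi> a + w s u) \<bullet> j) c" unfolding sexpandable_def by blast
  have "isCont \<phi> a" using manifold_chart_has_derivative(1)[OF chart a] by (rule has_derivative_continuous)
  then have "(\<phi> \<longlongrightarrow> \<phi> a) (at a)" by (simp add: isCont_def)
  then have "\<forall>\<^sub>F b in at a. \<phi> b \<in> W" using G(1,2) by (rule topological_tendstoD)
  then obtain e where e: "e > 0" "\<And>b. b \<noteq> a \<Longrightarrow> dist b a < e \<Longrightarrow> \<phi> b \<in> W"
    unfolding eventually_at by auto
  have "sexp n (\<lambda>s u. f (\<phi> (a + s *\<^sub>R u)) \<bullet> j) c"
  proof (rule sexp_cong[OF c])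
    show "min \<rho> e > 0" using \<rho> e by simp
    fix s :: real and u :: "real^'d" assume su: "(s, u) \<in> scaled_ball (min \<rho> e)"
    then have "\<phi> (a + s *\<^sub>R u) \<in> M"
      using manifold_chartD(4)[OF chart \<rho>(3)[of "s *\<^sub>R u"]] by (auto simp: scaled_ball_def)
    moreover have "\<phi> (a + s *\<^sub>R u) \<in> W"
      using e(2)[of "a + s *\<^sub>R u"] G(2) su by (cases "s *\<^sub>R u = 0") (auto simp: scaled_ball_def dist_norm)
    ultimately show "f (\<phi> (a + s *\<^sub>R u)) \<bullet> j = G (\<phi> a + w s u) \<bullet> j"
      using G(4) by (simp add: w_def)
  qed
  then show ?thesis unfolding sexpandable_def by blast
qed

text \<open>Both factors are of order \<open>s\<close>, so the coefficients of orders 0 and 1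
  vanish; order six is required because the division by \<open>s^2\<close> has to leave order
  four.\<close>

lemma sexp_product_vanishing:
  assumes XY: "sexpandable 6 (\<lambda>s u. X s u * Y s u)"
    and X: "\<And>u. ((\<lambda>s. X s u / s) \<longlongrightarrow> \<xi> u) (at_right 0)" and Y: "\<And>u. ((\<lambda>s. Y s u / s) \<longlongrightarrow> \<eta> u) (at_right 0)"
  obtains P where "sexp 4 (\<lambda>s u. X s u * Y s u / s\<^sup>2) P" "\<And>u. P 0 u = \<xi> u * \<eta> u"
proof -
  obtain c where c: "sexp 6 (\<lambda>s u. X s u * Y s u) c" using XY unfolding sexpandable_def by blast
  have lim2: "((\<lambda>s. X s u * Y s u / s\<^sup>2) \<longlongrightarrow> \<xi> u * \<eta> u) (at_right 0)" for u
    using tendsto_mult[OF X Y, of u u] by (simp add: power2_eq_square)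
  have lim: "((\<lambda>s. X s u * Y s u / s ^ k) \<longlongrightarrow> 0) (at_right 0)" if "k < 2" for k u
  proof -
    have "((\<lambda>s. s ^ (2 - k) * (X s u * Y s u / s\<^sup>2)) \<longlongrightarrow> 0 ^ (2 - k) * (\<xi> u * \<eta> u)) (at_right 0)"
      by (intro tendsto_intros lim2)
    moreover have "(0 :: real) ^ (2 - k) = 0" using that by simp
    ultimately have "((\<lambda>s. s ^ (2 - k) * (X s u * Y s u / s\<^sup>2)) \<longlongrightarrow> 0) (at_right 0)"
      by simp
    moreover have "\<forall>\<^sub>F s in at_right 0. s ^ (2 - k) * (X s u * Y s u / s\<^sup>2) = X s u * Y s u / s ^ k"
      using eventually_at_right_less[of "0::real"]
    proof eventually_elim
      case (elim s)
      have "s\<^sup>2 = s ^ k * s ^ (2 - k)" using that by (simp flip: power_add)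
      with elim show ?case by simp
    qed
    ultimately show ?thesis by (rule Lim_transform_eventually)
  qed
  have c0: "c 0 u = 0" for u by (rule sexp_coef_eqI[OF c _ _ lim]) auto
  have c1: "c 1 u = 0" for u by (rule sexp_coef_eqI[OF c _ _ lim]) (auto simp: c0)
  have c01: "c k u = 0" if "k < 2" for k u using that c0 c1 by (cases "k = 0") (auto simp: less_2_cases_iff)
  have c2: "c 2 u = \<xi> u * \<eta> u" for u by (rule sexp_coef_eqI[OF c _ _ lim2]) (auto simp: c01)
  show ?thesis
  proof (rule that)
    show "sexp 4 (\<lambda>s u. X s u * Y s u / s\<^sup>2) (\<lambda>k. c (2 + k))"
      using sexp_shift[of 2 4, OF _ c01] c by simp
    show "c (2 + 0) u = \<xi> u * \<eta> u" for u using c2 by simp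
  qed
qed

lemma directional_limit:
  fixes f :: "'a::real_normed_vector \<Rightarrow> 'b::euclidean_space"
  assumes "(f has_derivative A) (at a)"
  shows "((\<lambda>s. (f (a + s *\<^sub>R u) \<bullet> i - f a \<bullet> i) / s) \<longlongrightarrow> A u \<bullet> i) (at_right 0)"
proof -
  have "((\<lambda>t::real. a + t *\<^sub>R u) has_vector_derivative u) (at 0)"
    by (auto intro!: derivative_eq_intros)
  from has_vector_derivative_compose[OF this, of f A] assms
  have "((\<lambda>t. f (a + t *\<^sub>R u)) has_vector_derivative A u) (at 0)" by (simp add: comp_def)
  then have "((\<lambda>t. f (a + t *\<^sub>R u) \<bullet> i) has_vector_derivative A u \<bullet> i) (at 0)"
    by (rule bounded_linear.has_vector_derivative[OF bounded_linear_inner_left])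
  then have "((\<lambda>s. (f (a + s *\<^sub>R u) \<bullet> i - f a \<bullet> i) / s) \<longlongrightarrow> A u \<bullet> i) (at 0)"
    by (simp add: has_real_derivative_iff_has_vector_derivative[symmetric] has_field_derivative_iff)
  then show ?thesis by (rule filterlim_mono[OF _ order_refl at_le]) simp
qed

section \<open>Riemannian volume and integrals in a chart\<close>

lemma chart_image_open:
  assumes chart: "manifold_chart t M U V \<phi>" and "open S" "S \<subseteq> V"
  obtains T where "open T" "\<phi> ` S = M \<inter> U \<inter> T"
proof -
  obtain \<psi> where \<psi>: "homeomorphism V (M \<inter> U) \<phi> \<psi>" using chart by (auto simp: manifold_chart_def)
  have "openin (top_of_set V) S" using assms(2,3) by (simp add: open_openin_trans open_subset)
  then have "openin (top_of_set (M \<inter> U)) (\<phi> ` S)" by (rule homeomorphism_imp_open_map[OF \<psi>])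
  then show ?thesis using that unfolding openin_open by blast
qed

lemma riemannian_volume_AE:
  assumes "riemannian_volume t M \<mu>" "compact M"
  shows "AE z in \<mu>. z \<in> M"
proof (rule AE_I)
  show "{z \<in> space \<mu>. z \<notin> M} \<subseteq> UNIV - M" by auto
  show "emeasure \<mu> (UNIV - M) = 0" using assms(1) by (simp add: riemannian_volume_def)
  have "sets \<mu> = sets borel" using assms(1) by (simp add: riemannian_volume_def)
  then show "UNIV - M \<in> sets \<mu>" using borel_compact[OF assms(2)] by auto
qed

text \<open>\<open>riemannian_volume\<close> prescribes only measures of images of sets. Agreement
  on Borel sets identifies the volume restricted to the chart domain with an image of a weighted
  Lebesgue measure, and integrals follow from the equality of measures.\<close>

lemma riemannian_volume_chart_integral:
  fixes \<phi> :: "real^'d::finite \<Rightarrow> real^'m" and F :: "real^'m \<Rightarrow> real"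
  assumes vol: "riemannian_volume TYPE('d) M \<mu>" and chart: "manifold_chart TYPE('d) M U V \<phi>"
    and "compact M" and "open S" "S \<subseteq> V" and [measurable]: "F \<in> borel_measurable borel"
  shows "(\<integral>z. indicator (\<phi> ` S) z * F z \<partial>\<mu>) =
    (\<integral>a. indicator S a * (sqrt (gram_det \<phi> a) * F (if a \<in> V then \<phi> a else 0)) \<partial>lborel)"
proof -
  note chartD = manifold_chartD[OF chart]
  obtain \<psi> where \<psi>: "homeomorphism V (M \<inter> U) \<phi> \<psi>" using chart by (auto simp: manifold_chart_def)
  have inj: "inj_on \<phi> V" using \<psi> by (metis homeomorphism_def inj_on_inverseI)
  have sets\<mu>: "sets \<mu> = sets borel" using vol by (simp add: riemannian_volume_def)
  have [measurable]: "V \<in> sets borel" "S \<in> sets borel" using chartD(2) \<open>open S\<close> by auto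
  have MU[measurable]: "M \<inter> U \<in> sets borel"
    using \<open>compact M\<close> chartD(1) by (auto intro: borel_compact)
  \<comment> \<open>The chart is continuous on \<open>V\<close> only; the default value 0 outside
    makes it a Borel function on the whole space, and the vanishing of \<open>J\<close> there hides
    the default.\<close>
  define \<phi>' where "\<phi>' a = (if a \<in> V then \<phi> a else 0)" for a
  have \<phi>'[measurable]: "\<phi>' \<in> borel_measurable borel"
    unfolding \<phi>'_def using C_inf_on_continuous_on[OF chartD(3), of "[]"]
    by (intro borel_measurable_continuous_on_if) auto
  define J where "J a = (if a \<in> V then sqrt (gram_det \<phi> a) else 0)" for a
  have J[measurable]: "J \<in> borel_measurable borel"
    unfolding J_def using continuous_on_gram_det[OF chart]
    by (intro borel_measurable_continuous_on_if) (auto intro!: continuous_intros)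
  have J_nonneg: "J a \<ge> 0" for a
    by (auto simp: J_def intro: less_imp_le gram_det_pos[OF chart])
  have [measurable]: "\<phi> ` S \<in> sets borel"
  proof -
    obtain T where "open T" "\<phi> ` S = M \<inter> U \<inter> T" using chart_image_open[OF chart \<open>open S\<close> \<open>S \<subseteq> V\<close>] by blast
    then show ?thesis by auto
  qed
  have transport: "density \<mu> (indicator (M \<inter> U)) = distr (density lborel (\<lambda>a. ennreal (J a))) borel \<phi>'"
  proof (rule measure_eqI)
    show "sets (density \<mu> (indicator (M \<inter> U))) = sets (distr (density lborel (\<lambda>a. ennreal (J a))) borel \<phi>')"
      by (simp add: sets\<mu>)
    fix E assume "E \<in> sets (density \<mu> (indicator (M \<inter> U)))"
    then have E[measurable]: "E \<in> sets borel" by (simp add: sets\<mu>)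
    define A where "A = V \<inter> \<phi>' -` E"
    have A[measurable]: "A \<in> sets borel"
      unfolding A_def using measurable_sets[OF \<phi>' E] by auto
    have "\<phi> ` A = E \<inter> (M \<inter> U)"
    proof
      show "\<phi> ` A \<subseteq> E \<inter> (M \<inter> U)" using chartD(4) by (auto simp: A_def \<phi>'_def)
      show "E \<inter> (M \<inter> U) \<subseteq> \<phi> ` A"
      proof
        fix z assume z: "z \<in> E \<inter> (M \<inter> U)"
        then have "\<psi> z \<in> V" "\<phi> (\<psi> z) = z"
          using homeomorphism_apply2[OF \<psi>] homeomorphism_image2[OF \<psi>] by auto
        with z show "z \<in> \<phi> ` A" by (intro image_eqI[of _ _ "\<psi> z"]) (auto simp: A_def \<phi>'_def)
      qed
    qed
    have "emeasure (density \<mu> (indicator (M \<inter> U))) E = (\<integral>\<^sup>+z. indicator (M \<inter> U) z * indicator E z \<partial>\<mu>)"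
      using E MU by (subst emeasure_density) (auto simp: sets\<mu> measurable_cong_sets[OF sets\<mu> refl])
    also have "\<dots> = (\<integral>\<^sup>+z. indicator (\<phi> ` A) z \<partial>\<mu>)"
      unfolding \<open>\<phi> ` A = _\<close> by (intro nn_integral_cong) (auto split: split_indicator)
    also have "\<dots> = emeasure \<mu> (\<phi> ` A)"
      using E MU unfolding \<open>\<phi> ` A = _\<close> by (subst nn_integral_indicator) (auto simp: sets\<mu>)
    also have "\<dots> = (\<integral>\<^sup>+a\<in>A. ennreal (sqrt (gram_det \<phi> a)) \<partial>lborel)"
      unfolding gram_det_def
      by (rule vol[unfolded riemannian_volume_def, THEN conjunct2, THEN conjunct2, rule_format, of U V \<phi> A])
        (use chart A in \<open>auto simp: A_def\<close>)
    also have "\<dots> = (\<integral>\<^sup>+a. ennreal (J a) * indicator (\<phi>' -` E) a \<partial>lborel)"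
      by (intro nn_integral_cong) (auto simp: J_def A_def split: split_indicator)
    also have "\<dots> = emeasure (distr (density lborel (\<lambda>a. ennreal (J a))) borel \<phi>') E"
      using measurable_sets[OF \<phi>' E] by (subst emeasure_distr) (auto simp: emeasure_density)
    finally show "emeasure (density \<mu> (indicator (M \<inter> U))) E = emeasure (distr (density lborel (\<lambda>a. ennreal (J a))) borel \<phi>') E" .
  qed
  have "(\<integral>z. indicator (\<phi> ` S) z * F z \<partial>\<mu>) = (\<integral>z. indicator (M \<inter> U) z *\<^sub>R (indicator (\<phi> ` S) z * F z) \<partial>\<mu>)"
    using chartD(4) \<open>S \<subseteq> V\<close> by (intro Bochner_Integration.integral_cong) (auto split: split_indicator)
  also have "\<dots> = (\<integral>z. indicator (\<phi> ` S) z * F z \<partial>density \<mu> (\<lambda>z. ennreal (indicator (M \<inter> U) z)))"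
    by (subst integral_density) (auto simp: measurable_cong_sets[OF sets\<mu> refl])
  also have "density \<mu> (\<lambda>z. ennreal (indicator (M \<inter> U) z)) = distr (density lborel (\<lambda>a. ennreal (J a))) borel \<phi>'"
    by (simp add: transport[symmetric] ennreal_indicator)
  also have "(\<integral>z. indicator (\<phi> ` S) z * F z \<partial>\<dots>) = (\<integral>a. J a *\<^sub>R (indicator (\<phi> ` S) (\<phi>' a) * F (\<phi>' a)) \<partial>lborel)"
    by (subst integral_distr) (auto simp: integral_density J_nonneg)
  also have "\<dots> = (\<integral>a. indicator S a * (sqrt (gram_det \<phi> a) * F (if a \<in> V then \<phi> a else 0)) \<partial>lborel)"
  proof (intro Bochner_Integration.integral_cong refl)
    fix a
    show "J a *\<^sub>R (indicator (\<phi> ` S) (\<phi>' a) * F (\<phi>' a)) =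
        indicator S a * (sqrt (gram_det \<phi> a) * F (if a \<in> V then \<phi> a else 0))"
      using \<open>S \<subseteq> V\<close> inj_on_image_mem_iff[OF inj _ \<open>S \<subseteq> V\<close>, of a]
      by (cases "a \<in> V") (auto simp: J_def \<phi>'_def split: split_indicator)
  qed
  finally show ?thesis .
qed

text \<open>A consequence of \<open>(1 + y / k) ^ k \<le> exp y\<close>; it makes the part of the
  integral far from \<open>x\<close> smaller than a prescribed power of \<open>s\<close>.\<close>

lemma exp_minus_le_power:
  fixes y :: real
  assumes "y > 0"
  shows "exp (- y) \<le> (real k / y) ^ k"
proof (cases "k = 0")
  case False
  have "(1 + y / real k) ^ k \<le> exp y"
    using exp_ge_one_plus_x_over_n_power_n[of k y] assms False by simp
  moreover have "(y / real k) ^ k \<le> (1 + y / real k) ^ k"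
    using assms by (intro power_mono) auto
  ultimately have "(y / real k) ^ k \<le> exp y" by linarith
  moreover have "(y / real k) ^ k > 0" using assms False by simp
  ultimately have "inverse (exp y) \<le> inverse ((y / real k) ^ k)" by (rule le_imp_inverse_le)
  then show ?thesis by (simp add: exp_minus power_inverse[symmetric])
qed (use assms in simp)

text \<open>Not normalized: for \<open>f = 1\<close> it is the almost sure limit of
  \<open>kernel_sum\<close> divided by the number of samples.\<close>

definition gauss_mean :: "(real^'m) measure \<Rightarrow> real^'m \<Rightarrow> real \<Rightarrow> (real^'m \<Rightarrow> real) \<Rightarrow> real" where
  "gauss_mean \<nu> x \<epsilon> f = (\<integral>z. exp (- (norm (z - x))\<^sup>2 / (2 * \<epsilon>)) * f z \<partial>\<nu>)"

text \<open>The integral is split at a chart neighbourhood of \<open>x\<close>: the inner part is a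
  Laplace integral, the outer part is exponentially small. The parameter \<open>m\<close> is the
  power of \<open>s\<close> that \<open>f\<close> releases near \<open>x\<close>, namely 0 for the
  denominator and 2 for the numerator.\<close>

theorem gauss_mean_expansion:
  fixes \<phi> :: "real^'d::finite \<Rightarrow> real^'m" and f p :: "real^'m \<Rightarrow> real"
  assumes vol: "riemannian_volume TYPE('d) M \<mu>" and chart: "manifold_chart TYPE('d) M U V \<phi>"
    and M: "compact M" and a: "a \<in> V" "\<phi> a = x"
    and [measurable]: "p \<in> borel_measurable borel" "f \<in> borel_measurable borel"
    and p_nonneg: "\<And>z. p z \<ge> 0" and \<nu>: "\<nu> = density \<mu> (\<lambda>z. ennreal (p z))" and "prob_space \<nu>"
    and f_bdd: "\<And>z. \<bar>f z\<bar> \<le> b"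
    and g: "sexp 4 (\<lambda>s u. f (\<phi> (a + s *\<^sub>R u)) * (p (\<phi> (a + s *\<^sub>R u)) * sqrt (gram_det \<phi> (a + s *\<^sub>R u))) / s ^ m) P"
  defines "A \<equiv> frechet_derivative \<phi> (at a)"
  shows "\<exists>B K. \<forall>\<epsilon>. 0 < \<epsilon> \<and> \<epsilon> \<le> 1 \<longrightarrow>
    \<bar>gauss_mean \<nu> x \<epsilon> f / sqrt \<epsilon> ^ (CARD('d) + m) - (\<integral>u. exp (- (norm (A u))\<^sup>2 / 2) * P 0 u \<partial>lborel) - \<epsilon> * B\<bar> \<le> K * \<epsilon>\<^sup>2"
proof -
  interpret prob_space \<nu> by fact
  note chartD = manifold_chartD[OF chart]
  have sets\<mu>: "sets \<mu> = sets borel" using vol by (simp add: riemannian_volume_def)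
  have sets\<nu>[measurable_cong]: "sets \<nu> = sets borel" by (simp add: \<nu> sets\<mu>)
  have AE_M: "AE z in \<nu>. z \<in> M"
  proof -
    have "AE z in \<mu>. z \<in> M" by (rule riemannian_volume_AE[OF vol M])
    then show ?thesis unfolding \<nu> by (subst AE_density) (auto simp: measurable_cong_sets[OF sets\<mu> refl])
  qed
  obtain \<rho> B0 L where \<rho>: "\<rho> > 0" "B0 > 0" "\<And>h. norm h < \<rho> \<Longrightarrow> a + h \<in> V"
    "\<And>h. norm h < \<rho> \<Longrightarrow> B0 * norm h \<le> norm (\<phi> (a + h) - \<phi> a)"
    "\<And>h. norm h < \<rho> \<Longrightarrow> norm (\<phi> (a + h) - \<phi> a) \<le> L * norm h"
    using chart_two_sided_Lipschitz[OF chart a(1)] by blast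
  define \<phi>' where "\<phi>' b = (if b \<in> V then \<phi> b else 0)" for b
  have [measurable]: "V \<in> sets borel" using chartD(2) by auto
  have [measurable]: "\<phi>' \<in> borel_measurable borel"
    unfolding \<phi>'_def using C_inf_on_continuous_on[OF chartD(3), of "[]"]
    by (intro borel_measurable_continuous_on_if) auto
  define J where "J b = (if b \<in> V then sqrt (gram_det \<phi> b) else 0)" for b
  have [measurable]: "J \<in> borel_measurable borel"
    unfolding J_def using continuous_on_gram_det[OF chart]
    by (intro borel_measurable_continuous_on_if) (auto intro!: continuous_intros)
  define q where "q h = (norm (\<phi>' (a + h) - x))\<^sup>2" for h
  define g' where "g' h = f (\<phi>' (a + h)) * (p (\<phi>' (a + h)) * J (a + h))" for h
  have [measurable]: "q \<in> borel_measurable borel" "g' \<in> borel_measurable borel"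
    unfolding q_def g'_def by measurable
  have inV: "a + s *\<^sub>R u \<in> V" if "(s, u) \<in> scaled_ball \<rho>" for s u
    using that \<rho>(3)[of "s *\<^sub>R u"] by (auto simp: scaled_ball_def)

  \<comment> \<open>The exponent is a sum of squares of these coordinate differences; each is of
    order \<open>s\<close>, with the component of \<open>A u\<close> as its leading
    coefficient.\<close>
  define X where "X i s u = \<phi> (a + s *\<^sub>R u) \<bullet> i - \<phi> a \<bullet> i" for i s u
  have X_lim: "((\<lambda>s. X i s u / s) \<longlongrightarrow> A u \<bullet> i) (at_right 0)" for i u
    unfolding X_def A_def by (rule directional_limit[OF manifold_chart_has_derivative(1)[OF chart a(1)]])
  have X_exp: "sexpandable 6 (X i)" for i
    unfolding X_def
    by (intro sexpandable_minus sexpandable_const sexpandable_C_inf_on[OF chartD(3) a(1)]) auto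
  have "\<forall>i. \<exists>Q. sexp 4 (\<lambda>s u. X i s u * X i s u / s\<^sup>2) Q \<and> (\<forall>u. Q 0 u = (A u \<bullet> i) * (A u \<bullet> i))"
    by (rule allI, rule sexp_product_vanishing[OF sexpandable_mult[OF X_exp X_exp] X_lim X_lim]) blast
  from choice[OF this]
  obtain Qi where Qi: "\<And>i. sexp 4 (\<lambda>s u. X i s u * X i s u / s\<^sup>2) (Qi i)"
    "\<And>i u. Qi i 0 u = (A u \<bullet> i) * (A u \<bullet> i)" by auto
  define Q where "Q = (\<lambda>k u. \<Sum>i\<in>Basis. Qi i k u)"
  have "sexp 4 (\<lambda>s u. \<Sum>i\<in>I. X i s u * X i s u / s\<^sup>2) (\<lambda>k u. \<Sum>i\<in>I. Qi i k u)" if "finite I" for I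
    using that
  proof (induction I rule: finite_induct)
    case empty
    show ?case using sexp_const[of 4 0] by simp
  next
    case (insert i I)
    then show ?case using sexp_add[OF Qi(1)[of i] insert.IH] by simp
  qed
  from this[of Basis] have "sexp 4 (\<lambda>s u. \<Sum>i\<in>Basis. X i s u * X i s u / s\<^sup>2) Q" by (simp add: Q_def)
  then have q_exp: "sexp 4 (\<lambda>s u. q (s *\<^sub>R u) / s\<^sup>2) Q"
  proof (rule sexp_cong[OF _ \<rho>(1)])
    fix s :: real and u :: "real^'d" assume "(s, u) \<in> scaled_ball \<rho>"
    from inV[OF this] have "q (s *\<^sub>R u) = (\<Sum>i\<in>Basis. X i s u * X i s u)"
      unfolding q_def \<phi>'_def power2_norm_eq_inner
      by (subst euclidean_inner) (simp add: X_def a(2) inner_diff_left)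
    then show "q (s *\<^sub>R u) / s\<^sup>2 = (\<Sum>i\<in>Basis. X i s u * X i s u / s\<^sup>2)"
      by (simp add: sum_divide_distrib)
  qed
  have Q0: "Q 0 u = (norm (A u))\<^sup>2" for u
    unfolding Q_def Qi(2) power2_norm_eq_inner by (subst euclidean_inner) simp
  have g_exp: "sexp 4 (\<lambda>s u. g' (s *\<^sub>R u) / s ^ m) P"
    by (rule sexp_cong[OF g \<rho>(1)]) (use inV in \<open>auto simp: g'_def \<phi>'_def J_def\<close>)
  have q_ge: "B0\<^sup>2 * (norm h)\<^sup>2 \<le> q h" if "norm h < \<rho>" for h
  proof -
    have "(B0 * norm h)\<^sup>2 \<le> (norm (\<phi> (a + h) - \<phi> a))\<^sup>2"
      using \<rho>(2,4) that by (intro power_mono) auto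
    then show ?thesis using \<rho>(3)[OF that] a(2) by (simp add: q_def \<phi>'_def power_mult_distrib)
  qed
  obtain \<rho>1 B K where \<rho>1: "0 < \<rho>1" "\<rho>1 \<le> \<rho>" and lap: "\<And>s. 0 < s \<Longrightarrow> s \<le> 1 \<Longrightarrow>
      \<bar>(\<integral>h. indicator (ball 0 \<rho>1) h * exp (- q h / (2 * s\<^sup>2)) * g' h \<partial>lborel) / s ^ (CARD('d) + m)
        - (\<integral>u. exp (- Q 0 u / 2) * P 0 u \<partial>lborel) - s\<^sup>2 * B\<bar> \<le> K * s ^ 4"
    using Laplace_expansion[of q g' "B0\<^sup>2" \<rho>, OF _ _ _ \<rho>(1) q_ge q_exp g_exp] \<rho>(2) by auto
  define S where "S = ball a \<rho>1"
  have S: "open S" "S \<subseteq> V"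
  proof -
    show "S \<subseteq> V"
    proof
      fix b assume "b \<in> S"
      then have "norm (b - a) < \<rho>" using \<rho>1(2) by (simp add: S_def dist_norm norm_minus_commute)
      from \<rho>(3)[OF this] show "b \<in> V" by simp
    qed
  qed (simp add: S_def)
  \<comment> \<open>Since \<open>\<phi>\<close> is a homeomorphism onto a relatively open set, the
    image of \<open>S\<close> is cut out of \<open>M\<close> by an open set. Hence no other point of
    \<open>M\<close> comes arbitrarily close to \<open>x\<close>, even if it lies outside the
    chart.\<close>
  obtain T where T: "open T" "\<phi> ` S = M \<inter> U \<inter> T" using chart_image_open[OF chart S] by blast
  have \<phi>S[measurable]: "\<phi> ` S \<in> sets borel" using T chartD(1) borel_compact[OF M] by auto
  have "x \<in> \<phi> ` S" using a(2) \<rho>1(1) by (auto simp: S_def)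
  then have "open (U \<inter> T)" "x \<in> U \<inter> T" using T chartD(1) by auto
  then obtain r where r: "r > 0" "ball x r \<subseteq> U \<inter> T"
    unfolding open_contains_ball by blast
  have far: "r \<le> norm (z - x)" if "z \<in> M" "z \<notin> \<phi> ` S" for z
  proof (rule ccontr)
    assume "\<not> r \<le> norm (z - x)"
    then have "z \<in> ball x r" by (simp add: dist_norm norm_minus_commute)
    with r(2) that T(2) show False by auto
  qed
  \<comment> \<open>After division by \<open>s ^ (CARD('d) + m)\<close> a bound by
    \<open>s ^ k\<close> still leaves \<open>s ^ 4\<close>.\<close>
  define k where "k = CARD('d) + m + 4"
  \<comment> \<open>The constant of \<open>exp_minus_le_power\<close> at
    \<open>y = r^2 / (2 s^2)\<close>, times the bound on \<open>f\<close>.\<close>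
  define C where "C = \<bar>b\<bar> * (2 * real k / r\<^sup>2) ^ k"
  have "0 \<le> b" using f_bdd[of 0] by linarith
  have main: "\<bar>gauss_mean \<nu> x (s\<^sup>2) f / s ^ (CARD('d) + m) - (\<integral>u. exp (- Q 0 u / 2) * P 0 u \<partial>lborel) - s\<^sup>2 * B\<bar> \<le> (K + C) * s ^ 4"
    if s: "0 < s" "s \<le> 1" for s
  proof -
    define w where "w z = exp (- (norm (z - x))\<^sup>2 / (2 * s\<^sup>2)) * f z" for z
    have [measurable]: "w \<in> borel_measurable borel" unfolding w_def by measurable
    have w_le: "\<bar>w z\<bar> \<le> exp (- (norm (z - x))\<^sup>2 / (2 * s\<^sup>2)) * b" for z
      unfolding w_def using f_bdd[of z] by (simp add: abs_mult mult_left_mono)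
    have w_b: "\<bar>w z\<bar> \<le> b" for z
    proof -
      have "exp (- (norm (z - x))\<^sup>2 / (2 * s\<^sup>2)) * b \<le> 1 * b" using \<open>0 \<le> b\<close> s by (intro mult_right_mono) auto
      with w_le[of z] show ?thesis by linarith
    qed
    have int_in: "integrable \<nu> (\<lambda>z. indicator (\<phi> ` S) z * w z)"
      by (rule integrable_const_bound[of _ b]) (use w_b \<open>0 \<le> b\<close> in \<open>auto split: split_indicator\<close>)
    have int_out: "integrable \<nu> (\<lambda>z. indicator (- \<phi> ` S) z * w z)"
      by (rule integrable_const_bound[of _ b]) (use w_b \<open>0 \<le> b\<close> in \<open>auto split: split_indicator\<close>)
    have "gauss_mean \<nu> x (s\<^sup>2) f = (\<integral>z. indicator (\<phi> ` S) z * w z + indicator (- \<phi> ` S) z * w z \<partial>\<nu>)"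
      unfolding gauss_mean_def w_def
      by (intro Bochner_Integration.integral_cong refl) (auto split: split_indicator)
    then have split: "gauss_mean \<nu> x (s\<^sup>2) f = (\<integral>z. indicator (\<phi> ` S) z * w z \<partial>\<nu>) + (\<integral>z. indicator (- \<phi> ` S) z * w z \<partial>\<nu>)"
      using int_in int_out by simp
    have "(\<integral>z. indicator (\<phi> ` S) z * w z \<partial>\<nu>) = (\<integral>z. p z *\<^sub>R (indicator (\<phi> ` S) z * w z) \<partial>\<mu>)"
      unfolding \<nu> using p_nonneg by (subst integral_density) (auto simp: measurable_cong_sets[OF sets\<mu> refl])
    also have "\<dots> = (\<integral>z. indicator (\<phi> ` S) z * (p z * w z) \<partial>\<mu>)" by (simp add: mult_ac)
    also have "\<dots> = (\<integral>c. indicator S c * (sqrt (gram_det \<phi> c) * (p (if c \<in> V then \<phi> c else 0) * w (if c \<in> V then \<phi> c else 0))) \<partial>lborel)"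
      by (rule riemannian_volume_chart_integral[OF vol chart M S]) measurable
    also have "\<dots> = (\<integral>c. indicator S c * (J c * (p (\<phi>' c) * w (\<phi>' c))) \<partial>lborel)"
      using S(2) by (intro Bochner_Integration.integral_cong) (auto simp: J_def \<phi>'_def split: split_indicator)
    also have "\<dots> = (\<integral>h. indicator S (a + h) * (J (a + h) * (p (\<phi>' (a + h)) * w (\<phi>' (a + h)))) \<partial>lborel)"
      using S(1) by (subst lborel_integral_affine[where c=1 and t=a]) auto
    also have "\<dots> = (\<integral>h. indicator (ball 0 \<rho>1) h * exp (- q h / (2 * s\<^sup>2)) * g' h \<partial>lborel)"
      by (intro Bochner_Integration.integral_cong)
        (auto simp: S_def dist_norm w_def q_def g'_def split: split_indicator)
    finally have inner: "(\<integral>z. indicator (\<phi> ` S) z * w z \<partial>\<nu>) = (\<integral>h. indicator (ball 0 \<rho>1) h * exp (- q h / (2 * s\<^sup>2)) * g' h \<partial>lborel)" .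
    have outer: "\<bar>\<integral>z. indicator (- \<phi> ` S) z * w z \<partial>\<nu>\<bar> \<le> C * s ^ k"
    proof -
      have bd: "AE z in \<nu>. \<bar>indicator (- \<phi> ` S) z * w z\<bar> \<le> exp (- (r\<^sup>2 / (2 * s\<^sup>2))) * b"
        using AE_M
      proof eventually_elim
        case (elim z)
        show ?case
        proof (cases "z \<in> \<phi> ` S")
          case False
          have "r\<^sup>2 \<le> (norm (z - x))\<^sup>2" using far[OF elim False] r(1) by (intro power_mono) auto
          then have "exp (- (norm (z - x))\<^sup>2 / (2 * s\<^sup>2)) \<le> exp (- (r\<^sup>2 / (2 * s\<^sup>2)))"
            using s by (simp add: divide_right_mono)
          then have "exp (- (norm (z - x))\<^sup>2 / (2 * s\<^sup>2)) * b \<le> exp (- (r\<^sup>2 / (2 * s\<^sup>2))) * b"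
            using \<open>0 \<le> b\<close> by (rule mult_right_mono)
          with w_le[of z] False show ?thesis by simp
        qed (use \<open>0 \<le> b\<close> in simp)
      qed
      have "\<bar>\<integral>z. indicator (- \<phi> ` S) z * w z \<partial>\<nu>\<bar> \<le> (\<integral>z. exp (- (r\<^sup>2 / (2 * s\<^sup>2))) * b \<partial>\<nu>)"
        by (rule order_trans[OF integral_abs_bound], rule integral_mono_AE) (use int_out bd in auto)
      also have "\<dots> = exp (- (r\<^sup>2 / (2 * s\<^sup>2))) * b" by (simp add: prob_space)
      also have "\<dots> \<le> (real k / (r\<^sup>2 / (2 * s\<^sup>2))) ^ k * b"
        using r(1) s \<open>0 \<le> b\<close> by (intro mult_right_mono exp_minus_le_power) auto
      also have "\<dots> = C * s ^ (2 * k)"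
      proof -
        have "real k / (r\<^sup>2 / (2 * s\<^sup>2)) = (2 * real k / r\<^sup>2) * s\<^sup>2" by simp
        then show ?thesis using \<open>0 \<le> b\<close> by (simp add: C_def power_mult_distrib power_mult[symmetric] del: times_divide_eq_left times_divide_eq_right)
      qed
      also have "\<dots> \<le> C * s ^ k"
        using s r(1) by (intro mult_left_mono power_decreasing) (auto simp: C_def)
      finally show ?thesis .
    qed
    have "\<bar>(\<integral>z. indicator (- \<phi> ` S) z * w z \<partial>\<nu>) / s ^ (CARD('d) + m)\<bar> \<le> C * s ^ 4"
      using outer s by (simp add: k_def power_add abs_divide divide_le_eq mult_ac)
    moreover note lap[OF s]
    ultimately show ?thesis
      unfolding split inner add_divide_distrib distrib_right by linarith
  qed
  show ?thesis
  proof (intro exI allI impI)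
    fix \<epsilon> :: real assume "0 < \<epsilon> \<and> \<epsilon> \<le> 1"
    then have s: "0 < sqrt \<epsilon>" "sqrt \<epsilon> \<le> 1" "(sqrt \<epsilon>)\<^sup>2 = \<epsilon>" by auto
    have "sqrt \<epsilon> ^ 4 = ((sqrt \<epsilon>)\<^sup>2)\<^sup>2" by simp
    then have s4: "sqrt \<epsilon> ^ 4 = \<epsilon>\<^sup>2" unfolding s(3) .
    show "\<bar>gauss_mean \<nu> x \<epsilon> f / sqrt \<epsilon> ^ (CARD('d) + m) - (\<integral>u. exp (- (norm (A u))\<^sup>2 / 2) * P 0 u \<partial>lborel) - \<epsilon> * B\<bar> \<le> (K + C) * \<epsilon>\<^sup>2"
      using main[OF s(1,2)] unfolding s(3) s4 Q0 .
  qed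
qed

section \<open>The limit theorem\<close>

lemma smooth_map_on_continuous_on:
  assumes "smooth_map_on M f"
  shows "continuous_on M f"
  unfolding continuous_on_eq_continuous_within
proof
  fix q assume "q \<in> M"
  then obtain W G where G: "open W" "q \<in> W" "C_inf_on W G" "\<And>z. z \<in> M \<inter> W \<Longrightarrow> G z = f z"
    using assms[unfolded smooth_map_on_def, rule_format, of q] by auto
  have "isCont G q"
    using C_inf_on_differentiable[OF G(3,2)] by (rule differentiable_imp_continuous_within)
  then have "continuous (at q within M \<inter> W) G" by (rule continuous_at_imp_continuous_at_within)
  then have "continuous (at q within M \<inter> W) f"
    by (rule continuous_transform_within[of _ _ _ 1]) (use \<open>q \<in> M\<close> G in auto)
  \<comment> \<open>Continuity within \<open>M\<close> is local, so cutting down to the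
    neighbourhood \<open>W\<close> does not change it.\<close>
  then show "continuous (at q within M) f"
    using at_within_nhd[OF G(2,1), of "M \<inter> W" M] by (simp add: continuous_within Int_assoc)
qed

text \<open>\<open>Q\<close> and \<open>R\<close> solve
  \<open>N0 + \<epsilon> N1 = (Q + \<epsilon> R) (D0 + \<epsilon> D1)\<close> up to second order.
  Estimating \<open>n - (Q + \<epsilon> R) d\<close> before dividing leaves only terms of order
  \<open>\<epsilon>^2\<close>.\<close>

lemma ratio_expansion:
  fixes n d :: "real \<Rightarrow> real"
  assumes n: "\<And>\<epsilon>. 0 < \<epsilon> \<Longrightarrow> \<epsilon> \<le> 1 \<Longrightarrow> \<bar>n \<epsilon> - N0 - \<epsilon> * N1\<bar> \<le> K * \<epsilon>\<^sup>2"
    and d: "\<And>\<epsilon>. 0 < \<epsilon> \<Longrightarrow> \<epsilon> \<le> 1 \<Longrightarrow> \<bar>d \<epsilon> - D0 - \<epsilon> * D1\<bar> \<le> K' * \<epsilon>\<^sup>2"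
    and "D0 > 0"
  shows "\<exists>R C \<delta>. \<delta> > 0 \<and> (\<forall>\<epsilon>. 0 < \<epsilon> \<and> \<epsilon> < \<delta> \<longrightarrow> \<bar>n \<epsilon> / d \<epsilon> - N0 / D0 - \<epsilon> * R\<bar> \<le> C * \<epsilon>\<^sup>2)"
proof -
  define Q where "Q = N0 / D0"
  define R where "R = (N1 - Q * D1) / D0"
  have Q: "Q * D0 = N0" and R: "R * D0 = N1 - Q * D1"
    using \<open>D0 > 0\<close> by (simp_all add: Q_def R_def)
  have "0 \<le> K" using n[of 1] by (rule_tac order_trans[OF abs_ge_zero]) simp
  have "0 \<le> K'" using d[of 1] by (rule_tac order_trans[OF abs_ge_zero]) simp
  \<comment> \<open>Small enough for the corrections to \<open>D0\<close> to stay below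
    \<open>D0 / 2\<close>, so that \<open>d \<epsilon> \<ge> D0 / 2\<close>; the added 1 keeps the
    divisor positive.\<close>
  define \<delta> where "\<delta> = min 1 (D0 / (2 * (\<bar>D1\<bar> + K' + 1)))"
  have den: "\<bar>D1\<bar> + K' + 1 > 0" using \<open>0 \<le> K'\<close> by linarith
  define C where "C = (K + (\<bar>Q\<bar> + \<bar>R\<bar>) * K' + \<bar>R * D1\<bar>) / (D0 / 2)"
  show ?thesis
  proof (intro exI conjI allI impI)
    show "\<delta> > 0" using \<open>D0 > 0\<close> den by (simp add: \<delta>_def)
    fix \<epsilon> assume "0 < \<epsilon> \<and> \<epsilon> < \<delta>"
    then have e: "0 < \<epsilon>" "\<epsilon> \<le> 1" "\<epsilon> < D0 / (2 * (\<bar>D1\<bar> + K' + 1))" by (auto simp: \<delta>_def)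
    have e2: "\<epsilon>\<^sup>2 \<le> \<epsilon>" using e by (simp add: power2_eq_square mult_left_le)
    have "\<epsilon> * (\<bar>D1\<bar> + K' + 1) < D0 / 2" using e(3) den by (simp add: field_simps)
    moreover have "\<epsilon> * (\<bar>D1\<bar> + K' + 1) = \<epsilon> * \<bar>D1\<bar> + \<epsilon> * K' + \<epsilon>" by (simp add: algebra_simps)
    moreover have "K' * \<epsilon>\<^sup>2 \<le> \<epsilon> * K'" using e2 \<open>0 \<le> K'\<close> by (simp add: mult.commute[of \<epsilon>] mult_left_mono)
    moreover have "\<bar>\<epsilon> * D1\<bar> = \<epsilon> * \<bar>D1\<bar>" using e by (simp add: abs_mult)
    ultimately have d_ge: "d \<epsilon> \<ge> D0 / 2" using d[OF e(1,2)] e(1) by linarith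
    then have d_pos: "d \<epsilon> > 0" using \<open>D0 > 0\<close> by linarith
    define A where "A = n \<epsilon> - N0 - \<epsilon> * N1"
    define B where "B = d \<epsilon> - D0 - \<epsilon> * D1"
    have "n \<epsilon> - (Q + \<epsilon> * R) * d \<epsilon> = A - (Q + \<epsilon> * R) * B + (N0 - Q * D0) + \<epsilon> * (N1 - Q * D1 - R * D0) - \<epsilon>\<^sup>2 * (R * D1)"
      by (simp add: A_def B_def algebra_simps power2_eq_square)
    then have eq: "n \<epsilon> - (Q + \<epsilon> * R) * d \<epsilon> = A - (Q + \<epsilon> * R) * B - \<epsilon>\<^sup>2 * (R * D1)"
      by (simp add: Q R)
    have "\<bar>(Q + \<epsilon> * R) * B\<bar> \<le> (\<bar>Q\<bar> + \<bar>R\<bar>) * (K' * \<epsilon>\<^sup>2)"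
      unfolding abs_mult
    proof (intro mult_mono)
      have "\<epsilon> * \<bar>R\<bar> \<le> 1 * \<bar>R\<bar>" using e by (intro mult_right_mono) auto
      then show "\<bar>Q + \<epsilon> * R\<bar> \<le> \<bar>Q\<bar> + \<bar>R\<bar>" using abs_triangle_ineq[of Q "\<epsilon> * R"] e by (simp add: abs_mult)
    qed (use d[OF e(1,2)] in \<open>auto simp: B_def\<close>)
    moreover have "\<bar>A\<bar> \<le> K * \<epsilon>\<^sup>2" unfolding A_def by (rule n[OF e(1,2)])
    moreover have "\<bar>\<epsilon>\<^sup>2 * (R * D1)\<bar> = \<bar>R * D1\<bar> * \<epsilon>\<^sup>2" by (simp add: abs_mult)
    ultimately have "\<bar>n \<epsilon> - (Q + \<epsilon> * R) * d \<epsilon>\<bar> \<le> K * \<epsilon>\<^sup>2 + (\<bar>Q\<bar> + \<bar>R\<bar>) * (K' * \<epsilon>\<^sup>2) + \<bar>R * D1\<bar> * \<epsilon>\<^sup>2"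
      unfolding eq by linarith
    also have "\<dots> = C * (D0 / 2) * \<epsilon>\<^sup>2" using \<open>D0 > 0\<close> by (simp add: C_def field_simps)
    also have "\<dots> \<le> C * \<epsilon>\<^sup>2 * d \<epsilon>"
    proof -
      have "C \<ge> 0" using \<open>D0 > 0\<close> \<open>0 \<le> K\<close> \<open>0 \<le> K'\<close> by (simp add: C_def)
      then have "(C * \<epsilon>\<^sup>2) * (D0 / 2) \<le> (C * \<epsilon>\<^sup>2) * d \<epsilon>" using d_ge by (intro mult_left_mono) auto
      then show ?thesis by (simp add: mult_ac)
    qed
    finally have "\<bar>n \<epsilon> - (Q + \<epsilon> * R) * d \<epsilon>\<bar> / d \<epsilon> \<le> C * \<epsilon>\<^sup>2" using d_pos by (simp add: divide_le_eq)
    moreover have "n \<epsilon> / d \<epsilon> - N0 / D0 - \<epsilon> * R = (n \<epsilon> - (Q + \<epsilon> * R) * d \<epsilon>) / d \<epsilon>"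
      using d_pos by (simp add: Q_def[symmetric] field_simps)
    ultimately show "\<bar>n \<epsilon> / d \<epsilon> - N0 / D0 - \<epsilon> * R\<bar> \<le> C * \<epsilon>\<^sup>2"
      using d_pos by (simp add: abs_divide)
  qed
qed

section \<open>Empirical averages and their limits\<close>

lemma weighted_mean_strong_law:
  fixes Xs :: "nat \<Rightarrow> 'w \<Rightarrow> real^'m"
  assumes "prob_space P" and indep: "prob_space.indep_vars P (\<lambda>_. borel) Xs UNIV"
    and distr: "\<And>i. distr P borel (Xs i) = \<nu>"
    and f[measurable]: "f \<in> borel_measurable borel" and f_bdd: "\<And>z. \<bar>f z\<bar> \<le> b" and "\<epsilon> > 0"
  shows "AE \<omega> in P. (\<lambda>n. (\<Sum>i<n. exp (- (norm (Xs i \<omega> - x))\<^sup>2 / (2 * \<epsilon>)) * f (Xs i \<omega>)) / real n)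
    \<longlonglongrightarrow> gauss_mean \<nu> x \<epsilon> f"
proof -
  interpret prob_space P by fact
  define F where "F z = exp (- (norm (z - x))\<^sup>2 / (2 * \<epsilon>)) * f z" for z
  have F[measurable]: "F \<in> borel_measurable borel" unfolding F_def by measurable
  have Xs[measurable]: "random_variable borel (Xs i)" for i
    using indep unfolding indep_vars_def by blast
  have \<nu>[measurable_cong]: "sets \<nu> = sets borel" using distr[of 0] by (auto simp: sets_distr[symmetric])
  have "AE \<omega> in P. (\<lambda>n. (\<Sum>i<n. F (Xs i \<omega>)) / real n) \<longlonglongrightarrow> (\<integral>t. t \<partial>distr \<nu> borel F)"
  proof (rule bounded_iid_strong_law[OF \<open>prob_space P\<close>])
    show "indep_vars (\<lambda>_. borel) (\<lambda>i \<omega>. F (Xs i \<omega>)) UNIV"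
      by (rule indep_vars_compose2[OF indep]) (rule F)
    show "distr P borel (\<lambda>\<omega>. F (Xs i \<omega>)) = distr \<nu> borel F" for i
      unfolding distr[of i, symmetric] by (subst distr_distr) (auto simp: comp_def)
    have "\<bar>F z\<bar> \<le> b" for z
    proof -
      have "exp (- (norm (z - x))\<^sup>2 / (2 * \<epsilon>)) * \<bar>f z\<bar> \<le> 1 * \<bar>f z\<bar>"
        using \<open>\<epsilon> > 0\<close> by (intro mult_right_mono) auto
      with f_bdd[of z] show ?thesis by (simp add: F_def abs_mult)
    qed
    then show "AE t in distr \<nu> borel F. \<bar>t\<bar> \<le> b" by (subst AE_distr_iff) auto
  qed
  moreover have "(\<integral>t. t \<partial>distr \<nu> borel F) = gauss_mean \<nu> x \<epsilon> f"
    unfolding gauss_mean_def F_def[symmetric] by (subst integral_distr) auto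
  ultimately show ?thesis by (simp add: F_def)
qed

text \<open>Each column carries the square root of the kernel and of the normalization; the product
  of two columns restores both, which exhibits the entry as a quotient of two sample sums.\<close>

lemma emp_YXt_nth:
  "emp_YXt \<epsilon> x xs H n $ a $ b =
    (\<Sum>j<n. exp (- (norm (xs j - x))\<^sup>2 / (2 * \<epsilon>)) * ((H (xs j) - H x) $ a * (xs j - x) $ b)) / kernel_sum \<epsilon> x xs n"
proof -
  have ks: "kernel_sum \<epsilon> x xs n \<ge> 0" by (simp add: kernel_sum_def sum_nonneg)
  have "colY \<epsilon> x xs H n j $ a * colX \<epsilon> x xs n j $ b =
      exp (- (norm (xs j - x))\<^sup>2 / (2 * \<epsilon>)) * ((H (xs j) - H x) $ a * (xs j - x) $ b) / kernel_sum \<epsilon> x xs n" for j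
  proof -
    let ?e = "exp (- (norm (xs j - x))\<^sup>2 / (4 * \<epsilon>))"
    have e: "?e * ?e = exp (- (norm (xs j - x))\<^sup>2 / (2 * \<epsilon>))" by (simp add: exp_add[symmetric])
    have k: "(1 / sqrt (kernel_sum \<epsilon> x xs n)) * (1 / sqrt (kernel_sum \<epsilon> x xs n)) = 1 / kernel_sum \<epsilon> x xs n"
      using ks by simp
    have "colY \<epsilon> x xs H n j $ a * colX \<epsilon> x xs n j $ b =
        ((1 / sqrt (kernel_sum \<epsilon> x xs n)) * (1 / sqrt (kernel_sum \<epsilon> x xs n))) * (?e * ?e) * ((H (xs j) - H x) $ a * (xs j - x) $ b)"
      by (simp only: colX_def colY_def vector_scaleR_component real_scaleR_def mult_ac)
    then show ?thesis unfolding e k by simp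
  qed
  then show ?thesis by (simp add: emp_YXt_def sum_divide_distrib)
qed

lemma norm_matrix_le: "norm A \<le> (\<Sum>i\<in>UNIV. \<Sum>j\<in>UNIV. \<bar>A $ i $ j\<bar>)" for A :: "real^'m^'n"
proof -
  have "norm A \<le> (\<Sum>i\<in>UNIV. norm (A $ i))"
    unfolding norm_vec_def by (rule L2_set_le_sum) simp
  also have "\<dots> \<le> (\<Sum>i\<in>UNIV. \<Sum>j\<in>UNIV. \<bar>A $ i $ j\<bar>)"
    by (intro sum_mono norm_le_l1_cart)
  finally show ?thesis .
qed

lemma integral_pos:
  fixes f :: "'a \<Rightarrow> real"
  assumes f: "integrable M f" "\<And>x. f x > 0" and "emeasure M (space M) \<noteq> 0"
  shows "(\<integral>x. f x \<partial>M) > 0"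
proof -
  have "(\<integral>x. f x \<partial>M) \<noteq> 0"
  proof
    assume "(\<integral>x. f x \<partial>M) = 0"
    then have "AE x in M. f x = 0"
      using f by (subst (asm) integral_nonneg_eq_0_iff_AE) (auto intro: less_imp_le)
    then have "AE x in M. False" by eventually_elim (use f(2) less_irrefl in metis)
    then show False
      using assms(3) by (simp add: eventually_False ae_filter_eq_bot_iff)
  qed
  moreover have "(\<integral>x. f x \<partial>M) \<ge> 0"
    using f(2) by (intro Bochner_Integration.integral_nonneg) (simp add: less_imp_le)
  ultimately show ?thesis by simp
qed

lemma borel_measurable_vec_component [measurable]: "(\<lambda>v::real^'n::finite. v $ i) \<in> borel_measurable borel"
  by (intro borel_measurable_continuous_onI continuous_intros)

theorem theorem2:
  fixes M :: "(real^'m) set" and N :: "(real^'n) set"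
    and \<mu> :: "(real^'m) measure" and p :: "real^'m \<Rightarrow> real"
    and H :: "real^'m \<Rightarrow> real^'n"
    and P :: "'w measure" and Xs :: "nat \<Rightarrow> 'w \<Rightarrow> real^'m"
    and x :: "real^'m"
  assumes "compact M"
    and "smooth_embedded_submanifold TYPE('d::finite) M"
    and "riemannian_volume TYPE('d) M \<mu>"
    and "smooth_map_on M p" and "\<forall>z\<in>M. p z > 0"
    and "prob_space P"
    and "prob_space.indep_vars P (\<lambda>_. borel) Xs UNIV"
    and "\<forall>i. distr P borel (Xs i) = density \<mu> (\<lambda>z. ennreal (p z))"
    and "smooth_embedded_submanifold TYPE('e::finite) N"
    and "smooth_map_on M H" and "H ` M \<subseteq> N"
    and "x \<in> M"
  shows "\<exists>(R::real^'m^'n) (L::real \<Rightarrow> real^'m^'n).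
           (\<forall>\<epsilon>>0. AE \<omega> in P. (\<lambda>Nn. (1 / \<epsilon>) *\<^sub>R emp_YXt \<epsilon> x (\<lambda>j. Xs j \<omega>) H Nn) \<longlonglongrightarrow> L \<epsilon>) \<and>
           (\<exists>C \<delta>. \<delta> > 0 \<and> (\<forall>\<epsilon>. 0 < \<epsilon> \<and> \<epsilon> < \<delta> \<longrightarrow>
              norm (L \<epsilon> - DH_hat TYPE('d) TYPE('e) M N H x - \<epsilon> *\<^sub>R R) \<le> C * \<epsilon>\<^sup>2))"
proof -
  interpret P: prob_space P by fact
  \<comment> \<open>Nothing is assumed about \<open>p\<close> and \<open>H\<close> off
    \<open>M\<close>. The zero extensions are Borel, and they agree with the originals at almost
    every sample.\<close>
  define p' where "p' z = (if z \<in> M then p z else 0)" for z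
  define H' where "H' z = (if z \<in> M then H z else 0)" for z
  have M[measurable]: "M \<in> sets borel" using \<open>compact M\<close> by (rule borel_compact)
  have contp: "continuous_on M p" and contH: "continuous_on M H"
    using assms(4,10) by (auto intro: smooth_map_on_continuous_on)
  have [measurable]: "p' \<in> borel_measurable borel" "H' \<in> borel_measurable borel"
    unfolding p'_def H'_def by (intro borel_measurable_continuous_on_if contp contH M continuous_on_const)+
  have p'_nonneg: "p' z \<ge> 0" for z using assms(5) by (auto simp: p'_def less_imp_le)
  have sets\<mu>: "sets \<mu> = sets borel" using assms(3) by (simp add: riemannian_volume_def)
  have AE\<mu>: "AE z in \<mu>. z \<in> M" by (rule riemannian_volume_AE[OF assms(3,1)])
  define \<nu> where "\<nu> = density \<mu> (\<lambda>z. ennreal (p' z))"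
  \<comment> \<open>\<open>p\<close> need not be measurable off \<open>M\<close>, so the densities
    are compared by unfolding \<open>density_def\<close> and using equality of the integrands almost
    everywhere.\<close>
  have "density \<mu> (\<lambda>z. ennreal (p z)) = \<nu>"
  proof -
    have "(\<integral>\<^sup>+z. ennreal (p z) * indicator A z \<partial>\<mu>) = (\<integral>\<^sup>+z. ennreal (p' z) * indicator A z \<partial>\<mu>)" for A
      by (rule nn_integral_cong_AE) (use AE\<mu> in \<open>eventually_elim, simp add: p'_def\<close>)
    then show ?thesis by (simp add: \<nu>_def density_def)
  qed
  then have distr: "distr P borel (Xs i) = \<nu>" for i using assms(8) by simp
  have Xs[measurable]: "Xs i \<in> borel_measurable P" for i
    using assms(7) unfolding P.indep_vars_def by blast
  have "prob_space \<nu>" unfolding distr[of 0, symmetric] by (rule P.prob_space_distr) (rule Xs)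
  then interpret \<nu>: prob_space \<nu> .
  have sets\<nu>[measurable_cong]: "sets \<nu> = sets borel" by (simp add: \<nu>_def sets\<mu>)
  have AE\<nu>: "AE z in \<nu>. z \<in> M"
    unfolding \<nu>_def by (subst AE_density) (use AE\<mu> in \<open>auto simp: measurable_cong_sets[OF sets\<mu> refl]\<close>)
  have AE_Xs: "AE \<omega> in P. \<forall>i. Xs i \<omega> \<in> M"
    unfolding AE_all_countable
  proof
    show "AE \<omega> in P. Xs i \<omega> \<in> M" for i
      using AE\<nu> unfolding distr[of i, symmetric] by (subst (asm) AE_distr_iff) auto
  qed

  obtain U V and \<phi> :: "real^'d \<Rightarrow> real^'m" where "x \<in> U" and chart: "manifold_chart TYPE('d) M U V \<phi>"
    using assms(2,12) unfolding smooth_embedded_submanifold_def by blast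
  then obtain a where a: "a \<in> V" "\<phi> a = x"
    using assms(12) unfolding manifold_chart_def homeomorphism_def by blast
  define A where "A = frechet_derivative \<phi> (at a)"
  note D\<phi> = manifold_chart_has_derivative[OF chart a(1), folded A_def]
  have inj: "inj A" using manifold_chartD(5)[OF chart a(1)] by (simp add: A_def)
  obtain W G where G: "open W" "x \<in> W" "C_inf_on W G" "\<And>z. z \<in> M \<inter> W \<Longrightarrow> G z = H z"
    using assms(10)[unfolded smooth_map_on_def, rule_format, OF assms(12)] by auto
  define L where "L = frechet_derivative G (at x)"
  have DG: "(G has_derivative L) (at x)"
    using C_inf_on_differentiable[OF G(3,2)] by (simp add: L_def frechet_derivative_works[symmetric])
  have linL: "linear L" using DG by (rule has_derivative_linear)

  obtain \<rho> where \<rho>: "\<rho> > 0" "\<And>h. norm h < \<rho> \<Longrightarrow> a + h \<in> V"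
    by (rule chart_two_sided_Lipschitz[OF chart a(1)]) blast
  have inM: "\<phi> (a + s *\<^sub>R u) \<in> M" if "(s, u) \<in> scaled_ball \<rho>" for s u
    using that manifold_chartD(4)[OF chart \<rho>(2)[of "s *\<^sub>R u"]] by (auto simp: scaled_ball_def)

  \<comment> \<open>The density of the sampling law in chart coordinates. Only its value
    \<open>w0\<close> at \<open>a\<close> enters the leading terms, as a common factor of numerator
    and denominator.\<close>
  define w where "w s u = p' (\<phi> (a + s *\<^sub>R u)) * sqrt (gram_det \<phi> (a + s *\<^sub>R u))" for s u
  define w0 where "w0 = p x * sqrt (gram_det \<phi> a)"
  have "w0 > 0" unfolding w0_def using assms(5,12) gram_det_pos[OF chart a(1)] by simp
  have "sexpandable 4 (\<lambda>s u. (p (\<phi> (a + s *\<^sub>R u)) \<bullet> 1) * sqrt (gram_det \<phi> (a + s *\<^sub>R u)))"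
    using smooth_map_sexpandable[OF chart a(1) assms(4), of 4 1] gram_det_sexpandable[OF chart a(1)]
    by (intro sexpandable_mult) simp_all
  then obtain wc where "sexp 4 (\<lambda>s u. p (\<phi> (a + s *\<^sub>R u)) * sqrt (gram_det \<phi> (a + s *\<^sub>R u))) wc"
    unfolding sexpandable_def by auto
  then have wc: "sexp 4 w wc"
    by (rule sexp_cong[OF _ \<rho>(1)]) (simp add: w_def p'_def inM)
  have wc0: "wc 0 u = w0" for u
  proof (rule sexp_coef_eqI[OF wc])
    have "continuous_on V (\<lambda>b. p (\<phi> b) * sqrt (gram_det \<phi> b))"
      using continuous_on_gram_det[OF chart] C_inf_on_continuous_on[OF manifold_chartD(3)[OF chart], of "[]"]
        manifold_chartD(4)[OF chart]
      by (intro continuous_intros continuous_on_compose2[OF contp]) auto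
    then have "isCont (\<lambda>b. p (\<phi> b) * sqrt (gram_det \<phi> b)) a"
      using manifold_chartD(2)[OF chart] a(1) by (simp add: continuous_on_eq_continuous_at)
    from isCont_tendsto_compose[OF this tendsto_line_at_right]
    have lim: "((\<lambda>s. p (\<phi> (a + s *\<^sub>R u)) * sqrt (gram_det \<phi> (a + s *\<^sub>R u))) \<longlongrightarrow> w0) (at_right 0)"
      by (simp add: w0_def a(2))
    have "\<forall>\<^sub>F s in at_right 0. norm (s *\<^sub>R u) < \<rho>"
      using \<rho>(1) by (rule eventually_norm_scaleR_less)
    then have "\<forall>\<^sub>F s in at_right 0. p (\<phi> (a + s *\<^sub>R u)) * sqrt (gram_det \<phi> (a + s *\<^sub>R u)) = w s u / s ^ 0"
    proof eventually_elim
      case (elim s)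
      then have "\<phi> (a + s *\<^sub>R u) \<in> M" using manifold_chartD(4)[OF chart \<rho>(2)[OF elim]] by simp
      then show ?case by (simp add: w_def p'_def)
    qed
    with lim show "((\<lambda>s. w s u / s ^ 0) \<longlongrightarrow> w0) (at_right 0)" by (rule Lim_transform_eventually)
  qed auto

  define Z where "Z = (\<integral>u. exp (- (norm (A u))\<^sup>2 / 2) \<partial>lborel)"
  have Z_int: "integrable lborel (\<lambda>u. exp (- (norm (A u))\<^sup>2 / 2))"
    using D\<phi>(2) inj by (rule integrable_gaussian_weight)
  have "Z > 0"
    unfolding Z_def by (rule integral_pos[OF Z_int]) auto

  define den where "den \<epsilon> = gauss_mean \<nu> x \<epsilon> (\<lambda>_. 1)" for \<epsilon>
  \<comment> \<open>The indicator makes the integrand bounded on the whole space, as the strong law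
    requires; almost surely it equals 1 at all samples.\<close>
  define num where "num i j \<epsilon> = gauss_mean \<nu> x \<epsilon> (\<lambda>z. (H' z - H x) $ i * (indicator M z * (z - x) $ j))" for i j \<epsilon>
  define L\<epsilon> where "L\<epsilon> \<epsilon> = (\<chi> i j. (1 / \<epsilon>) * (num i j \<epsilon> / den \<epsilon>))" for \<epsilon>
  obtain bH where bH: "\<And>z. z \<in> M \<Longrightarrow> norm (H z) \<le> bH"
    using compact_imp_bounded[OF compact_continuous_image[OF contH \<open>compact M\<close>]] by (auto simp: bounded_iff)
  obtain bM where bM: "\<And>z. z \<in> M \<Longrightarrow> norm z \<le> bM"
    using compact_imp_bounded[OF \<open>compact M\<close>] by (auto simp: bounded_iff)
  define b where "b = (bH + norm (H x)) * (bM + norm x)"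
  have num_bdd: "\<bar>(H' z - H x) $ i * (indicator M z * (z - x) $ j)\<bar> \<le> b" for z i j
  proof (cases "z \<in> M")
    case True
    have "\<bar>(H z - H x) $ i\<bar> \<le> bH + norm (H x)"
      using component_le_norm_cart[of "H z - H x" i] norm_triangle_ineq4[of "H z" "H x"] bH[OF True] by linarith
    moreover have "\<bar>(z - x) $ j\<bar> \<le> bM + norm x"
      using component_le_norm_cart[of "z - x" j] norm_triangle_ineq4[of z x] bM[OF True] by linarith
    ultimately have "\<bar>(H z - H x) $ i\<bar> * \<bar>(z - x) $ j\<bar> \<le> b"
      unfolding b_def by (intro mult_mono) auto
    then show ?thesis using True by (simp add: H'_def abs_mult)
  next
    case False
    have "0 \<le> bH" "0 \<le> bM" using bH[OF assms(12)] bM[OF assms(12)] norm_ge_zero order_trans by blast+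
    then show ?thesis using False by (simp add: b_def)
  qed
  have num_meas[measurable]: "(\<lambda>z. (H' z - H x) $ i * (indicator M z * (z - x) $ j)) \<in> borel_measurable borel" for i j
    by measurable
  have den_pos: "den \<epsilon> > 0" if "\<epsilon> > 0" for \<epsilon>
  proof -
    have int: "integrable \<nu> (\<lambda>z. exp (- (norm (z - x))\<^sup>2 / (2 * \<epsilon>)))"
      by (rule \<nu>.integrable_const_bound[of _ 1]) (use that in auto)
    show ?thesis
      using integral_pos[OF int] by (simp add: den_def gauss_mean_def \<nu>.emeasure_space_1)
  qed

  have conv: "AE \<omega> in P. (\<lambda>n. (1 / \<epsilon>) *\<^sub>R emp_YXt \<epsilon> x (\<lambda>j. Xs j \<omega>) H n) \<longlonglongrightarrow> L\<epsilon> \<epsilon>" if "\<epsilon> > 0" for \<epsilon>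
  proof -
    have "AE \<omega> in P. \<forall>i\<in>UNIV. \<forall>j\<in>UNIV. (\<lambda>n. (\<Sum>k<n. exp (- (norm (Xs k \<omega> - x))\<^sup>2 / (2 * \<epsilon>)) *
        ((H' (Xs k \<omega>) - H x) $ i * (indicator M (Xs k \<omega>) * (Xs k \<omega> - x) $ j))) / real n) \<longlonglongrightarrow> num i j \<epsilon>"
      unfolding num_def
      by (intro AE_finite_allI weighted_mean_strong_law[OF assms(6,7) distr num_meas num_bdd that]) auto
    moreover have "AE \<omega> in P. (\<lambda>n. (\<Sum>k<n. exp (- (norm (Xs k \<omega> - x))\<^sup>2 / (2 * \<epsilon>)) * 1) / real n) \<longlonglongrightarrow> den \<epsilon>"
      unfolding den_def by (rule weighted_mean_strong_law[OF assms(6,7) distr _ _ that, of _ 1]) auto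
    ultimately show ?thesis using AE_Xs
    proof eventually_elim
      case (elim \<omega>)
      show ?case
      proof (intro vec_tendstoI)
        fix i j
        let ?n = "\<lambda>n. \<Sum>k<n. exp (- (norm (Xs k \<omega> - x))\<^sup>2 / (2 * \<epsilon>)) * ((H (Xs k \<omega>) - H x) $ i * (Xs k \<omega> - x) $ j)"
        let ?d = "\<lambda>n. kernel_sum \<epsilon> x (\<lambda>j. Xs j \<omega>) n"
        have "(\<lambda>n. ?n n / real n) \<longlonglongrightarrow> num i j \<epsilon>"
          using elim(1,3) by (simp add: H'_def)
        moreover have "(\<lambda>n. ?d n / real n) \<longlonglongrightarrow> den \<epsilon>"
          using elim(2) by (simp add: kernel_sum_def)
        \<comment> \<open>Both sums are divided by \<open>n\<close>, which cancels for
          \<open>n > 0\<close>; the limit of the denominator is positive.\<close>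
        ultimately have "(\<lambda>n. (1 / \<epsilon>) * ((?n n / real n) / (?d n / real n))) \<longlonglongrightarrow> (1 / \<epsilon>) * (num i j \<epsilon> / den \<epsilon>)"
          using den_pos[OF that] by (intro tendsto_intros) auto
        moreover have "\<forall>\<^sub>F n in sequentially. (1 / \<epsilon>) * ((?n n / real n) / (?d n / real n)) =
            ((1 / \<epsilon>) *\<^sub>R emp_YXt \<epsilon> x (\<lambda>j. Xs j \<omega>) H n) $ i $ j"
          using eventually_gt_at_top[of 0] by eventually_elim (simp add: emp_YXt_nth)
        ultimately show "(\<lambda>n. ((1 / \<epsilon>) *\<^sub>R emp_YXt \<epsilon> x (\<lambda>j. Xs j \<omega>) H n) $ i $ j) \<longlonglongrightarrow> L\<epsilon> \<epsilon> $ i $ j"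
          unfolding L\<epsilon>_def by (auto intro: Lim_transform_eventually)
      qed
    qed
  qed

  obtain D1 KD where D_exp: "\<And>\<epsilon>. 0 < \<epsilon> \<Longrightarrow> \<epsilon> \<le> 1 \<Longrightarrow> \<bar>den \<epsilon> / sqrt \<epsilon> ^ CARD('d) - w0 * Z - \<epsilon> * D1\<bar> \<le> KD * \<epsilon>\<^sup>2"
  proof -
    have "sexp 4 (\<lambda>s u. (1::real) * (p' (\<phi> (a + s *\<^sub>R u)) * sqrt (gram_det \<phi> (a + s *\<^sub>R u))) / s ^ 0) wc"
      using wc by (simp add: w_def[abs_def])
    from gauss_mean_expansion[OF assms(3) chart assms(1) a _ _ p'_nonneg \<nu>_def \<nu>.prob_space_axioms _ this, of 1]
    show ?thesis using that by (auto simp: den_def A_def[symmetric] wc0 Z_def mult.commute)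
  qed
  define T where "T = tangent_basis TYPE('d) M x"
  note T = tangent_basis_orthonormal[OF assms(2,12), folded T_def]
  have T_A: "span (range (\<lambda>c. T $ c)) = range A"
    using T(2) tangent_space_chart[OF chart a(1)] by (simp add: a(2) A_def)
  define DH where "DH = DH_hat TYPE('d) TYPE('e) M N H x"
  have DH: "DH $ i $ j = (\<Sum>c\<in>UNIV. L (T $ c) $ i * T $ c $ j)" for i j
    unfolding DH_def T_def by (rule DH_hat_eq[OF assms(2,9) DG G(1,2,4) assms(11,12)])
  \<comment> \<open>Each row of the tangent basis is \<open>A (v c)\<close>, so integration by parts
    with \<open>w = v c\<close> evaluates the moments against \<open>A u \<bullet> T $ c\<close>.
    Expanding \<open>A u\<close> in the orthonormal basis then reassembles the formula of
    \<open>DH_hat_eq\<close>.\<close>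
  have moment: "(\<integral>u. exp (- (norm (A u))\<^sup>2 / 2) * (L (A u) $ i * A u $ j) \<partial>lborel) = DH $ i $ j * Z" for i j
  proof -
    have "\<exists>v. T $ c = A v" for c
      using span_base[of "T $ c" "range (\<lambda>c. T $ c)"] T_A by auto
    then obtain v where v: "\<And>c. T $ c = A (v c)" by metis
    have lin: "linear (\<lambda>u. L (A u) $ i)"
      using linear_compose[OF D\<phi>(2) linL] by (auto simp: linear_iff comp_def)
    have part: "(\<integral>u. exp (- (norm (A u))\<^sup>2 / 2) * (L (A u) $ i * (A u \<bullet> T $ c)) \<partial>lborel) = L (T $ c) $ i * Z" for c
      unfolding v Z_def by (rule gaussian_integration_by_parts[OF D\<phi>(2) inj lin])
    have int: "integrable lborel (\<lambda>u. exp (- (norm (A u))\<^sup>2 / 2) * (L (A u) $ i * (A u \<bullet> T $ c)))" for c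
      by (rule integrable_gaussian_moment2[OF D\<phi>(2) inj lin])
        (use D\<phi>(2) in \<open>auto simp: linear_iff inner_add_left\<close>)
    have "A u $ j = (\<Sum>c\<in>UNIV. (A u \<bullet> T $ c) * T $ c $ j)" for u
    proof -
      have "(\<Sum>c\<in>UNIV. (A u \<bullet> T $ c) *\<^sub>R T $ c) = A u"
        by (rule orthonormal_span_expansion[OF T(1)]) (simp add: T_A)
      from arg_cong[OF this, of "\<lambda>v. v $ j"] show ?thesis by (simp add: sum_component)
    qed
    then have "(\<integral>u. exp (- (norm (A u))\<^sup>2 / 2) * (L (A u) $ i * A u $ j) \<partial>lborel) =
        (\<integral>u. (\<Sum>c\<in>UNIV. exp (- (norm (A u))\<^sup>2 / 2) * (L (A u) $ i * (A u \<bullet> T $ c)) * T $ c $ j) \<partial>lborel)"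
      by (intro Bochner_Integration.integral_cong refl) (simp only: sum_distrib_left mult_ac)
    also have "\<dots> = (\<Sum>c\<in>UNIV. L (T $ c) $ i * Z * T $ c $ j)"
      by (subst Bochner_Integration.integral_sum)
        (simp_all only: integrable_mult_left int integral_mult_left_zero part)
    also have "\<dots> = DH $ i $ j * Z" by (simp add: DH sum_distrib_left mult_ac)
    finally show ?thesis .
  qed
  \<comment> \<open>The exponent exceeds that of the denominator by 2: the integrand is a product of
    two differences, each of order \<open>s\<close>.\<close>
  have N_exp: "\<exists>N1 KN. \<forall>\<epsilon>. 0 < \<epsilon> \<and> \<epsilon> \<le> 1 \<longrightarrow>
      \<bar>num i j \<epsilon> / sqrt \<epsilon> ^ (CARD('d) + 2) - w0 * (DH $ i $ j * Z) - \<epsilon> * N1\<bar> \<le> KN * \<epsilon>\<^sup>2" for i j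
  proof -
    define X where "X s u = H (\<phi> (a + s *\<^sub>R u)) \<bullet> axis i 1 - H (\<phi> a) \<bullet> axis i 1" for s u
    define Y where "Y s u = \<phi> (a + s *\<^sub>R u) \<bullet> axis j 1 - \<phi> a \<bullet> axis j 1" for s u
    have Y_lim: "((\<lambda>s. Y s u / s) \<longlongrightarrow> A u $ j) (at_right 0)" for u
      using directional_limit[OF D\<phi>(1), of u "axis j 1"] by (simp add: Y_def inner_axis)
    \<comment> \<open>The derivative is that of the extension \<open>G\<close>; close to
      \<open>a\<close> the chart stays in both \<open>M\<close> and \<open>W\<close>, where
      \<open>G\<close> and \<open>H\<close> coincide.\<close>
    have X_lim: "((\<lambda>s. X s u / s) \<longlongrightarrow> L (A u) $ i) (at_right 0)" for u
    proof -
      have "((\<lambda>b. G (\<phi> b)) has_derivative (\<lambda>u. L (A u))) (at a)"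
        using has_derivative_compose[OF D\<phi>(1), of G L] DG a(2) by simp
      from directional_limit[OF this, of u "axis i 1"]
      have lim: "((\<lambda>s. (G (\<phi> (a + s *\<^sub>R u)) \<bullet> axis i 1 - G (\<phi> a) \<bullet> axis i 1) / s) \<longlongrightarrow> L (A u) $ i) (at_right 0)"
        by (simp add: inner_axis)
      have "isCont \<phi> a" using D\<phi>(1) by (rule has_derivative_continuous)
      moreover note tendsto_line_at_right
      ultimately have "((\<lambda>s. \<phi> (a + s *\<^sub>R u)) \<longlongrightarrow> x) (at_right 0)"
        unfolding a(2)[symmetric] by (rule isCont_tendsto_compose)
      then have "\<forall>\<^sub>F s in at_right 0. \<phi> (a + s *\<^sub>R u) \<in> W" using G(1,2) by (rule topological_tendstoD)
      moreover have "\<forall>\<^sub>F s in at_right 0. norm (s *\<^sub>R u) < \<rho>"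
        using \<rho>(1) by (rule eventually_norm_scaleR_less)
      ultimately have "\<forall>\<^sub>F s in at_right 0. (G (\<phi> (a + s *\<^sub>R u)) \<bullet> axis i 1 - G (\<phi> a) \<bullet> axis i 1) / s = X s u / s"
      proof eventually_elim
        case (elim s)
        have "\<phi> (a + s *\<^sub>R u) \<in> M" using manifold_chartD(4)[OF chart \<rho>(2)[OF elim(2)]] by simp
        then show ?case using G(2,4) elim(1) a(2) assms(12) by (simp add: X_def)
      qed
      with lim show ?thesis by (rule Lim_transform_eventually)
    qed
    have "sexpandable 6 (\<lambda>s u. X s u * Y s u)"
      unfolding X_def Y_def
      by (intro sexpandable_mult sexpandable_minus sexpandable_const
          sexpandable_C_inf_on[OF manifold_chartD(3)[OF chart] a(1)]
          smooth_map_sexpandable[OF chart a(1) assms(10)]) auto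
    from sexp_product_vanishing[OF this X_lim Y_lim]
    obtain Q where Q: "sexp 4 (\<lambda>s u. X s u * Y s u / s\<^sup>2) Q" "\<And>u. Q 0 u = L (A u) $ i * A u $ j" by blast
    define R where "R k u = (\<Sum>i\<le>k. Q i u * wc (k - i) u)" for k u
    have R: "sexp 4 (\<lambda>s u. X s u * Y s u / s\<^sup>2 * w s u) R"
      unfolding R_def by (rule sexp_mult[OF Q(1) wc])
    have R0: "R 0 u = L (A u) $ i * A u $ j * w0" for u by (simp add: R_def Q(2) wc0)
    have "sexp 4 (\<lambda>s u. ((H' (\<phi> (a + s *\<^sub>R u)) - H x) $ i * (indicator M (\<phi> (a + s *\<^sub>R u)) * (\<phi> (a + s *\<^sub>R u) - x) $ j)) *
        (p' (\<phi> (a + s *\<^sub>R u)) * sqrt (gram_det \<phi> (a + s *\<^sub>R u))) / s ^ 2) R"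
      by (rule sexp_cong[OF R \<rho>(1)]) (simp add: X_def Y_def w_def inM H'_def a(2) inner_axis)
    from gauss_mean_expansion[OF assms(3) chart assms(1) a _ num_meas p'_nonneg \<nu>_def \<nu>.prob_space_axioms num_bdd this]
    have "\<exists>B K. \<forall>\<epsilon>. 0 < \<epsilon> \<and> \<epsilon> \<le> 1 \<longrightarrow>
      \<bar>num i j \<epsilon> / sqrt \<epsilon> ^ (CARD('d) + 2) - (\<integral>u. exp (- (norm (A u))\<^sup>2 / 2) * R 0 u \<partial>lborel) - \<epsilon> * B\<bar> \<le> K * \<epsilon>\<^sup>2"
      by (simp add: num_def A_def[symmetric])
    moreover have "(\<integral>u. exp (- (norm (A u))\<^sup>2 / 2) * R 0 u \<partial>lborel) = w0 * (DH $ i $ j * Z)"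
    proof -
      have "(\<integral>u. exp (- (norm (A u))\<^sup>2 / 2) * R 0 u \<partial>lborel) =
          (\<integral>u. w0 * (exp (- (norm (A u))\<^sup>2 / 2) * (L (A u) $ i * A u $ j)) \<partial>lborel)"
        by (intro Bochner_Integration.integral_cong) (auto simp: R0)
      then show ?thesis by (simp only: integral_mult_right_zero moment)
    qed
    ultimately show ?thesis by simp
  qed

  have "\<exists>R C \<delta>. \<delta> > 0 \<and> (\<forall>\<epsilon>. 0 < \<epsilon> \<and> \<epsilon> < \<delta> \<longrightarrow> \<bar>L\<epsilon> \<epsilon> $ i $ j - DH $ i $ j - \<epsilon> * R\<bar> \<le> C * \<epsilon>\<^sup>2)" for i j
  proof -
    obtain N1 KN where NK: "\<And>\<epsilon>. 0 < \<epsilon> \<Longrightarrow> \<epsilon> \<le> 1 \<Longrightarrow>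
        \<bar>num i j \<epsilon> / sqrt \<epsilon> ^ (CARD('d) + 2) - w0 * (DH $ i $ j * Z) - \<epsilon> * N1\<bar> \<le> KN * \<epsilon>\<^sup>2"
      using N_exp by blast
    have "w0 * Z > 0" using \<open>w0 > 0\<close> \<open>Z > 0\<close> by simp
    from ratio_expansion[OF NK D_exp this] obtain R C \<delta> where RC: "\<delta> > 0"
      "\<And>\<epsilon>. 0 < \<epsilon> \<Longrightarrow> \<epsilon> < \<delta> \<Longrightarrow> \<bar>(num i j \<epsilon> / sqrt \<epsilon> ^ (CARD('d) + 2)) / (den \<epsilon> / sqrt \<epsilon> ^ CARD('d))
          - w0 * (DH $ i $ j * Z) / (w0 * Z) - \<epsilon> * R\<bar> \<le> C * \<epsilon>\<^sup>2" by blast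
    \<comment> \<open>The two extra powers of \<open>sqrt \<epsilon>\<close> in the numerator are
      exactly the prefactor \<open>1 / \<epsilon>\<close> of the theorem.\<close>
    have "(num i j \<epsilon> / sqrt \<epsilon> ^ (CARD('d) + 2)) / (den \<epsilon> / sqrt \<epsilon> ^ CARD('d)) = L\<epsilon> \<epsilon> $ i $ j" if "\<epsilon> > 0" for \<epsilon>
      using that by (simp add: L\<epsilon>_def power_add)
    moreover have "w0 * (DH $ i $ j * Z) / (w0 * Z) = DH $ i $ j"
      using \<open>w0 > 0\<close> \<open>Z > 0\<close> by simp
    ultimately have "\<bar>L\<epsilon> \<epsilon> $ i $ j - DH $ i $ j - \<epsilon> * R\<bar> \<le> C * \<epsilon>\<^sup>2" if "0 < \<epsilon>" "\<epsilon> < \<delta>" for \<epsilon>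
      using RC(2)[OF that] that by simp
    with RC(1) show ?thesis by blast
  qed
  then obtain R C \<delta> where RC: "\<And>i j. \<delta> i j > 0"
    "\<And>i j \<epsilon>. 0 < \<epsilon> \<Longrightarrow> \<epsilon> < \<delta> i j \<Longrightarrow> \<bar>L\<epsilon> \<epsilon> $ i $ j - DH $ i $ j - \<epsilon> * R i j\<bar> \<le> C i j * \<epsilon>\<^sup>2"
    by metis
  \<comment> \<open>A common range of \<epsilon> exists because there are finitely many
    entries.\<close>
  define \<delta>0 where "\<delta>0 = Min (range (\<lambda>(i, j). \<delta> i j))"
  have \<delta>0: "\<delta>0 > 0" "\<delta>0 \<le> \<delta> i j" for i j
    unfolding \<delta>0_def using RC(1) by (auto intro!: Min_le)
  have "norm (L\<epsilon> \<epsilon> - DH - \<epsilon> *\<^sub>R (\<chi> i j. R i j)) \<le> (\<Sum>i\<in>UNIV. \<Sum>j\<in>UNIV. C i j) * \<epsilon>\<^sup>2" if "0 < \<epsilon>" "\<epsilon> < \<delta>0" for \<epsilon>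
  proof -
    have "norm (L\<epsilon> \<epsilon> - DH - \<epsilon> *\<^sub>R (\<chi> i j. R i j)) \<le> (\<Sum>i\<in>UNIV. \<Sum>j\<in>UNIV. \<bar>L\<epsilon> \<epsilon> $ i $ j - DH $ i $ j - \<epsilon> * R i j\<bar>)"
      by (rule order_trans[OF norm_matrix_le]) simp
    also have "\<dots> \<le> (\<Sum>i\<in>UNIV. \<Sum>j\<in>UNIV. C i j * \<epsilon>\<^sup>2)"
      using that \<delta>0 by (intro sum_mono RC(2)) (auto intro: less_le_trans)
    finally show ?thesis by (simp add: sum_distrib_right)
  qed
  with conv \<delta>0(1) show ?thesis unfolding DH_def by blast
qed

end
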